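(* Let $n\ge1$ and let $A$ be an $n\times n$ Hermitian random matrix with probability density $p_n(A)\propto\prod_{i=1}^n w(\lambda_i)$, where $\lambda_1\le\cdots\le\lambda_n$ are the eigenvalues of $A$. For $x\in\mathbb{R}$ let $M_x=\{U\in M\mid \operatorname{tr}(UA)\ge x\}$, where $M=\{hh^*\mid h\in\mathbb{C}^n,\ h^*h=1\}$, and let $\chi(M_x)$ be its Euler characteristic. Then $$\mathbb{E}[\chi(M_x)]=\frac{1}{h_{n-1}}\int_x^\infty\widehat\phi_{n-1}(\lambda)\,w(\lambda)\,d\lambda,\qquad \widehat\phi_{m}(x)=\phi_m(x)\phi_{m+1}'(x)-\phi_{m+1}(x)\phi_m'(x),$$ where $\phi_i$, $i\ge0$, are the monic orthogonal polynomials with respect to $w$ and $h_i=\int_{\mathbb{R}}\phi_i(x)^2w(x)\,dx$.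
   Context: $w:\mathbb{R}\to[0,\infty)$ is a weight function with finite moments of every order and $\int_{\mathbb{R}} w(x)\,dx>0$. The density is with respect to Lebesgue measure on the space of $n\times n$ Hermitian matrices identified with $\mathbb{R}^{n^2}$. The monic orthogonal polynomials $\phi_i$ satisfy $\deg\phi_i=i$ and $\int_{\mathbb{R}}\phi_i(x)\phi_j(x)w(x)\,dx=h_i\delta_{ij}$ with $h_i>0$. *)

theory Defs
  imports
    "HOL-Probability.Probability"
    "HOL-Homology.Homology"
    "HOL-Computational_Algebra.Polynomial"
begin

section \<open>Hermitian matrices\<close>

definition hermitian :: "complex^'n^'n \<Rightarrow> bool" where
  "hermitian A \<longleftrightarrow> (\<forall>i j. A $ i $ j = cnj (A $ j $ i))"

definition charpoly :: "complex^'n^'n \<Rightarrow> complex poly" where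
  "charpoly A = det (mat [:0, 1:] - map_matrix (\<lambda>a. [:a:]) A)"

text \<open>The eigenvalues with multiplicity in increasing order, 0-indexed. All eigenvalues of a
  Hermitian matrix are real, so for such a matrix the list exists; it is always unique.\<close>

definition eigenvalues :: "complex^'n^'n \<Rightarrow> real list" where
  "eigenvalues A =
    (THE ls. sorted ls \<and> charpoly A = (\<Prod>l\<leftarrow>ls. [:- complex_of_real l, 1:]))"

text \<open>
  The identification of the \<open>n \<times> n\<close> Hermitian matrices with the real space of dimension
  \<open>n\<^sup>2\<close>. The coordinates are arranged as a real matrix, so that no order on the index type is
  needed: the symmetric part of \<open>X\<close> is the real part of the Hermitian matrix and its antisymmetric
  part is the imaginary part. This is a linear bijection from real matrices onto Hermitian ones,
  isometric for the Frobenius norms. The pushforward of Lebesgue measure is, up to a constant factor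
  depending only on \<open>n\<close>, the product of all \<open>dA\<^sub>i\<^sub>i\<close> and of all \<open>d(Re A\<^sub>i\<^sub>j) d(Im A\<^sub>i\<^sub>j)\<close> with
  \<open>i < j\<close>.\<close>

definition hermitian_of :: "real^'n^'n \<Rightarrow> complex^'n^'n" where
  "hermitian_of X =
    (\<chi> i j. Complex ((X $ i $ j + X $ j $ i) / 2) ((X $ i $ j - X $ j $ i) / 2))"

definition hermitian_lborel :: "(complex^'n^'n) measure" where
  "hermitian_lborel = distr lborel borel hermitian_of"

section \<open>Euler characteristic\<close>

definition int_independent :: "('g, 'm) monoid_scheme \<Rightarrow> 'g set \<Rightarrow> bool" where
  "int_independent G S \<longleftrightarrow> finite S \<and> S \<subseteq> carrier G \<and>
    (\<forall>c :: 'g \<Rightarrow> int. finprod G (\<lambda>s. s [^]\<^bsub>G\<^esub> c s) S = \<one>\<^bsub>G\<^esub> \<longrightarrow> (\<forall>s\<in>S. c s = 0))"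

text \<open>The rank of an abelian group (written multiplicatively). It is only meaningful if the
  cardinalities below are bounded.\<close>

definition abelian_rank :: "('g, 'm) monoid_scheme \<Rightarrow> nat" where
  "abelian_rank G = Sup (card ` {S. int_independent G S})"

definition betti_number :: "nat \<Rightarrow> 'a topology \<Rightarrow> nat" where
  "betti_number p X = abelian_rank (homology_group (int p) X)"

text \<open>Meaningful for spaces whose Betti numbers are finite and almost all zero.\<close>

definition euler_characteristic :: "'a topology \<Rightarrow> int" where
  "euler_characteristic X =
    (\<Sum>p\<in>{p. betti_number p X \<noteq> 0}. (-1) ^ p * int (betti_number p X))"

section \<open>The manifold of rank-one projections and its excursion sets\<close>

definition rank_one_projections :: "(complex^'n^'n) set" where
  "rank_one_projections =
    {(\<chi> i j. h $ i * cnj (h $ j)) | h :: complex^'n. (\<Sum>i\<in>UNIV. cnj (h $ i) * h $ i) = 1}"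

text \<open>The trace below is a real number when \<open>A\<close> is Hermitian.\<close>

definition excursion_set :: "complex^'n^'n \<Rightarrow> real \<Rightarrow> (complex^'n^'n) set" where
  "excursion_set A x = {U \<in> rank_one_projections. Re (trace (U ** A)) \<ge> x}"

section \<open>Orthogonal polynomials\<close>

definition weight_function :: "(real \<Rightarrow> real) \<Rightarrow> bool" where
  "weight_function w \<longleftrightarrow> (\<forall>x. w x \<ge> 0) \<and>
    (\<forall>k::nat. integrable lborel (\<lambda>x. x ^ k * w x)) \<and> (LBINT x. w x) > 0"

definition monic_orthogonal_polynomials ::
  "(real \<Rightarrow> real) \<Rightarrow> (nat \<Rightarrow> real poly) \<Rightarrow> (nat \<Rightarrow> real) \<Rightarrow> bool" where
  "monic_orthogonal_polynomials w \<phi> h \<longleftrightarrow>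
    (\<forall>i. degree (\<phi> i) = i \<and> lead_coeff (\<phi> i) = 1 \<and> h i > 0) \<and>
    (\<forall>i j. (LBINT x. poly (\<phi> i) x * poly (\<phi> j) x * w x) = (if i = j then h i else 0))"

definition phi_hat :: "(nat \<Rightarrow> real poly) \<Rightarrow> nat \<Rightarrow> real poly" where
  "phi_hat \<phi> m = \<phi> m * pderiv (\<phi> (m + 1)) - \<phi> (m + 1) * pderiv (\<phi> m)"

end

theory Submission
  imports Defs
begin

text \<open>
  Diagonalise \<open>A\<close>, so that \<open>M\<^sub>x\<close> becomes the set of the projections with
  \<open>\<Sum>\<^sub>i \<lambda>\<^sub>i U\<^sub>i\<^sub>i \<ge> x\<close>. Scaling down the coordinates whose eigenvalue is below \<open>x\<close> retracts it onto a
  complex projective space \<open>\<complex>P\<^sup>k\<^sup>-\<^sup>1\<close>, where \<open>k\<close> counts the eigenvalues in \<open>[x, \<infinity>)\<close>. Hence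
  \<open>\<chi>(M\<^sub>x) = k\<close>, and the expectation of \<open>k\<close> is wanted.

  The eigenvalue density \<open>\<Prod>\<^sub>i\<^sub><\<^sub>j (\<lambda>\<^sub>i - \<lambda>\<^sub>j)\<^sup>2 \<Prod>\<^sub>i w(\<lambda>\<^sub>i)\<close> is obtained by induction on the dimension, up to a
  constant. Border a matrix \<open>H\<close> by a column \<open>v\<close> and a corner \<open>a\<close>, and replace \<open>a\<close> by the top eigenvalue
  \<open>\<lambda>\<close> of the result, which solves \<open>a = \<lambda> - v\<^sup>* (\<lambda> - H)\<^sup>-\<^sup>1 v\<close>. With \<open>P = \<lambda> - H\<close> and \<open>v = P u\<close>, the bordered
  matrix is \<open>\<lambda> - N\<^sup>* P N\<close> with \<open>N N\<^sup>* = 1 + u u\<^sup>* = T\<^sup>2\<close>, so that its remaining eigenvalues are those of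
  \<open>K = \<lambda> - T P T\<close>. In the variables \<open>\<lambda>\<close>, \<open>u\<close>, \<open>K\<close> the volume element factors into a function of
  \<open>u\<close> and \<open>det (\<lambda> - K)\<^sup>2 d\<lambda> dK\<close>.

  Writing the discriminant as the square of the determinant of the \<open>\<phi>\<^sub>j(\<lambda>\<^sub>i)\<close>, orthogonality reduces the
  expectation of \<open>k\<close> to the integral of \<open>\<Sum>\<^sub>j\<^sub><\<^sub>n \<phi>\<^sub>j\<^sup>2 w / h\<^sub>j\<close> over \<open>[x, \<infinity>)\<close>, and the confluent
  Christoffel-Darboux formula sums the kernel. As the density is only known through integrals of
  products \<open>\<Prod>\<^sub>i u(\<lambda>\<^sub>i)\<close>, \<open>k\<close> is reached through its generating function \<open>(1 + s)\<^sup>k\<close>.\<close>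

section \<open>Unitary matrices and the spectral theorem\<close>

text \<open>Parametrising matrices by eigenvalues and eigenvectors would need a quotient of the
  unitary group and a Jacobian on it. The recursion avoids both: apart from one substitution in a
  single real variable, every change of variables is real affine in one group of coordinates with
  the others fixed, so only a scale factor has to be known. Diagonal conjugations give it directly,
  and a unitary one cancels against its inverse.

  The top eigenvalue suits the corner because, beyond the spectrum of H, the corner is a bijective
  function of \<lambda> onto the whole line, and the constraint left on the other eigenvalues is
  symmetric: they lie below \<lambda>.

  Products of one function over the spectrum are closed under the recursion, since the squared
  determinant and the constraint are absorbed into the function. Integrals take values in
  [0, \<infinity>], so the constant of proportionality is carried along unevaluated, possibly
  infinite, until the total mass of the density fixes it.\<close>

definition adjoint_matrix :: "complex^'n^'n \<Rightarrow> complex^'n^'n" where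
  "adjoint_matrix A = (\<chi> i j. cnj (A $ j $ i))"

definition diag_on :: "'n set \<Rightarrow> ('n \<Rightarrow> complex) \<Rightarrow> complex^'n^'n" where
  "diag_on S d = (\<chi> i j. if i = j \<and> i \<in> S then d i else 0)"

abbreviation one_on :: "'n set \<Rightarrow> complex^'n^'n" where
  "one_on S \<equiv> diag_on S (\<lambda>_. 1)"

text \<open>Matrices are supported on a block, so that one index type serves all dimensions below it.\<close>

definition supported :: "'n set \<Rightarrow> complex^'n^'n \<Rightarrow> bool" where
  "supported S A \<longleftrightarrow> (\<forall>i j. i \<notin> S \<or> j \<notin> S \<longrightarrow> A $ i $ j = 0)"

definition unitary_on :: "'n set \<Rightarrow> complex^'n^'n \<Rightarrow> bool" where
  "unitary_on S U \<longleftrightarrow> supported S U \<and> U ** adjoint_matrix U = one_on S \<and> adjoint_matrix U ** U = one_on S"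

lemma adjoint_matrix_nth [simp]: "adjoint_matrix A $ i $ j = cnj (A $ j $ i)"
  by (simp add: adjoint_matrix_def)

lemma adjoint_matrix_mult: "adjoint_matrix (A ** B) = adjoint_matrix B ** adjoint_matrix A"
  by (simp add: vec_eq_iff matrix_matrix_mult_def mult.commute)

lemma adjoint_matrix_adjoint_matrix [simp]: "adjoint_matrix (adjoint_matrix A) = A"
  by (simp add: vec_eq_iff)

lemma hermitian_iff_adjoint_matrix: "hermitian A \<longleftrightarrow> adjoint_matrix A = A"
  unfolding hermitian_def vec_eq_iff by (metis adjoint_matrix_nth)

lemma diag_on_nth: "diag_on S d $ i $ j = (if i = j \<and> i \<in> S then d i else 0)"
  by (simp add: diag_on_def)

lemma mult_diag_on_nth: "(A ** diag_on S d) $ i $ j = (if j \<in> S then A $ i $ j * d j else 0)"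
proof -
  have "(A ** diag_on S d) $ i $ j = (\<Sum>k\<in>UNIV. if k = j then (if j \<in> S then A $ i $ j * d j else 0) else 0)"
    unfolding matrix_matrix_mult_def vec_lambda_beta diag_on_nth by (intro sum.cong) auto
  then show ?thesis by simp
qed

lemma diag_on_mult_nth: "(diag_on S d ** A) $ i $ j = (if i \<in> S then d i * A $ i $ j else 0)"
proof -
  have "(diag_on S d ** A) $ i $ j = (\<Sum>k\<in>UNIV. if k = i then (if i \<in> S then d i * A $ i $ j else 0) else 0)"
    unfolding matrix_matrix_mult_def vec_lambda_beta diag_on_nth by (intro sum.cong) auto
  then show ?thesis by simp
qed

lemma diag_on_mult_diag_on: "diag_on S d ** diag_on S e = diag_on S (\<lambda>i. d i * e i)"
  unfolding vec_eq_iff by (auto simp: diag_on_mult_nth diag_on_nth)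

lemma one_on_mult: "supported S A \<Longrightarrow> one_on S ** A = A"
  by (auto simp: vec_eq_iff diag_on_mult_nth supported_def)

lemma mult_one_on: "supported S A \<Longrightarrow> A ** one_on S = A"
  by (auto simp: vec_eq_iff mult_diag_on_nth supported_def)

lemma supported_mult: "supported S A \<Longrightarrow> supported S B \<Longrightarrow> supported S (A ** B)"
  by (auto simp: supported_def matrix_matrix_mult_def intro!: sum.neutral)

lemma supported_adjoint_matrix: "supported S A \<Longrightarrow> supported S (adjoint_matrix A)"
  by (auto simp: supported_def)

lemma supported_diag_on [simp]: "supported S (diag_on S d)"
  by (auto simp: supported_def diag_on_nth)

lemma adjoint_matrix_diag_on: "adjoint_matrix (diag_on S d) = diag_on S (\<lambda>i. cnj (d i))"
  by (auto simp: vec_eq_iff diag_on_nth)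

lemma unitary_on_one_on: "unitary_on S (one_on S)"
  by (simp add: unitary_on_def adjoint_matrix_diag_on diag_on_mult_diag_on)

lemma unitary_on_mult:
  assumes "unitary_on S U" "unitary_on S V"
  shows "unitary_on S (U ** V)"
proof -
  note sU = assms(1)[unfolded unitary_on_def] and sV = assms(2)[unfolded unitary_on_def]
  have "U ** V ** adjoint_matrix (U ** V) = U ** (V ** adjoint_matrix V) ** adjoint_matrix U"
    by (simp only: adjoint_matrix_mult matrix_mul_assoc)
  moreover have "adjoint_matrix (U ** V) ** (U ** V) = adjoint_matrix V ** (adjoint_matrix U ** U) ** V"
    by (simp only: adjoint_matrix_mult matrix_mul_assoc)
  ultimately show ?thesis
    using sU sV by (simp add: unitary_on_def mult_one_on supported_mult supported_adjoint_matrix)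
qed

lemma unitary_on_entry:
  assumes "unitary_on S U"
  shows "norm (U $ i $ j) \<le> 1"
proof -
  have "Re ((U ** adjoint_matrix U) $ i $ i) = (\<Sum>k\<in>UNIV. (cmod (U $ i $ k))\<^sup>2)"
    by (simp add: matrix_matrix_mult_def complex_norm_square[symmetric] del: of_real_power)
  moreover have "Re ((U ** adjoint_matrix U) $ i $ i) \<le> 1"
    using assms by (simp add: unitary_on_def diag_on_nth)
  moreover have "(cmod (U $ i $ j))\<^sup>2 \<le> (\<Sum>k\<in>UNIV. (cmod (U $ i $ k))\<^sup>2)"
    by (rule member_le_sum) auto
  ultimately have "(cmod (U $ i $ j))\<^sup>2 \<le> 1\<^sup>2" by simp
  then show ?thesis by (rule power2_le_imp_le) simp
qed

lemma compact_unitary_on: "compact {U :: complex^'n^'n. unitary_on S U}"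
proof -
  have "bounded {U :: complex^'n^'n. unitary_on S U}"
  proof (rule boundedI)
    fix U :: "complex^'n^'n" assume "U \<in> {U. unitary_on S U}"
    then have e: "norm (U $ i $ j) \<le> 1" for i j by (simp add: unitary_on_entry)
    have l1: "norm v \<le> (\<Sum>i\<in>UNIV. norm (v $ i))" for v :: "('b::real_normed_vector)^'n"
      unfolding norm_vec_def by (rule L2_set_le_sum) simp
    have "norm U \<le> (\<Sum>i\<in>UNIV. norm (U $ i))" by (rule l1)
    also have "\<dots> \<le> (\<Sum>i\<in>(UNIV :: 'n set). \<Sum>j\<in>(UNIV :: 'n set). 1)"
      by (rule sum_mono, rule order.trans[OF l1], rule sum_mono, rule e)
    finally show "norm U \<le> real (CARD('n) * CARD('n))" by simp
  qed
  moreover have "closed {U :: complex^'n^'n. unitary_on S U}"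
    unfolding unitary_on_def supported_def vec_eq_iff matrix_matrix_mult_def vec_lambda_beta
    by (simp add: adjoint_matrix_def)
       (intro closed_Collect_conj closed_Collect_all closed_Collect_imp closed_Collect_eq continuous_intros; simp)
  ultimately show ?thesis by (simp add: compact_eq_bounded_closed)
qed

text \<open>The unit number \<open>e\<close> is a phase: the rotations with \<open>e = 1\<close> and
  with \<open>e = \<i>\<close> detect the real and the imaginary part of the entry at
  \<open>(a, b)\<close>.\<close>

definition plane_rotation :: "'n set \<Rightarrow> 'n \<Rightarrow> 'n \<Rightarrow> complex \<Rightarrow> real \<Rightarrow> complex^'n^'n" where
  "plane_rotation S a b e t = (\<chi> i j. if i = a \<and> j = a \<or> i = b \<and> j = b then of_real (cos t)
     else if i = a \<and> j = b then - cnj e * of_real (sin t) else if i = b \<and> j = a then e * of_real (sin t)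
     else if i = j \<and> i \<in> S then 1 else 0)"

lemma plane_rotation_column:
  fixes f :: "'n::finite \<Rightarrow> complex"
  assumes "a \<noteq> b"
  shows "(\<Sum>k\<in>UNIV. f k * plane_rotation S a b e t $ k $ j) =
    (if j = a then f a * of_real (cos t) + f b * (e * of_real (sin t))
     else if j = b then f b * of_real (cos t) - f a * (cnj e * of_real (sin t))
     else if j \<in> S then f j else 0)"
proof -
  have "(\<Sum>k\<in>UNIV. f k * plane_rotation S a b e t $ k $ j) =
    (\<Sum>k\<in>UNIV. (if k = a then f a * plane_rotation S a b e t $ a $ j else 0) +
       (if k = b then f b * plane_rotation S a b e t $ b $ j else 0) +
       (if k = j then (if j \<noteq> a \<and> j \<noteq> b \<and> j \<in> S then f j else 0) else 0))"
    using assms by (intro sum.cong) (auto simp: plane_rotation_def)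
  also have "\<dots> = f a * plane_rotation S a b e t $ a $ j + f b * plane_rotation S a b e t $ b $ j +
      (if j \<noteq> a \<and> j \<noteq> b \<and> j \<in> S then f j else 0)"
    by (simp add: sum.distrib)
  also have "\<dots> = (if j = a then f a * of_real (cos t) + f b * (e * of_real (sin t))
     else if j = b then f b * of_real (cos t) - f a * (cnj e * of_real (sin t))
     else if j \<in> S then f j else 0)"
    using assms by (auto simp: plane_rotation_def)
  finally show ?thesis .
qed

lemma adjoint_matrix_plane_rotation:
  "a \<noteq> b \<Longrightarrow> adjoint_matrix (plane_rotation S a b e t) = plane_rotation S a b e (- t)"
  unfolding vec_eq_iff
proof (intro allI)
  fix i j assume "a \<noteq> b"
  then show "adjoint_matrix (plane_rotation S a b e t) $ i $ j = plane_rotation S a b e (- t) $ i $ j"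
    by (cases "i = a"; cases "i = b"; cases "j = a"; cases "j = b") (auto simp: plane_rotation_def)
qed

lemma plane_rotation_0:
  assumes "a \<noteq> b" "a \<in> S" "b \<in> S"
  shows "plane_rotation S a b e 0 = one_on S"
  unfolding vec_eq_iff
proof (intro allI)
  fix i j
  show "plane_rotation S a b e 0 $ i $ j = one_on S $ i $ j"
    using assms
    by (cases "i = a"; cases "i = b"; cases "j = a"; cases "j = b") (simp_all add: plane_rotation_def diag_on_nth)
qed

lemma plane_rotation_mult_inverse:
  assumes "a \<noteq> b" "a \<in> S" "b \<in> S" "cmod e = 1"
  shows "plane_rotation S a b e s ** plane_rotation S a b e (- s) = one_on S"
proof -
  define C where "C = complex_of_real (cos s)"
  define D where "D = complex_of_real (sin s)"
  have e: "e * cnj e = 1" using assms(4) complex_norm_square[of e] by simp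
  have cs: "C * C + D * D = 1"
    unfolding C_def D_def of_real_mult[symmetric] of_real_add[symmetric]
    using sin_cos_squared_add[of s] by (simp add: power2_eq_square add.commute)
  have 1: "C * C + - cnj e * D * (e * - D) = 1" "C * C - e * D * (cnj e * - D) = 1"
  proof -
    have "C * C + - cnj e * D * (e * - D) = C * C + e * cnj e * (D * D)"
      "C * C - e * D * (cnj e * - D) = C * C + e * cnj e * (D * D)" by (simp_all add: algebra_simps)
    then show "C * C + - cnj e * D * (e * - D) = 1" "C * C - e * D * (cnj e * - D) = 1"
      unfolding e using cs by simp_all
  qed
  have 2: "- cnj e * D * C - C * (cnj e * - D) = 0" "e * D * C + C * (e * - D) = 0"
    by (simp_all add: algebra_simps)
  show ?thesis
    unfolding vec_eq_iff
  proof (intro allI)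
    fix i j
    have "(plane_rotation S a b e s ** plane_rotation S a b e (- s)) $ i $ j =
      (\<Sum>k\<in>UNIV. plane_rotation S a b e s $ i $ k * plane_rotation S a b e (- s) $ k $ j)"
      by (simp add: matrix_matrix_mult_def)
    also have "\<dots> = one_on S $ i $ j"
      unfolding plane_rotation_column[OF assms(1)] cos_minus sin_minus of_real_minus C_def[symmetric] D_def[symmetric]
      using 1 2 assms(1-3)
      by (cases "i = a"; cases "i = b"; cases "j = a"; cases "j = b")
         (simp_all add: plane_rotation_def diag_on_nth C_def[symmetric] D_def[symmetric])
    finally show "(plane_rotation S a b e s ** plane_rotation S a b e (- s)) $ i $ j = one_on S $ i $ j" .
  qed
qed

lemma unitary_on_plane_rotation:
  assumes "a \<noteq> b" "a \<in> S" "b \<in> S" "cmod e = 1"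
  shows "unitary_on S (plane_rotation S a b e t)"
proof -
  have "supported S (plane_rotation S a b e t)"
    using assms by (auto simp: supported_def plane_rotation_def)
  then show ?thesis
    using plane_rotation_mult_inverse[OF assms, of t] plane_rotation_mult_inverse[OF assms, of "- t"]
    unfolding unitary_on_def adjoint_matrix_plane_rotation[OF assms(1)] by simp
qed

text \<open>A maximiser of the linear functional \<open>U \<mapsto> \<Sum>\<^sub>i c\<^sub>i (U\<^sup>* H U)\<^sub>i\<^sub>i\<close> on the compact unitary group
  diagonalises \<open>H\<close> if the \<open>c\<^sub>i\<close> are distinct: its derivatives along the plane rotations are
  multiples of the off-diagonal entries.\<close>

theorem spectral_theorem_on:
  fixes H :: "complex^'n^'n"
  assumes "supported S H" "hermitian H"
  obtains U \<mu> where "unitary_on S U" "H = U ** diag_on S (\<lambda>i. of_real (\<mu> i)) ** adjoint_matrix U"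
proof -
  obtain c :: "'n \<Rightarrow> nat" where c: "inj c"
    using finite_imp_inj_to_nat_seg[of "UNIV :: 'n set"] by auto
  define F where "F U = (\<Sum>i\<in>UNIV. real (c i) * Re ((adjoint_matrix U ** H ** U) $ i $ i))" for U
  have contF: "continuous_on UNIV F"
    unfolding F_def matrix_matrix_mult_def vec_lambda_beta adjoint_matrix_nth by (intro continuous_intros)
  have "{U :: complex^'n^'n. unitary_on S U} \<noteq> {}" using unitary_on_one_on by blast
  from continuous_attains_sup[OF compact_unitary_on this continuous_on_subset[OF contF]]
  obtain U where U: "unitary_on S U" and max: "\<And>V. unitary_on S V \<Longrightarrow> F V \<le> F U" by auto
  define K where "K = adjoint_matrix U ** H ** U"
  have Kadj: "adjoint_matrix K = K"
    using assms(2) by (simp add: K_def adjoint_matrix_mult matrix_mul_assoc hermitian_iff_adjoint_matrix)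
  have Ksup: "supported S K"
    using U assms(1) unfolding K_def unitary_on_def by (intro supported_mult supported_adjoint_matrix) auto
  have off: "Re (e * K $ a $ b) = 0" if ab: "a \<in> S" "b \<in> S" "a \<noteq> b" and e: "cmod e = 1" for a b e
  proof -
    define R where "R t = plane_rotation S a b e t" for t
    define G where "G t = (\<Sum>i\<in>UNIV. real (c i) * Re ((adjoint_matrix (R t) ** K ** R t) $ i $ i))" for t
    have GF: "G t = F (U ** R t)" for t
      unfolding G_def F_def K_def by (simp only: adjoint_matrix_mult matrix_mul_assoc)
    have R0: "R 0 = one_on S"
      unfolding R_def by (rule plane_rotation_0[OF ab(3,1,2)])
    have Gmax: "G t \<le> G 0" for t
    proof -
      have "U ** R 0 = U" using U unfolding R0 by (simp add: unitary_on_def mult_one_on)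
      then show ?thesis
        unfolding GF using max[OF unitary_on_mult[OF U unitary_on_plane_rotation[OF ab(3,1,2) e, of t]]] by (simp add: R_def)
    qed
    have Kba: "K $ b $ a = cnj (K $ a $ b)" "K $ a $ a = cnj (K $ a $ a)" "K $ b $ b = cnj (K $ b $ b)"
      using Kadj by (metis adjoint_matrix_nth)+
    \<comment> \<open>Only the diagonal entries at \<open>a\<close> and \<open>b\<close> vary with
      \<open>t\<close>. The squares of sine and cosine are stationary at 0, so the mixed terms alone
      carry the derivative there, and they enter the two entries with opposite signs.\<close>
    have Gt: "G t = (\<Sum>i\<in>UNIV - {a, b}. real (c i) * Re (K $ i $ i)) +
        real (c a) * (Re (K $ a $ a) * (cos t)\<^sup>2 + Re (K $ b $ b) * (sin t)\<^sup>2 + 2 * Re (e * K $ a $ b) * sin t * cos t) +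
        real (c b) * (Re (K $ a $ a) * (sin t)\<^sup>2 + Re (K $ b $ b) * (cos t)\<^sup>2 - 2 * Re (e * K $ a $ b) * sin t * cos t)" for t
    proof -
      have 1: "(adjoint_matrix (R t) ** K ** R t) $ i $ i = (\<Sum>k\<in>UNIV. (\<Sum>l\<in>UNIV. cnj (R t $ l $ i) * K $ l $ k) * R t $ k $ i)" for i
        by (simp add: matrix_matrix_mult_def)
      have 2: "(\<Sum>l\<in>UNIV. cnj (R t $ l $ i) * K $ l $ k) = cnj (\<Sum>l\<in>UNIV. cnj (K $ l $ k) * R t $ l $ i)" for i k
        by (simp add: mult.commute)
      have d: "Re ((adjoint_matrix (R t) ** K ** R t) $ i $ i) = Re (K $ i $ i)" if "i \<noteq> a" "i \<noteq> b" for i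
        unfolding 1 2 unfolding R_def plane_rotation_column[OF ab(3)] using that Ksup by (auto simp: supported_def)
      define C D E where "C = complex_of_real (cos t)" and "D = complex_of_real (sin t)" and "E = cnj e"
      define z where "z = e * K $ a $ b"
      have eE: "e * E = 1" using e complex_norm_square[of e] by (simp add: E_def)
      have CD: "C * C = of_real ((cos t)\<^sup>2)" "D * D = of_real ((sin t)\<^sup>2)" "D * C = of_real (sin t * cos t)"
        by (simp_all add: C_def D_def power2_eq_square)
      have z': "z + E * cnj (K $ a $ b) = of_real (2 * Re z)"
        by (simp add: z_def E_def complex_eq_iff)
      have "(adjoint_matrix (R t) ** K ** R t) $ a $ a =
          (K $ a $ a * C + cnj (K $ a $ b) * (E * D)) * C + (K $ a $ b * C + K $ b $ b * (E * D)) * (e * D)"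
        unfolding 1 2 unfolding R_def plane_rotation_column[OF ab(3)] by (simp add: Kba(1) C_def D_def E_def)
      also have "\<dots> = K $ a $ a * (C * C) + K $ b $ b * (e * E * (D * D)) + (z + E * cnj (K $ a $ b)) * (D * C)"
        unfolding z_def by (simp add: algebra_simps)
      finally have da: "Re ((adjoint_matrix (R t) ** K ** R t) $ a $ a) = Re (K $ a $ a) * (cos t)\<^sup>2 + Re (K $ b $ b) * (sin t)\<^sup>2 + 2 * Re (e * K $ a $ b) * sin t * cos t"
        unfolding eE CD z' by (simp add: z_def del: of_real_power of_real_mult)
      have "(adjoint_matrix (R t) ** K ** R t) $ b $ b =
          (K $ b $ b * C - K $ a $ b * (e * D)) * C - (cnj (K $ a $ b) * C - K $ a $ a * (e * D)) * (E * D)"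
        unfolding 1 2 unfolding R_def plane_rotation_column[OF ab(3)] using ab(3) by (simp add: Kba(1) C_def D_def E_def)
      also have "\<dots> = K $ b $ b * (C * C) + K $ a $ a * (e * E * (D * D)) - (z + E * cnj (K $ a $ b)) * (D * C)"
        unfolding z_def by (simp add: algebra_simps)
      finally have db: "Re ((adjoint_matrix (R t) ** K ** R t) $ b $ b) = Re (K $ a $ a) * (sin t)\<^sup>2 + Re (K $ b $ b) * (cos t)\<^sup>2 - 2 * Re (e * K $ a $ b) * sin t * cos t"
        unfolding eE CD z' by (simp add: z_def del: of_real_power of_real_mult)
      have "G t = (\<Sum>i\<in>UNIV - {a, b}. real (c i) * Re ((adjoint_matrix (R t) ** K ** R t) $ i $ i)) +
         (\<Sum>i\<in>{a, b}. real (c i) * Re ((adjoint_matrix (R t) ** K ** R t) $ i $ i))"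
        unfolding G_def by (rule sum.subset_diff) auto
      also have "(\<Sum>i\<in>UNIV - {a, b}. real (c i) * Re ((adjoint_matrix (R t) ** K ** R t) $ i $ i)) = (\<Sum>i\<in>UNIV - {a, b}. real (c i) * Re (K $ i $ i))"
        by (intro sum.cong) (auto simp: d)
      finally show ?thesis using ab(3) by (simp add: da db)
    qed
    have "(G has_real_derivative 2 * (real (c a) - real (c b)) * Re (e * K $ a $ b)) (at 0)"
      unfolding Gt by (auto intro!: derivative_eq_intros simp: algebra_simps)
    then have "2 * (real (c a) - real (c b)) * Re (e * K $ a $ b) = 0"
      by (rule DERIV_local_max[of _ _ _ 1]) (use Gmax in auto)
    moreover have "real (c a) \<noteq> real (c b)" using c ab(3) by (auto simp: inj_def)
    ultimately show ?thesis by simp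
  qed
  have off0: "K $ a $ b = 0" if "a \<in> S" "b \<in> S" "a \<noteq> b" for a b
    using off[OF that, of 1] off[OF that, of \<i>] by (simp add: complex_eq_iff)
  have real: "K $ a $ a = of_real (Re (K $ a $ a))" for a
  proof -
    have "K $ a $ a = cnj (K $ a $ a)" using Kadj by (metis adjoint_matrix_nth)
    then show ?thesis by (simp add: complex_eq_iff)
  qed
  have Kd: "K = diag_on S (\<lambda>i. of_real (Re (K $ i $ i)))"
    unfolding vec_eq_iff diag_on_nth
  proof (intro allI)
    fix i j
    show "K $ i $ j = (if i = j \<and> i \<in> S then of_real (Re (K $ i $ i)) else 0)"
      using off0[of i j] real[of i] Ksup[unfolded supported_def, rule_format, of i j] by (cases "i = j") auto
  qed
  have "U ** K ** adjoint_matrix U = (U ** adjoint_matrix U) ** H ** (U ** adjoint_matrix U)"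
    by (simp only: K_def matrix_mul_assoc)
  also have "\<dots> = H" using U assms(1) by (simp add: unitary_on_def one_on_mult mult_one_on)
  finally show thesis using that[OF U] Kd by metis
qed

section \<open>Homology of complex projective spaces\<close>

definition outer :: "complex^'n \<Rightarrow> complex^'n^'n" where
  "outer h = (\<chi> i j. h $ i * cnj (h $ j))"

definition projections_on :: "'n set \<Rightarrow> (complex^'n^'n) set" where
  "projections_on S = {outer h | h. (\<Sum>i\<in>UNIV. (cmod (h $ i))\<^sup>2) = 1 \<and> (\<forall>i. i \<notin> S \<longrightarrow> h $ i = 0)}"

text \<open>The projective action of the diagonal map with entries \<open>d i\<close>: the line of
  \<open>h\<close> goes to the line of the vector \<open>d i * h $ i\<close>. The denominator is the
  squared norm of that vector and restores the trace 1.\<close>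

definition rescale :: "('n \<Rightarrow> real) \<Rightarrow> complex^'n^'n \<Rightarrow> complex^'n^'n" where
  "rescale d U = (\<chi> i j. of_real (d i) * U $ i $ j * of_real (d j) /
                          of_real (\<Sum>k\<in>UNIV. (d k)\<^sup>2 * Re (U $ k $ k)))"

lemma outer_nth [simp]: "outer h $ i $ j = h $ i * cnj (h $ j)"
  by (simp add: outer_def)

lemma Re_outer_diag: "Re (outer h $ i $ i) = (cmod (h $ i))\<^sup>2"
  by (simp add: complex_norm_square[symmetric] del: of_real_power)

lemma rank_one_projections_eq: "rank_one_projections = projections_on UNIV"
proof -
  have "((\<Sum>i\<in>UNIV. cnj (h $ i) * h $ i) = 1) = ((\<Sum>i\<in>UNIV. (cmod (h $ i))\<^sup>2) = 1)" for h :: "complex^'n"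
  proof -
    have "(\<Sum>i\<in>UNIV. cnj (h $ i) * h $ i) = of_real (\<Sum>i\<in>UNIV. (cmod (h $ i))\<^sup>2)"
      unfolding of_real_sum by (intro sum.cong) (simp_all only: complex_norm_square mult.commute)
    then show ?thesis by (metis of_real_1 of_real_eq_iff)
  qed
  then show ?thesis
    by (auto simp: rank_one_projections_def projections_on_def outer_def)
qed

lemma rescale_outer:
  assumes r: "r = sqrt (\<Sum>k\<in>UNIV. (d k)\<^sup>2 * (cmod (h $ k))\<^sup>2)"
  shows "rescale d (outer h) = outer (\<chi> i. of_real (d i / r) * h $ i)"
proof -
  have "(\<Sum>k\<in>UNIV. (d k)\<^sup>2 * Re (outer h $ k $ k)) = r * r"
    unfolding Re_outer_diag r by (simp add: sum_nonneg)
  then show ?thesis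
    by (simp add: rescale_def vec_eq_iff)
qed

lemma rescale_in_projections_on:
  assumes "U \<in> projections_on T" and "(\<Sum>k\<in>UNIV. (d k)\<^sup>2 * Re (U $ k $ k)) > 0"
    and "\<And>i. i \<in> T \<Longrightarrow> i \<notin> S \<Longrightarrow> d i = 0"
  shows "rescale d U \<in> projections_on S"
proof -
  obtain h where U: "U = outer h" and h: "(\<Sum>i\<in>UNIV. (cmod (h $ i))\<^sup>2) = 1" "\<forall>i. i \<notin> T \<longrightarrow> h $ i = 0"
    using assms(1) by (auto simp: projections_on_def)
  define r where "r = sqrt (\<Sum>k\<in>UNIV. (d k)\<^sup>2 * (cmod (h $ k))\<^sup>2)"
  have pos: "(\<Sum>k\<in>UNIV. (d k)\<^sup>2 * (cmod (h $ k))\<^sup>2) > 0"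
    using assms(2) unfolding U Re_outer_diag .
  have r2: "r\<^sup>2 = (\<Sum>k\<in>UNIV. (d k)\<^sup>2 * (cmod (h $ k))\<^sup>2)" "r > 0"
    using pos by (auto simp: r_def)
  have "(\<Sum>i\<in>UNIV. (cmod (of_real (d i / r) * h $ i))\<^sup>2) = (\<Sum>i\<in>UNIV. (d i)\<^sup>2 * (cmod (h $ i))\<^sup>2) / r\<^sup>2"
    by (simp add: norm_mult norm_divide power_mult_distrib power_divide sum_divide_distrib)
  then have 1: "(\<Sum>i\<in>UNIV. (cmod ((\<chi> i. of_real (d i / r) * h $ i) $ i))\<^sup>2) = 1"
    using r2 pos by simp
  have 2: "\<forall>i. i \<notin> S \<longrightarrow> (\<chi> i. of_real (d i / r) * h $ i) $ i = 0"
    using h(2) assms(3) by auto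
  show ?thesis unfolding U rescale_outer[OF r_def] projections_on_def using 1 2 by blast
qed

lemma projections_on_trace:
  assumes "U \<in> projections_on S"
  shows "(\<Sum>k\<in>UNIV. Re (U $ k $ k)) = 1" "Re (U $ k $ k) \<ge> 0"
  using assms unfolding projections_on_def by (auto simp: Re_outer_diag simp del: outer_nth)

lemma projections_on_zero:
  assumes "U \<in> projections_on S" "i \<notin> S \<or> j \<notin> S"
  shows "U $ i $ j = 0"
  using assms by (auto simp: projections_on_def)

lemma projections_on_eqI:
  assumes "U \<in> projections_on T" "\<And>i. i \<notin> S \<Longrightarrow> U $ i $ i = 0"
  shows "U \<in> projections_on S"
  using assms by (auto simp: projections_on_def)

lemma projections_on_mono: "S \<subseteq> T \<Longrightarrow> projections_on S \<subseteq> projections_on T"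
  by (auto simp: projections_on_def)

lemma rescale_id:
  assumes "U \<in> projections_on S" "\<And>i. i \<in> S \<Longrightarrow> d i = 1"
  shows "rescale d U = U"
proof -
  have "(\<Sum>k\<in>UNIV. (d k)\<^sup>2 * Re (U $ k $ k)) = (\<Sum>k\<in>UNIV. Re (U $ k $ k))"
  proof (rule sum.cong)
    fix k show "(d k)\<^sup>2 * Re (U $ k $ k) = Re (U $ k $ k)"
      using assms(2)[of k] projections_on_zero[OF assms(1), of k k] by (cases "k \<in> S") auto
  qed simp
  then have 1: "(\<Sum>k\<in>UNIV. (d k)\<^sup>2 * Re (U $ k $ k)) = 1"
    using projections_on_trace[OF assms(1)] by simp
  have "of_real (d i) * U $ i $ j * of_real (d j) = U $ i $ j" for i j
    using assms(2) projections_on_zero[OF assms(1), of i j] by (cases "i \<in> S \<and> j \<in> S") auto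
  then show ?thesis unfolding rescale_def 1 by (simp add: vec_eq_iff)
qed

text \<open>Bounds the denominator of \<open>rescale\<close> from below by the mass on
  \<open>S\<close>, uniformly in the factors outside \<open>S\<close>, so that the deformations
  below never divide by zero.\<close>

lemma diag_ge_sum:
  assumes "U \<in> projections_on T" and d: "\<And>k. k \<in> S \<Longrightarrow> d k = 1"
  shows "(\<Sum>k\<in>UNIV. (d k)\<^sup>2 * Re (U $ k $ k)) \<ge> (\<Sum>k\<in>S. Re (U $ k $ k))"
proof -
  have "(\<Sum>k\<in>S. Re (U $ k $ k)) = (\<Sum>k\<in>S. (d k)\<^sup>2 * Re (U $ k $ k))"
    by (intro sum.cong) (simp_all add: d)
  also have "\<dots> \<le> (\<Sum>k\<in>UNIV. (d k)\<^sup>2 * Re (U $ k $ k))"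
    by (intro sum_mono2 mult_nonneg_nonneg projections_on_trace(2)[OF assms(1)]) auto
  finally show ?thesis .
qed

lemma continuous_on_rescale:
  fixes d :: "'a::topological_space \<Rightarrow> ('n::finite) \<Rightarrow> real" and U :: "'a \<Rightarrow> complex^'n^'n"
  assumes "\<And>i. continuous_on Z (\<lambda>z. d z i)" "continuous_on Z U"
    and "\<And>z. z \<in> Z \<Longrightarrow> (\<Sum>k\<in>UNIV. (d z k)\<^sup>2 * Re (U z $ k $ k)) \<noteq> 0"
  shows "continuous_on Z (\<lambda>z. rescale (d z) (U z))"
proof -
  have ne: "complex_of_real (\<Sum>k\<in>UNIV. (d z k)\<^sup>2 * Re (U z $ k $ k)) \<noteq> 0" if "z \<in> Z" for z
    using assms(3)[OF that] by (simp only: of_real_eq_0_iff not_False_eq_True)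
  show ?thesis
    unfolding rescale_def by (intro continuous_intros assms ballI ne)
qed

text \<open>Multiplying the coordinates outside \<open>S\<close> by \<open>t\<close> gives the
  identity at \<open>t = 1\<close> and lands in \<open>projections_on S\<close> at
  \<open>t = 0\<close>; positive mass on \<open>S\<close> keeps every stage defined. It is used for
  three sets \<open>Y\<close>: an affine chart, a punctured projective space and the excursion
  set.\<close>

lemma projections_on_retract:
  fixes Y :: "(complex^'n^'n) set"
  assumes Y: "Y \<subseteq> projections_on T"
    and pos: "\<And>U. U \<in> Y \<Longrightarrow> (\<Sum>k\<in>S. Re (U $ k $ k)) > 0"
    and closed: "\<And>U t. U \<in> Y \<Longrightarrow> 0 \<le> t \<Longrightarrow> t \<le> 1 \<Longrightarrow> rescale (\<lambda>k. if k \<in> S then 1 else t) U \<in> Y"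
  shows "top_of_set Y homotopy_equivalent_space top_of_set (Y \<inter> projections_on S)"
proof -
  define F where "F = (\<lambda>(t::real) U :: complex^'n^'n. rescale (\<lambda>k. if k \<in> S then 1 else t) U)"
  have spos: "(\<Sum>k\<in>UNIV. (if k \<in> S then 1 else t)\<^sup>2 * Re (U $ k $ k)) > 0" if "U \<in> Y" for t U
    using diag_ge_sum[of U T S "\<lambda>k. if k \<in> S then 1 else t"] pos[OF that] that Y by (auto simp del: sum.If_cases)
  have contF: "continuous_on (UNIV \<times> Y) (\<lambda>p. F (fst p) (snd p))"
    unfolding F_def
  proof (rule continuous_on_rescale)
    show "continuous_on (UNIV \<times> Y) (\<lambda>z. if i \<in> S then 1 else fst z)" for i
      by (cases "i \<in> S") (auto intro!: continuous_intros)
    show "(\<Sum>k\<in>UNIV. (if k \<in> S then 1 else fst z)\<^sup>2 * Re (snd z $ k $ k)) \<noteq> 0"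
      if "z \<in> UNIV \<times> Y" for z
      by (rule less_imp_neq[symmetric], rule spos) (use that in auto)
  qed (intro continuous_intros)
  have F0: "F 0 U \<in> projections_on S" if "U \<in> Y" for U
    unfolding F_def by (rule rescale_in_projections_on[OF _ spos]) (use that Y in auto)
  have FS: "F t U = U" if "U \<in> projections_on S" for t U
    unfolding F_def by (rule rescale_id[OF that]) auto
  have FY: "F t U \<in> Y" if "U \<in> Y" "0 \<le> t" "t \<le> 1" for t U
    using closed that by (simp add: F_def)
  have F1: "F 1 U = U" if "U \<in> Y" for U
    unfolding F_def by (rule rescale_id[of _ T]) (use that Y in auto)
  have contFt: "continuous_on Y (F t)" for t
    by (rule continuous_on_compose2[OF contF, of Y "\<lambda>U. (t, U)", simplified])
       (auto intro!: continuous_intros)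
  have ret: "retraction_maps (top_of_set Y) (top_of_set (Y \<inter> projections_on S)) (F 0) id"
    unfolding retraction_maps_def
    using contFt[of 0] FY[of _ 0] F0 FS by (auto simp: continuous_map_in_subtopology)
  have "homotopic_with (\<lambda>_. True) (top_of_set Y) (top_of_set Y) (F 0) id"
  proof -
    have "homotopic_with (\<lambda>_. True) (top_of_set Y) (top_of_set Y) (F 0) (F 1)"
    proof (intro homotopic_with[THEN iffD2] exI[of _ "\<lambda>p. F (fst p) (snd p)"] conjI)
      show "continuous_map (prod_topology (top_of_set {0..1}) (top_of_set Y)) (top_of_set Y) (\<lambda>p. F (fst p) (snd p))"
        using FY continuous_on_subset[OF contF, of "{0..1} \<times> Y"] by auto
    qed auto
    then show ?thesis by (rule homotopic_with_eq) (auto simp: F1)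
  qed
  then show ?thesis
    using deformation_retraction_imp_homotopy_equivalent_space[OF _ ret] by simp
qed

lemma nsphere_eq: "nsphere n = top_of_set {x. (\<Sum>i\<le>n. x i ^ 2) = 1 \<and> (\<forall>i>n. x i = 0)}"
  by (simp add: nsphere euclidean_product_topology)

lemma sum_pairs: "(\<Sum>i\<le>2 * m + 1. f i) = (\<Sum>j\<le>(m::nat). f (2 * j) + (f (2 * j + 1) :: real))"
  by (induction m) (simp_all add: algebra_simps numeral_2_eq_2)

text \<open>In the affine chart \<open>h\<^sub>b = 1\<close> the space below is the punctured coordinate space
  \<open>\<complex>\<^sup>S - {0}\<close>.\<close>

lemma punctured_chart_homotopy_equivalent_nsphere:
  fixes S :: "('n::finite) set"
  assumes b: "b \<notin> S" and m: "card S = Suc m"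
  shows "top_of_set {U \<in> projections_on (insert b S). Re (U $ b $ b) > 0 \<and> (\<exists>i\<in>S. U $ i $ b \<noteq> 0)}
         homotopy_equivalent_space nsphere (2 * m + 1)"
proof -
  define Y where "Y = {U \<in> projections_on (insert b S). Re (U $ b $ b) > 0 \<and> (\<exists>i\<in>S. U $ i $ b \<noteq> 0)}"
  define N where "N = {x :: nat \<Rightarrow> real. (\<Sum>i\<le>2 * m + 1. x i ^ 2) = 1 \<and> (\<forall>i>2 * m + 1. x i = 0)}"
  have "card S = card {..m}" using m by simp
  then obtain e where e: "bij_betw e S {..m}"
    by (metis finite_atMost finite_code finite_same_card_bij)
  define ei where "ei = inv_into S e"
  have ei: "bij_betw ei {..m} S" unfolding ei_def using e by (rule bij_betw_inv_into)
  have eie: "ei (e i) = i" if "i \<in> S" for i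
    unfolding ei_def using e that by (meson bij_betw_inv_into_left)
  have eei: "e (ei j) = j" if "j \<le> m" for j
    unfolding ei_def using e that by (simp add: bij_betw_inv_into_right)
  have eiS: "ei j \<in> S" if "j \<le> m" for j
    using ei that by (auto simp: bij_betw_def)
  \<comment> \<open>For \<open>U = outer h\<close>, column \<open>b\<close> has the entries
    \<open>h $ i * cnj (h $ b)\<close>, a positive multiple of the affine coordinates
    \<open>h $ i / h $ b\<close>. Normalising its part on \<open>S\<close> gives a point of the
    sphere, with real and imaginary parts as coordinates \<open>2 * j\<close> and
    \<open>2 * j + 1\<close>.\<close>
  define \<rho> where "\<rho> U = sqrt (\<Sum>i\<in>S. (cmod (U $ i $ b))\<^sup>2)" for U :: "complex^'n^'n"
  define f where "f U = (\<lambda>k::nat. if k \<le> 2 * m + 1 then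
      (if even k then Re (U $ ei (k div 2) $ b) else Im (U $ ei (k div 2) $ b)) / \<rho> U else 0)"
    for U :: "complex^'n^'n"
  \<comment> \<open>The representative with entry 1 at \<open>b\<close> and a unit vector on
    \<open>S\<close>. Its squared norm is 2, hence the division by 2 in \<open>g\<close>.\<close>
  define hh where "hh x = (\<chi> i. if i = b then 1 else if i \<in> S then Complex (x (2 * e i)) (x (2 * e i + 1)) else 0)"
    for x :: "nat \<Rightarrow> real"
  define g where "g x = (\<chi> i j. outer (hh x) $ i $ j / 2)" for x
  have \<rho>pos: "\<rho> U > 0" if U: "U \<in> Y" for U
  proof -
    obtain i where "i \<in> S" "U $ i $ b \<noteq> 0" using U unfolding Y_def by blast
    then have "(\<Sum>i\<in>S. (cmod (U $ i $ b))\<^sup>2) > 0"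
      by (intro sum_pos2[of _ i]) auto
    then show ?thesis by (simp add: \<rho>_def)
  qed
  have sumf: "(\<Sum>i\<le>2 * m + 1. f U i ^ 2) = 1" if "U \<in> Y" for U
  proof -
    have "(\<Sum>i\<le>2 * m + 1. f U i ^ 2) = (\<Sum>j\<le>m. (cmod (U $ ei j $ b))\<^sup>2 / (\<rho> U)\<^sup>2)"
      unfolding sum_pairs by (rule sum.cong) (auto simp: f_def cmod_power2 power_divide add_divide_distrib)
    also have "\<dots> = (\<Sum>i\<in>S. (cmod (U $ i $ b))\<^sup>2 / (\<rho> U)\<^sup>2)"
      by (rule sum.reindex_bij_betw[OF ei])
    also have "\<dots> = (\<rho> U)\<^sup>2 / (\<rho> U)\<^sup>2"
      unfolding sum_divide_distrib[symmetric] by (simp add: \<rho>_def sum_nonneg)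
    finally show ?thesis using \<rho>pos[OF that] by simp
  qed
  have fN: "f U \<in> N" if "U \<in> Y" for U
    using sumf[OF that] by (auto simp: N_def f_def)
  have contf: "continuous_on Y f"
  proof (rule continuous_on_coordinatewise_then_product)
    fix k
    have "continuous_on Y \<rho>" unfolding \<rho>_def by (intro continuous_intros)
    then show "continuous_on Y (\<lambda>U. f U k)"
      using \<rho>pos by (cases "k \<le> 2 * m + 1"; cases "even k")
         (auto simp: f_def less_imp_neq[symmetric] dest: \<rho>pos intro!: continuous_intros)
  qed
  have hN: "(\<Sum>i\<in>S. (cmod (hh x $ i))\<^sup>2) = 1" if "x \<in> N" for x
  proof -
    have "(\<Sum>i\<in>S. (cmod (hh x $ i))\<^sup>2) = (\<Sum>j\<le>m. (cmod (hh x $ ei j))\<^sup>2)"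
      by (rule sum.reindex_bij_betw[OF ei, symmetric])
    also have "\<dots> = (\<Sum>j\<le>m. (x (2 * j))\<^sup>2 + (x (2 * j + 1))\<^sup>2)"
      by (rule sum.cong) (use eiS b in \<open>auto simp: hh_def eei cmod_power2\<close>)
    also have "\<dots> = 1" using that unfolding N_def sum_pairs by simp
    finally show ?thesis .
  qed
  have gY: "g x \<in> Y" if x: "x \<in> N" for x
  proof -
    define h where "h = (\<chi> i. hh x $ i / of_real (sqrt 2))"
    have so: "sum F UNIV = F b + sum F S" if "\<And>i. i \<notin> insert b S \<Longrightarrow> F i = 0" for F :: "'n \<Rightarrow> real"
    proof -
      have "sum F UNIV = sum F (insert b S)" using that by (intro sum.mono_neutral_right) auto
      then show ?thesis using b by simp
    qed
    have "(\<Sum>i\<in>UNIV. (cmod (hh x $ i))\<^sup>2) = 2"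
      using hN[OF x] by (subst so) (auto simp: hh_def)
    then have "(\<Sum>i\<in>UNIV. (cmod (h $ i))\<^sup>2) = 1"
      by (simp add: h_def norm_divide power_divide sum_divide_distrib[symmetric])
    moreover have "\<forall>i. i \<notin> insert b S \<longrightarrow> h $ i = 0" by (auto simp: h_def hh_def)
    ultimately have "outer h \<in> projections_on (insert b S)" unfolding projections_on_def by blast
    moreover have "g x = outer h"
    proof -
      have "complex_of_real (sqrt 2) * complex_of_real (sqrt 2) = 2"
        unfolding of_real_mult[symmetric] by simp
      then show ?thesis by (auto simp: g_def h_def vec_eq_iff)
    qed
    moreover have "\<exists>i\<in>S. g x $ i $ b \<noteq> 0"
    proof (rule ccontr)
      assume "\<not> ?thesis"
      then have "\<forall>i\<in>S. hh x $ i = 0" by (auto simp: g_def hh_def)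
      then show False using hN[OF x] by simp
    qed
    moreover have "Re (g x $ b $ b) > 0" by (simp add: g_def hh_def)
    ultimately show ?thesis by (simp add: Y_def)
  qed
  have contg: "continuous_on N g"
  proof -
    have c0: "continuous_on N (\<lambda>x. x k)" for k
      by (rule continuous_on_product_then_coordinatewise) (simp add: continuous_on_id)
    have c: "continuous_on N (\<lambda>x. Complex (x k) (x l))" for k l
      unfolding Complex_eq by (intro continuous_intros c0)
    have "continuous_on N hh"
      unfolding hh_def
    proof (intro continuous_intros)
      fix i show "continuous_on N (\<lambda>x. if i = b then 1 else if i \<in> S then Complex (x (2 * e i)) (x (2 * e i + 1)) else 0)"
        by (cases "i = b"; cases "i \<in> S") (simp_all add: c)
    qed
    then show ?thesis unfolding g_def outer_nth by (intro continuous_intros) auto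
  qed
  have fg: "f (g x) = x" if x: "x \<in> N" for x
  proof -
    have go: "g x $ i $ b = hh x $ i / 2" for i by (simp add: g_def hh_def)
    have "\<rho> (g x) = sqrt ((\<Sum>i\<in>S. (cmod (hh x $ i))\<^sup>2) / 4)"
      unfolding \<rho>_def go by (simp add: norm_divide power_divide sum_divide_distrib)
    then have \<rho>g: "\<rho> (g x) = 1 / 2" using hN[OF x] by (simp add: real_sqrt_divide)
    show ?thesis
    proof
      fix k
      show "f (g x) k = x k"
      proof (cases "k \<le> 2 * m + 1")
        case True
        then have k2: "k div 2 \<le> m" by simp
        have "hh x $ ei (k div 2) = Complex (x (2 * (k div 2))) (x (2 * (k div 2) + 1))"
          using eiS[OF k2] b by (auto simp: hh_def eei k2)
        then show ?thesis unfolding f_def go \<rho>g using True by (auto elim: oddE)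
      next
        case False
        then show ?thesis using x by (auto simp: f_def N_def)
      qed
    qed
  qed
  \<comment> \<open>The part of \<open>h\<close> on \<open>S\<close> is scaled from its own size to
    the norm of \<open>h $ b\<close>. As \<open>\<rho>\<close> is the product of these two norms,
    the final factor is \<open>Re (U $ b $ b) / \<rho> U\<close>. Both parts then have equal norm,
    as in the representative behind \<open>g (f U)\<close>.\<close>
  define F where "F p = rescale (\<lambda>k. if k = b then 1 else (1 - fst p) + fst p * Re (snd p $ b $ b) / \<rho> (snd p)) (snd p)"
    for p :: "real \<times> (complex^'n^'n)"
  have pos: "(\<Sum>k\<in>UNIV. (if k = b then 1 else c)\<^sup>2 * Re (U $ k $ k)) > 0"
    if "U \<in> Y" for U :: "complex^'n^'n" and c
    using diag_ge_sum[of U "insert b S" "{b}" "\<lambda>k. if k = b then 1 else c"] that by (auto simp: Y_def)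
  have FY: "F (t, U) \<in> Y" if t: "t \<in> {0..1}" and U: "U \<in> Y" for t U
  proof -
    let ?c = "(1 - t) + t * Re (U $ b $ b) / \<rho> U"
    have cpos: "?c > 0"
    proof (cases "t = 1")
      case True then show ?thesis using U \<rho>pos[OF U] by (auto simp: Y_def)
    next
      case False
      have "t * Re (U $ b $ b) / \<rho> U \<ge> 0" using U t \<rho>pos[OF U] by (auto simp: Y_def)
      moreover have "1 - t > 0" using False t by auto
      ultimately show ?thesis by linarith
    qed
    have Uo: "Re (U $ b $ b) > 0" "U \<in> projections_on (insert b S)" using U by (auto simp: Y_def)
    obtain i where i: "i \<in> S" "U $ i $ b \<noteq> 0" using U unfolding Y_def by blast
    have p: "(\<Sum>k\<in>UNIV. (if k = b then 1 else ?c)\<^sup>2 * Re (U $ k $ k)) > 0" using pos[OF U] .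
    have "F (t, U) \<in> projections_on (insert b S)"
      unfolding F_def fst_conv snd_conv using p Uo by (intro rescale_in_projections_on) auto
    moreover have "Re (F (t, U) $ b $ b) > 0"
    proof -
      have "F (t, U) $ b $ b = U $ b $ b / of_real (\<Sum>k\<in>UNIV. (if k = b then 1 else ?c)\<^sup>2 * Re (U $ k $ k))"
        unfolding F_def rescale_def fst_conv snd_conv by simp
      then show ?thesis using p Uo(1) by (simp add: Re_divide_of_real del: of_real_sum)
    qed
    moreover have "F (t, U) $ i $ b \<noteq> 0"
    proof -
      have "F (t, U) $ i $ b = of_real ?c * U $ i $ b / of_real (\<Sum>k\<in>UNIV. (if k = b then 1 else ?c)\<^sup>2 * Re (U $ k $ k))"
        using i b unfolding F_def rescale_def fst_conv snd_conv by auto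
      moreover have "complex_of_real ?c \<noteq> 0" using cpos by (simp only: of_real_eq_0_iff)
      moreover have "complex_of_real (\<Sum>k\<in>UNIV. (if k = b then 1 else ?c)\<^sup>2 * Re (U $ k $ k)) \<noteq> 0"
        using p by (simp only: of_real_eq_0_iff)
      ultimately show ?thesis using i by simp
    qed
    ultimately show ?thesis using i by (auto simp: Y_def)
  qed
  have contF: "continuous_on ({0..1} \<times> Y) F"
    unfolding F_def
  proof (rule continuous_on_rescale)
    fix i
    have "continuous_on ({0..1} \<times> Y) (\<lambda>p. \<rho> (snd p))" unfolding \<rho>_def by (intro continuous_intros)
    then have "continuous_on ({0..1} \<times> Y) (\<lambda>p. (1 - fst p) + fst p * Re (snd p $ b $ b) / \<rho> (snd p))"
      using \<rho>pos by (intro continuous_intros) (auto simp: less_imp_neq[symmetric])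
    then show "continuous_on ({0..1} \<times> Y) (\<lambda>p. if i = b then 1 else (1 - fst p) + fst p * Re (snd p $ b $ b) / \<rho> (snd p))"
      by (cases "i = b") simp_all
  next
    fix z assume "z \<in> {0..1::real} \<times> Y"
    then show "(\<Sum>k\<in>UNIV. (if k = b then 1 else 1 - fst z + fst z * Re (snd z $ b $ b) / \<rho> (snd z))\<^sup>2 * Re (snd z $ k $ k)) \<noteq> 0"
      by (intro less_imp_neq[symmetric] pos) auto
  qed (intro continuous_intros)
  have F0: "F (0, U) = U" if "U \<in> Y" for U
    unfolding F_def fst_conv snd_conv using that
    by (intro rescale_id[of _ "insert b S"]) (auto simp: Y_def)
  have F1: "F (1, U) = g (f U)" if U: "U \<in> Y" for U
  proof -
    have "U \<in> projections_on (insert b S)" using U by (simp add: Y_def)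
    then obtain h where h: "U = outer h" "\<forall>i. i \<notin> insert b S \<longrightarrow> h $ i = 0"
      by (auto simp: projections_on_def)
    have ho: "h $ b \<noteq> 0" using U h by (auto simp: Y_def)
    define c where "c = cmod (h $ b)"
    have c: "c > 0" using ho by (simp add: c_def)
    define s where "s = sqrt (\<Sum>i\<in>S. (cmod (h $ i))\<^sup>2)"
    have \<rho>: "\<rho> U = s * c"
      unfolding \<rho>_def h(1) s_def c_def
      by (simp add: norm_mult power_mult_distrib sum_distrib_right[symmetric] real_sqrt_mult)
    have s: "s > 0" using \<rho>pos[OF U] c unfolding \<rho> by (simp add: zero_less_mult_iff)
    have Uoo: "Re (U $ b $ b) = c\<^sup>2" unfolding h(1) Re_outer_diag c_def ..
    have s2: "(\<Sum>i\<in>S. (cmod (h $ i))\<^sup>2) = s\<^sup>2" by (simp add: s_def sum_nonneg)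
    define d where "d = (\<lambda>k. if k = b then 1 else c / s)"
    have Fd: "F (1, U) = rescale d U"
    proof -
      have e: "1 - 1 + 1 * c\<^sup>2 / (s * c) = c / s" using c s by (simp add: power2_eq_square)
      show ?thesis unfolding F_def d_def fst_conv snd_conv Uoo \<rho> e ..
    qed
    have tr: "(\<Sum>k\<in>UNIV. (d k)\<^sup>2 * Re (U $ k $ k)) = 2 * c\<^sup>2"
    proof -
      have "(\<Sum>k\<in>UNIV. (d k)\<^sup>2 * Re (U $ k $ k)) = (\<Sum>k\<in>insert b S. (d k)\<^sup>2 * (cmod (h $ k))\<^sup>2)"
        unfolding h(1) Re_outer_diag using h(2) by (intro sum.mono_neutral_right) auto
      also have "\<dots> = c\<^sup>2 + (\<Sum>k\<in>S. (c / s)\<^sup>2 * (cmod (h $ k))\<^sup>2)"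
        using b by (auto simp: d_def c_def intro!: sum.cong)
      also have "\<dots> = c\<^sup>2 + (c / s)\<^sup>2 * s\<^sup>2" unfolding s2[symmetric] by (simp add: sum_distrib_left)
      finally show ?thesis using s by (simp add: power_divide)
    qed
    have cc: "h $ b * cnj (h $ b) = of_real (c\<^sup>2)"
      unfolding c_def by (simp only: complex_norm_square)
    have hhf: "hh (f U) $ i = of_real (d i / c\<^sup>2) * (h $ i * cnj (h $ b))" for i
    proof (cases "i = b")
      case True
      then show ?thesis using c cc by (simp add: hh_def d_def)
    next
      case False
      show ?thesis
      proof (cases "i \<in> S")
        case True
        have le: "e i \<le> m" using e True by (auto simp: bij_betw_def)
        have "hh (f U) $ i = Complex (Re (U $ i $ b) / \<rho> U) (Im (U $ i $ b) / \<rho> U)"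
          using True False le by (simp add: hh_def f_def eie)
        also have "\<dots> = of_real (1 / (s * c)) * U $ i $ b"
          unfolding \<rho> by (simp add: complex_eq_iff)
        finally show ?thesis using c s False by (simp add: h(1) d_def power2_eq_square)
      next
        case f: False
        then show ?thesis using False h(2) by (simp add: hh_def)
      qed
    qed
    show ?thesis
      unfolding Fd
    proof (intro vec_eq_iff[THEN iffD2] allI)
      fix i j
      have "g (f U) $ i $ j = of_real (d i / c\<^sup>2) * (h $ i * cnj (h $ b)) * cnj (of_real (d j / c\<^sup>2) * (h $ j * cnj (h $ b))) / 2"
        by (simp add: g_def hhf)
      also have "\<dots> = of_real (d i * d j) * (h $ i * cnj (h $ j)) * (h $ b * cnj (h $ b)) / (2 * of_real (c\<^sup>2 * c\<^sup>2))"
        by (simp add: field_simps)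
      also have "\<dots> = of_real (d i * d j) * (h $ i * cnj (h $ j)) / of_real (2 * c\<^sup>2)"
        unfolding cc using c by (simp add: field_simps)
      also have "\<dots> = rescale d U $ i $ j"
        unfolding rescale_def tr by (simp add: h(1) field_simps)
      finally show "rescale d U $ i $ j = g (f U) $ i $ j" ..
    qed
  qed
  have hom: "homotopic_with (\<lambda>_. True) (top_of_set Y) (top_of_set Y) (g \<circ> f) id"
  proof -
    have "homotopic_with (\<lambda>_. True) (top_of_set Y) (top_of_set Y) (\<lambda>U. F (0, U)) (\<lambda>U. F (1, U))"
    proof (intro homotopic_with[THEN iffD2] exI[of _ F] conjI)
      show "continuous_map (prod_topology (top_of_set {0..1}) (top_of_set Y)) (top_of_set Y) F"
        using FY contF by auto
    qed auto
    then have "homotopic_with (\<lambda>_. True) (top_of_set Y) (top_of_set Y) id (g \<circ> f)"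
      by (rule homotopic_with_eq) (auto simp: F0 F1)
    then show ?thesis by (rule homotopic_with_symD)
  qed
  have "retraction_maps (top_of_set Y) (top_of_set N) f g"
    unfolding retraction_maps_def using contf contg fN gY fg by auto
  from deformation_retraction_imp_homotopy_equivalent_space[OF hom this]
  show ?thesis unfolding nsphere_eq Y_def N_def .
qed

section \<open>Trivial terms in the long exact sequence of a pair\<close>

lemma les_iso_subspace:
  assumes "trivial_group (relative_homology_group (p + 1) X S)" "trivial_group (relative_homology_group p X S)"
  shows "homology_group p (subtopology X S) \<cong> homology_group p X"
proof -
  have "exact_seq ([relative_homology_group p X S, homology_group p X, homology_group p (subtopology X S), relative_homology_group (p + 1) X S],
     [hom_induced p X {} X S id, hom_induced p (subtopology X S) {} X {} id, hom_boundary (p + 1) X S])"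
    using homology_exactness_axiom_3[of p X S] homology_exactness_axiom_2[of "p + 1" X S]
    by (metis add_diff_cancel_right' exact_seq_cons_iff)
  from very_short_exact_sequence[OF this assms] show ?thesis
    by (rule is_isoI)
qed

lemma les_iso_relative:
  assumes "trivial_group (homology_group p (subtopology X S))" "trivial_group (homology_group (p - 1) (subtopology X S))"
  shows "homology_group p X \<cong> relative_homology_group p X S"
proof -
  have "exact_seq ([homology_group (p - 1) (subtopology X S), relative_homology_group p X S, homology_group p X, homology_group p (subtopology X S)],
     [hom_boundary p X S, hom_induced p X {} X S id, hom_induced p (subtopology X S) {} X {} id])"
    using homology_exactness_axiom_3[of p X S] homology_exactness_axiom_1[of p X S]
    by (metis exact_seq_cons_iff)
  from very_short_exact_sequence[OF this assms] show ?thesis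
    by (rule is_isoI)
qed

lemma les_trivial:
  assumes S: "trivial_group (homology_group p (subtopology X S))"
    and XS: "trivial_group (relative_homology_group p X S)"
  shows "trivial_group (homology_group p X)"
proof -
  let ?i = "hom_induced p (subtopology X S) {} X {} id" and ?j = "hom_induced p X {} X S id"
  have "exact_seq ([relative_homology_group p X S, homology_group p X, homology_group p (subtopology X S)], [?j, ?i])"
    by (rule homology_exactness_axiom_3)
  then have ex: "?i ` carrier (homology_group p (subtopology X S)) = kernel (homology_group p X) (relative_homology_group p X S) ?j"
    by simp
  have j: "?j \<in> hom (homology_group p X) (relative_homology_group p X S)" and
    i: "?i \<in> hom (homology_group p (subtopology X S)) (homology_group p X)"
    by (auto simp: hom_induced_hom)
  have "kernel (homology_group p X) (relative_homology_group p X S) ?j = carrier (homology_group p X)"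
    using XS j unfolding kernel_def trivial_group_def hom_def by auto
  moreover have "?i ` carrier (homology_group p (subtopology X S)) = {\<one>\<^bsub>homology_group p X\<^esub>}"
    using S i hom_one[OF i] unfolding trivial_group_def by auto
  ultimately show ?thesis using ex by (simp add: trivial_group_def)
qed

text \<open>The image under \<open>outer\<close> of a compact part of the unit sphere. Closedness is
  what excision asks of the removed hyperplane.\<close>

lemma closed_projections_on: "closed (projections_on S :: (complex^'n^'n) set)"
proof -
  have "compact {h :: complex^'n. (\<Sum>i\<in>UNIV. (cmod (h $ i))\<^sup>2) = 1 \<and> (\<forall>i. i \<notin> S \<longrightarrow> h $ i = 0)}"
  proof (rule compact_Int_closed[of "sphere 0 1", THEN back_subst[of compact]])
    show "compact (sphere (0 :: complex^'n) 1)" by simp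
    show "closed {h :: complex^'n. \<forall>i. i \<notin> S \<longrightarrow> h $ i = 0}"
      by (intro closed_Collect_all closed_Collect_imp closed_Collect_eq continuous_intros) auto
    show "sphere 0 1 \<inter> {h :: complex^'n. \<forall>i. i \<notin> S \<longrightarrow> h $ i = 0} =
       {h. (\<Sum>i\<in>UNIV. (cmod (h $ i))\<^sup>2) = 1 \<and> (\<forall>i. i \<notin> S \<longrightarrow> h $ i = 0)}"
      by (auto simp: norm_vec_def L2_set_def)
  qed
  then have "compact (outer ` {h :: complex^'n. (\<Sum>i\<in>UNIV. (cmod (h $ i))\<^sup>2) = 1 \<and> (\<forall>i. i \<notin> S \<longrightarrow> h $ i = 0)})"
    by (rule compact_continuous_image[rotated]) (auto simp: outer_def intro!: continuous_intros)
  moreover have "outer ` {h :: complex^'n. (\<Sum>i\<in>UNIV. (cmod (h $ i))\<^sup>2) = 1 \<and> (\<forall>i. i \<notin> S \<longrightarrow> h $ i = 0)} = projections_on S"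
    by (auto simp: projections_on_def)
  ultimately show ?thesis by (metis compact_imp_closed)
qed

lemma outer_axis_in: "outer (axis b 1 :: complex^'n) \<in> projections_on (insert b S)"
proof -
  have "(\<Sum>i\<in>UNIV. (cmod ((axis b 1 :: complex^'n) $ i))\<^sup>2) = (\<Sum>i\<in>UNIV. if i = b then 1 else 0)"
    by (intro sum.cong) (auto simp: axis_def)
  then have "(\<Sum>i\<in>UNIV. (cmod ((axis b 1 :: complex^'n) $ i))\<^sup>2) = 1" by simp
  then show ?thesis by (auto simp: projections_on_def axis_def intro!: exI[of _ "axis b 1"])
qed

lemma projections_on_singleton: "projections_on {b} = {outer (axis b 1)}"
proof -
  have "U = outer (axis b 1)" if "U \<in> projections_on {b}" for U
  proof -
    obtain h where h: "U = outer h" "(\<Sum>i\<in>UNIV. (cmod (h $ i))\<^sup>2) = 1" "\<forall>i. i \<notin> {b} \<longrightarrow> h $ i = 0"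
      using \<open>U \<in> projections_on {b}\<close> by (auto simp: projections_on_def)
    have "(\<Sum>i\<in>UNIV. (cmod (h $ i))\<^sup>2) = (\<Sum>i\<in>{b}. (cmod (h $ i))\<^sup>2)"
      using h(3) by (intro sum.mono_neutral_right) auto
    then have "h $ b * cnj (h $ b) = 1" using h(2) complex_norm_square[of "h $ b"] by simp
    then show ?thesis unfolding h(1) using h(3) by (auto simp: vec_eq_iff axis_def)
  qed
  then show ?thesis using outer_axis_in[of b "{}"] by blast
qed

text \<open>Attaching a cell of dimension \<open>2 m\<close> to \<open>\<complex>P\<^sup>m\<^sup>-\<^sup>1\<close>.\<close>

lemma relative_homology_projections_on:
  fixes S :: "('n::finite) set"
  assumes b: "b \<notin> S" and m: "card S = Suc m"
  defines "X \<equiv> top_of_set (projections_on (insert b S) :: (complex^'n^'n) set)"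
    and "p \<equiv> (outer (axis b 1) :: complex^'n^'n)"
  shows "relative_homology_group q X (projections_on (insert b S) - {p}) \<cong>
         reduced_homology_group (q - 1) (nsphere (2 * m + 1))"
    and "subtopology X (projections_on (insert b S) - {p}) homotopy_equivalent_space top_of_set (projections_on S :: (complex^'n^'n) set)"
proof -
  let ?M = "projections_on (insert b S) :: (complex^'n^'n) set"
  let ?A = "projections_on S :: (complex^'n^'n) set"
  define V where "V = {U \<in> ?M. Re (U $ b $ b) > 0}"
  define W where "W = {U \<in> ?M. Re (U $ b $ b) > 0 \<and> (\<exists>i\<in>S. U $ i $ b \<noteq> 0)}"
  have AM: "?A \<subseteq> ?M" by (rule projections_on_mono) auto
  have p: "p \<in> ?M" unfolding p_def by (rule outer_axis_in)
  have pb: "p $ b $ b = 1" by (simp add: p_def axis_def)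
  have pA: "p \<notin> ?A" using projections_on_zero[of p S b b] b pb by auto
  have M_A: "?M - ?A = V"
  proof -
    have "U \<in> ?A \<longleftrightarrow> Re (U $ b $ b) = 0" if U: "U \<in> ?M" for U
    proof
      assume "U \<in> ?A" then show "Re (U $ b $ b) = 0" using projections_on_zero[of U S b b] b by auto
    next
      assume 0: "Re (U $ b $ b) = 0"
      obtain h where h: "U = outer h" "\<forall>i. i \<notin> insert b S \<longrightarrow> h $ i = 0"
        using U by (auto simp: projections_on_def)
      have "h $ b = 0" using 0 unfolding h(1) Re_outer_diag by simp
      then have "U $ i $ i = 0" if "i \<notin> S" for i using h that by (cases "i = b") auto
      then show "U \<in> ?A" by (rule projections_on_eqI[OF U])
    qed
    then show ?thesis unfolding V_def using projections_on_trace(2) by (auto simp: order.strict_iff_order)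
  qed
  have Wp: "(?M - {p}) - ?A = W"
  proof -
    have "U = p" if U: "U \<in> ?M" "\<forall>i\<in>S. U $ i $ b = 0" "Re (U $ b $ b) > 0" for U
    proof -
      obtain h where h: "U = outer h" "\<forall>i. i \<notin> insert b S \<longrightarrow> h $ i = 0"
        using U by (auto simp: projections_on_def)
      have "h $ b \<noteq> 0" using U(3) h(1) by auto
      then have "h $ i = 0" if "i \<noteq> b" for i using h U(2) that by (cases "i \<in> S") auto
      then have "U $ i $ i = 0" if "i \<notin> {b}" for i using h that by auto
      then have "U \<in> projections_on {b}" by (rule projections_on_eqI[OF U(1)])
      then show ?thesis by (simp add: projections_on_singleton p_def)
    qed
    moreover have "p $ i $ b = 0" if "i \<in> S" for i using that b by (auto simp: p_def axis_def)
    moreover have "(?M - {p}) - ?A = V - {p}" using M_A by blast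
    ultimately show ?thesis unfolding W_def V_def by blast
  qed
  have Ac: "X closure_of ?A \<subseteq> X interior_of (?M - {p})"
  proof -
    have "closedin X ?A" unfolding X_def using AM closed_projections_on closed_subset by blast
    then have 1: "X closure_of ?A = ?A" by (simp add: closure_of_closedin)
    have "openin X (?M - {p})" unfolding X_def
      by (metis openin_delete openin_subtopology_self t1_space_euclidean t1_space_subtopology t1_space_openin_delete_alt)
    then have 2: "X interior_of (?M - {p}) = ?M - {p}" by (simp add: interior_of_openin)
    show ?thesis unfolding 1 2 using AM pA by auto
  qed
  have sub: "subtopology X (?M - ?A) = top_of_set V" "subtopology X ?M = X"
    unfolding M_A unfolding X_def by (auto simp: subtopology_subtopology V_def Int_absorb1)
  \<comment> \<open>Excising the hyperplane \<open>?A\<close> leaves the affine chart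
    \<open>V\<close> and the punctured chart \<open>W\<close>. Since \<open>V\<close> is
    contractible, the relative homology is the reduced homology of \<open>W\<close> one degree
    lower, and \<open>W\<close> is a sphere up to homotopy.\<close>
  have exc: "relative_homology_group q (top_of_set V) W \<cong> relative_homology_group q X (?M - {p})"
    using homology_excision_axiom[OF Ac, of ?M q] unfolding Wp sub by (meson Diff_subset is_isoI)
  have rs: "rescale (\<lambda>k. if k \<in> {b} then 1 else t) U \<in> V" if U: "U \<in> V" for U t
  proof -
    have pos: "(\<Sum>k\<in>UNIV. (if k \<in> {b} then 1 else t)\<^sup>2 * Re (U $ k $ k)) > 0"
      using diag_ge_sum[of U "insert b S" "{b}" "\<lambda>k. if k \<in> {b} then 1 else t"] U by (auto simp: V_def)
    have "rescale (\<lambda>k. if k \<in> {b} then 1 else t) U \<in> ?M"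
      by (rule rescale_in_projections_on[of U "insert b S"]) (use U pos in \<open>auto simp: V_def\<close>)
    moreover have "rescale (\<lambda>k. if k \<in> {b} then 1 else t) U $ b $ b =
       U $ b $ b / of_real (\<Sum>k\<in>UNIV. (if k \<in> {b} then 1 else t)\<^sup>2 * Re (U $ k $ k))"
      by (simp add: rescale_def)
    ultimately show ?thesis using pos U unfolding V_def by (simp add: Re_divide_of_real del: of_real_sum)
  qed
  have "top_of_set V homotopy_equivalent_space top_of_set (V \<inter> projections_on {b})"
    by (rule projections_on_retract[of V "insert b S"]) (use rs in \<open>auto simp: V_def\<close>)
  moreover have "V \<inter> projections_on {b} = {p}"
    unfolding projections_on_singleton using p pb by (auto simp: V_def p_def)
  ultimately have contr: "contractible_space (top_of_set V)"
    using homotopy_equivalent_space_contractibility contractible_space_singleton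
    by (metis contractible_space_subtopology_singleton)
  obtain s where s: "s \<in> S" using m by (metis card_eq_SucD insertI1)
  have sb: "s \<noteq> b" using s b by auto
  have "W \<noteq> {}"
  proof -
    define h where "h = (\<chi> i. if i = b \<or> i = s then complex_of_real (1 / sqrt 2) else 0)"
    have "(\<Sum>i\<in>UNIV. (cmod (h $ i))\<^sup>2) = (\<Sum>i\<in>{b, s}. (cmod (h $ i))\<^sup>2)"
      by (intro sum.mono_neutral_right) (auto simp: h_def)
    also have "\<dots> = 1" using sb by (simp add: h_def norm_divide power_divide)
    finally have "outer h \<in> ?M" using s by (auto simp: projections_on_def h_def intro!: exI[of _ h])
    then have "outer h \<in> W" unfolding W_def using s by (auto simp: h_def intro!: bexI[of _ s])
    then show ?thesis by auto
  qed
  then have "topspace (top_of_set V) \<inter> W \<noteq> {}" unfolding V_def W_def by auto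
  from isomorphic_group_relative_homology_of_contractible[OF contr this]
  have i2: "relative_homology_group q (top_of_set V) W \<cong> reduced_homology_group (q - 1) (top_of_set W)"
    by (simp add: subtopology_subtopology) (metis (no_types, lifting) Collect_mono Int_absorb1 V_def W_def)
  have i3: "reduced_homology_group (q - 1) (top_of_set W) \<cong> reduced_homology_group (q - 1) (nsphere (2 * m + 1))"
    unfolding W_def
    by (intro homotopy_equivalent_space_imp_isomorphic_reduced_homology_groups punctured_chart_homotopy_equivalent_nsphere b m)
  show "relative_homology_group q X (?M - {p}) \<cong> reduced_homology_group (q - 1) (nsphere (2 * m + 1))"
    using exc i2 i3 by (meson group.iso_sym group_relative_homology_group iso_trans)
  have "subtopology X (?M - {p}) = top_of_set (?M - {p})"
    unfolding X_def by (simp add: subtopology_subtopology Int_absorb1)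
  \<comment> \<open>Away from \<open>p\<close> the part on \<open>S\<close> never vanishes, so
    shrinking the entry at \<open>b\<close> pushes the punctured space onto the hyperplane
    \<open>?A\<close>: the linear projection from \<open>p\<close>.\<close>
  moreover have "top_of_set (?M - {p}) homotopy_equivalent_space top_of_set ((?M - {p}) \<inter> ?A)"
  proof (rule projections_on_retract[of _ "insert b S"])
    show spos: "(\<Sum>k\<in>S. Re (U $ k $ k)) > 0" if U: "U \<in> ?M - {p}" for U
    proof (rule ccontr)
      assume "\<not> ?thesis"
      then have "(\<Sum>k\<in>S. Re (U $ k $ k)) = 0"
        using sum_nonneg[of S "\<lambda>k. Re (U $ k $ k)"] projections_on_trace(2)[of U "insert b S"] U by fastforce
      then have "\<forall>k\<in>S. Re (U $ k $ k) = 0"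
        using projections_on_trace(2)[of U "insert b S"] U by (subst (asm) sum_nonneg_eq_0_iff) auto
      then have "U $ i $ i = 0" if "i \<notin> {b}" for i
        using U that by (cases "i \<in> S") (auto simp: projections_on_def complex_eq_iff)
      then have "U \<in> projections_on {b}" using U by (auto intro: projections_on_eqI)
      then show False using U by (simp add: projections_on_singleton p_def)
    qed
    fix U :: "complex^'n^'n" and t :: real
    assume U: "U \<in> ?M - {p}" and t: "0 \<le> t" "t \<le> 1"
    let ?d = "\<lambda>k. if k \<in> S then 1 else t"
    have pos: "(\<Sum>k\<in>UNIV. (?d k)\<^sup>2 * Re (U $ k $ k)) > 0"
      using diag_ge_sum[of U "insert b S" S ?d] spos[OF U] U by auto
    have "rescale ?d U \<in> ?M"
      by (rule rescale_in_projections_on[of U "insert b S"]) (use U pos in auto)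
    moreover have "rescale ?d U \<noteq> p"
    proof
      assume eq: "rescale ?d U = p"
      have "\<forall>k\<in>S. U $ k $ k = 0"
      proof
        fix k assume k: "k \<in> S"
        have "rescale ?d U $ k $ k = U $ k $ k / of_real (\<Sum>k\<in>UNIV. (?d k)\<^sup>2 * Re (U $ k $ k))"
          using k by (simp add: rescale_def)
        moreover have "p $ k $ k = 0" using k b by (auto simp: p_def axis_def)
        moreover have "complex_of_real (\<Sum>k\<in>UNIV. (?d k)\<^sup>2 * Re (U $ k $ k)) \<noteq> 0"
          using pos by (simp only: of_real_eq_0_iff)
        ultimately show "U $ k $ k = 0" using eq by simp
      qed
      then show False using spos[OF U] by simp
    qed
    ultimately show "rescale ?d U \<in> ?M - {p}" by simp
  qed auto
  moreover have "(?M - {p}) \<inter> ?A = ?A" using AM pA by auto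
  ultimately show "subtopology X (?M - {p}) homotopy_equivalent_space top_of_set ?A" by simp
qed

text \<open>The cell attached to the smaller space has dimension \<open>2 * card S\<close>, while
  the homology already present lies in even degrees below that. Adjacent degrees are never both
  occupied, so the long exact sequence falls apart into isomorphisms and the cell adds one copy of
  the integers. A single point is a second base case, because the punctured chart of the cell
  argument must be nonempty.\<close>

lemma homology_projections_on:
  fixes S :: "('n::finite) set"
  shows "(even q \<and> 0 \<le> q \<and> q < 2 * int (card S) \<longrightarrow>
            homology_group q (top_of_set (projections_on S :: (complex^'n^'n) set)) \<cong> integer_group) \<and>
         (\<not> (even q \<and> 0 \<le> q \<and> q < 2 * int (card S)) \<longrightarrow>
            trivial_group (homology_group q (top_of_set (projections_on S :: (complex^'n^'n) set))))"
  using finite[of S]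
proof (induction S arbitrary: q rule: finite_induct)
  case empty
  have "projections_on {} = ({} :: (complex^'n^'n) set)"
    by (auto simp: projections_on_def) (metis (no_types, lifting) norm_zero power_zero_numeral sum.neutral zero_neq_one)
  then have "trivial_group (homology_group q (top_of_set (projections_on {} :: (complex^'n^'n) set)))"
    by (intro trivial_homology_group_empty) simp
  moreover have "\<not> (even q \<and> 0 \<le> q \<and> q < 2 * int (card {}))" by simp
  ultimately show ?case by blast
next
  case (insert b S)
  let ?X = "top_of_set (projections_on (insert b S) :: (complex^'n^'n) set)"
  show ?case
  proof (cases "card S")
    case 0
    then have "topspace ?X = {outer (axis b 1)}" using insert by (simp add: projections_on_singleton)
    then show ?thesis
      using 0 insert homology_dimension_axiom[of ?X _ q] homology_coefficients[of ?X]
      by (cases "q = 0") auto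
  next
    case (Suc m)
    let ?Y = "projections_on (insert b S) - {outer (axis b 1)} :: (complex^'n^'n) set"
    let ?B = "homology_group q (top_of_set (projections_on S :: (complex^'n^'n) set))"
    note R = relative_homology_projections_on[OF insert(2) Suc]
    have rel: "relative_homology_group q ?X ?Y \<cong> reduced_homology_group (q - 1) (nsphere (2 * m + 1))" for q
      by (rule R(1))
    have relt: "trivial_group (relative_homology_group q ?X ?Y)" if "q \<noteq> 2 * int m + 2" for q
    proof -
      have "trivial_group (reduced_homology_group (q - 1) (nsphere (2 * m + 1)))"
        using that by (intro reduced_homology_group_nsphere(2)) auto
      then show ?thesis using isomorphic_group_triviality[OF rel[of q]] by simp
    qed
    have relz: "relative_homology_group (2 * int m + 2) ?X ?Y \<cong> integer_group"
    proof -
      have "reduced_homology_group (2 * int m + 2 - 1) (nsphere (2 * m + 1)) \<cong> integer_group"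
        using reduced_homology_group_nsphere(1)[of "2 * m + 1"] by (simp add: add.commute)
      then show ?thesis using rel[of "2 * int m + 2"] iso_trans by blast
    qed
    have subi: "homology_group q (subtopology ?X ?Y) \<cong> homology_group q (top_of_set (projections_on S :: (complex^'n^'n) set))" for q
      by (rule homotopy_equivalent_space_imp_isomorphic_homology_groups[OF R(2)])
    have subt: "trivial_group (homology_group q (subtopology ?X ?Y))" if "\<not> (even q \<and> 0 \<le> q \<and> q < 2 * int (card S))" for q
      using isomorphic_group_triviality[OF subi[of q]] insert(3)[of q] that by auto
    have cardS: "card (insert b S) = Suc (Suc m)" using insert Suc by simp
    consider "q = 2 * int m + 2" | "odd q" | "even q" "q \<noteq> 2 * int m + 2" by blast
    then show ?thesis
    proof cases
      case 1
      have "homology_group q ?X \<cong> relative_homology_group q ?X ?Y"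
        by (rule les_iso_relative; rule subt) (use 1 Suc in auto)
      then show ?thesis using relz 1 cardS iso_trans by auto
    next
      case 2
      have "trivial_group (homology_group q ?X)"
        by (rule les_trivial[OF subt relt]) (use 2 in auto)
      then show ?thesis using 2 by simp
    next
      case 3
      have "homology_group q (subtopology ?X ?Y) \<cong> homology_group q ?X"
        by (rule les_iso_subspace; rule relt) (use 3 in auto)
      then have "?B \<cong> homology_group q ?X"
        using subi[of q] by (meson group.iso_sym group_relative_homology_group iso_trans)
      show ?thesis
      proof (cases "0 \<le> q \<and> q < 2 * int (card S)")
        case True
        then have "?B \<cong> integer_group" using 3 insert(3)[of q] by auto
        moreover have "homology_group q ?X \<cong> ?B"
          using \<open>?B \<cong> homology_group q ?X\<close> by (meson group.iso_sym group_relative_homology_group)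
        ultimately have "homology_group q ?X \<cong> integer_group" by (rule iso_trans[rotated])
        then show ?thesis using True 3 cardS Suc by simp
      next
        case False
        then have "trivial_group ?B" using insert(3)[of q] by auto
        then have "trivial_group (homology_group q ?X)"
          using isomorphic_group_triviality[OF \<open>?B \<cong> homology_group q ?X\<close>] by simp
        moreover have "\<not> (even q \<and> 0 \<le> q \<and> q < 2 * int (card (insert b S)))"
        proof
          assume a: "even q \<and> 0 \<le> q \<and> q < 2 * int (card (insert b S))"
          then obtain k where "q = 2 * k" by auto
          then show False using a False 3(2) unfolding cardS Suc by presburger
        qed
        ultimately show ?thesis by blast
      qed
    qed
  qed
qed

section \<open>Ranks of homology groups and the Euler characteristic\<close>

lemma abelian_rank_trivial:
  assumes "Group.comm_group G" "trivial_group G"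
  shows "abelian_rank G = 0"
proof -
  interpret comm_group G by (rule assms)
  have G: "carrier G = {\<one>\<^bsub>G\<^esub>}" using assms(2) by (simp add: trivial_group_def)
  have "S = {}" if S: "int_independent G S" for S
  proof (rule ccontr)
    assume "S \<noteq> {}"
    moreover have "S \<subseteq> carrier G" using S by (simp add: int_independent_def)
    ultimately have S1: "S = {\<one>\<^bsub>G\<^esub>}" using G by auto
    have ind: "\<forall>s\<in>S. c s = 0" if "finprod G (\<lambda>s. s [^]\<^bsub>G\<^esub> c s) S = \<one>\<^bsub>G\<^esub>" for c :: "'a \<Rightarrow> int"
      using S that by (simp add: int_independent_def)
    have "finprod G (\<lambda>s. s [^]\<^bsub>G\<^esub> (1::int)) S = \<one>\<^bsub>G\<^esub>"
      unfolding S1 by (simp add: finprod_insert)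
    from ind[OF this] show False using S1 by simp
  qed
  moreover have "int_independent G {}" by (simp add: int_independent_def)
  ultimately have "{S. int_independent G S} = {{}}" by blast
  then show ?thesis by (simp add: abelian_rank_def)
qed

lemma abelian_rank_integer_group:
  assumes "Group.comm_group G" "G \<cong> integer_group"
  shows "abelian_rank G = 1"
proof -
  interpret comm_group G by (rule assms)
  obtain f where f: "f \<in> iso G integer_group" using assms(2) by (auto simp: is_iso_def)
  then have fh: "f \<in> hom G integer_group" and inj: "inj_on f (carrier G)" and surj: "f ` carrier G = UNIV"
    by (auto simp: iso_def bij_betw_def)
  interpret Z: Group.group integer_group by simp
  interpret gh: group_hom G integer_group f
    by (unfold_locales) (rule fh)
  have pow: "f (x [^]\<^bsub>G\<^esub> k) = k * f x" if "x \<in> carrier G" for x and k :: int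
    using gh.hom_int_pow[OF that, of k] by simp
  have one: "x = \<one>\<^bsub>G\<^esub>" if "x \<in> carrier G" "f x = 0" for x
    using inj that gh.hom_one one_closed unfolding inj_on_def by (metis one_integer_group)
  have c1: "card S \<le> 1" if S: "int_independent G S" for S
  proof (rule ccontr)
    assume "\<not> card S \<le> 1"
    then obtain a b where ab: "a \<in> S" "b \<in> S" "a \<noteq> b"
      by (metis One_nat_def card_le_Suc0_iff_eq int_independent_def S)
    have fin: "finite S" and sub: "S \<subseteq> carrier G" using S by (auto simp: int_independent_def)
    \<comment> \<open>Any two integers satisfy \<open>f b * f a - f a * f b = 0\<close>.
      Independence makes both coefficients vanish, and then injectivity of \<open>f\<close> gives
      \<open>a = b\<close>.\<close>
    define c where "c = (\<lambda>s. if s = a then f b else if s = b then - f a else 0)"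
    have ab': "a \<in> carrier G" "b \<in> carrier G" using ab sub by auto
    have "finprod G (\<lambda>s. s [^]\<^bsub>G\<^esub> c s) S = finprod G (\<lambda>s. s [^]\<^bsub>G\<^esub> c s) {a, b}"
      using ab fin sub by (intro finprod_mono_neutral_cong_right) (auto simp: c_def)
    also have "\<dots> = a [^]\<^bsub>G\<^esub> f b \<otimes>\<^bsub>G\<^esub> b [^]\<^bsub>G\<^esub> (- f a)"
      using ab' ab(3) by (simp add: c_def)
    also have "\<dots> = \<one>\<^bsub>G\<^esub>"
    proof (rule one)
      show "a [^]\<^bsub>G\<^esub> f b \<otimes>\<^bsub>G\<^esub> b [^]\<^bsub>G\<^esub> (- f a) \<in> carrier G" using ab' by auto
      have "f (a [^]\<^bsub>G\<^esub> f b \<otimes>\<^bsub>G\<^esub> b [^]\<^bsub>G\<^esub> (- f a)) = f (a [^]\<^bsub>G\<^esub> f b) + f (b [^]\<^bsub>G\<^esub> (- f a))"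
        using gh.hom_mult[of "a [^]\<^bsub>G\<^esub> f b" "b [^]\<^bsub>G\<^esub> (- f a)"] ab' int_pow_closed by (simp add: mult_integer_group)
      then show "f (a [^]\<^bsub>G\<^esub> f b \<otimes>\<^bsub>G\<^esub> b [^]\<^bsub>G\<^esub> (- f a)) = 0"
        using pow ab' by simp
    qed
    finally have "\<forall>s\<in>S. c s = 0" using S unfolding int_independent_def by blast
    then have "f a = 0" "f b = 0" using ab by (auto simp: c_def split: if_splits)
    then show False using one ab' ab(3) by metis
  qed
  obtain g where g: "g \<in> carrier G" "f g = 1" using surj by (metis UNIV_I imageE)
  have "int_independent G {g}"
    unfolding int_independent_def
  proof (intro conjI allI impI ballI)
    fix c :: "'a \<Rightarrow> int" and s
    assume "finprod G (\<lambda>s. s [^]\<^bsub>G\<^esub> c s) {g} = \<one>\<^bsub>G\<^esub>" "s \<in> {g}"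
    then have "g [^]\<^bsub>G\<^esub> c g = \<one>\<^bsub>G\<^esub>" using g by simp
    then have "c g * f g = 0" using pow[OF g(1), of "c g"] gh.hom_one by (simp add: one_integer_group)
    then show "c s = 0" using g \<open>s \<in> {g}\<close> by simp
  qed (use g in auto)
  then have "1 \<in> card ` {S. int_independent G S}" by (intro image_eqI[of _ _ "{g}"]) auto
  then show ?thesis unfolding abelian_rank_def
    by (intro cSup_eq_maximum) (use c1 in auto)
qed

lemma euler_characteristic_homotopy_equivalent_projections_on:
  fixes S :: "('n::finite) set"
  assumes "X homotopy_equivalent_space top_of_set (projections_on S :: (complex^'n^'n) set)"
  shows "euler_characteristic X = int (card S)"
proof -
  have iso: "homology_group q X \<cong> homology_group q (top_of_set (projections_on S :: (complex^'n^'n) set))" for q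
    using assms by (rule homotopy_equivalent_space_imp_isomorphic_homology_groups)
  have b: "betti_number p X = (if even p \<and> p < 2 * card S then 1 else 0)" for p
  proof (cases "even p \<and> p < 2 * card S")
    case True
    then have "even (int p) \<and> 0 \<le> int p \<and> int p < 2 * int (card S)" by auto
    then have "homology_group (int p) X \<cong> integer_group"
      using homology_projections_on[where 'n='n, of "int p" S] iso_trans[OF iso] by blast
    then show ?thesis using True
      unfolding betti_number_def by (simp add: abelian_rank_integer_group abelian_homology_group)
  next
    case False
    then have "\<not> (even (int p) \<and> 0 \<le> int p \<and> int p < 2 * int (card S))" by auto
    then have "trivial_group (homology_group (int p) (top_of_set (projections_on S :: (complex^'n^'n) set)))"
      using homology_projections_on[where 'n='n, of "int p" S] by blast
    then have "trivial_group (homology_group (int p) X)"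
      using isomorphic_group_triviality[OF iso] by simp
    then show ?thesis unfolding betti_number_def using False by (auto simp: abelian_rank_trivial abelian_homology_group)
  qed
  have "{p. even p \<and> p < 2 * card S} = (\<lambda>k. 2 * k) ` {..<card S}"
    by (auto elim!: evenE)
  then show ?thesis
    unfolding euler_characteristic_def b by (simp add: sum.reindex inj_on_def)
qed

section \<open>Spectra of Hermitian matrices\<close>

definition diagonalizes :: "'n set \<Rightarrow> complex^'n^'n \<Rightarrow> complex^'n^'n \<Rightarrow> ('n \<Rightarrow> real) \<Rightarrow> bool" where
  "diagonalizes S B U \<mu> \<longleftrightarrow> unitary_on S U \<and> B = U ** diag_on S (\<lambda>i. of_real (\<mu> i)) ** adjoint_matrix U"

text \<open>The traces of these powers are the power sums of the spectrum. Both the uniqueness of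
  the spectrum and its Borel dependence on the matrix are read off from them. The zeroth power is
  the unit of the block, so its trace is \<open>card S\<close>.\<close>

definition matpow_on :: "'n set \<Rightarrow> complex^'n^'n \<Rightarrow> nat \<Rightarrow> complex^'n^'n" where
  "matpow_on S B k = ((\<lambda>X. X ** B) ^^ k) (one_on S)"

definition spectrum_on :: "'n set \<Rightarrow> complex^'n^'n \<Rightarrow> real multiset" where
  "spectrum_on S B = (THE M. \<exists>U \<mu>. diagonalizes S B U \<mu> \<and> M = image_mset \<mu> (mset_set S))"

lemma trace_diag_on: "trace (diag_on S d) = (\<Sum>i\<in>S. d i)"
  by (simp add: trace_def diag_on_nth sum.If_cases)

lemma unitary_conj_mult:
  assumes "unitary_on S U"
  shows "(U ** diag_on S d ** adjoint_matrix U) ** (U ** diag_on S e ** adjoint_matrix U) =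
         U ** diag_on S (\<lambda>i. d i * e i) ** adjoint_matrix U"
proof -
  have "(U ** diag_on S d ** adjoint_matrix U) ** (U ** diag_on S e ** adjoint_matrix U) =
    U ** (diag_on S d ** (adjoint_matrix U ** U) ** diag_on S e) ** adjoint_matrix U"
    by (simp only: matrix_mul_assoc)
  then show ?thesis
    using assms by (simp add: unitary_on_def diag_on_mult_diag_on)
qed

lemma matpow_on_diagonalizes:
  assumes "diagonalizes S B U \<mu>"
  shows "matpow_on S B k = U ** diag_on S (\<lambda>i. of_real (\<mu> i ^ k)) ** adjoint_matrix U"
proof (induction k)
  case 0
  have "U ** one_on S = U" using assms by (simp add: diagonalizes_def unitary_on_def mult_one_on)
  then show ?case using assms by (simp add: matpow_on_def diagonalizes_def unitary_on_def)
next
  case (Suc k)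
  have "matpow_on S B (Suc k) = matpow_on S B k ** B" by (simp add: matpow_on_def)
  also have "\<dots> = U ** diag_on S (\<lambda>i. of_real (\<mu> i ^ k) * of_real (\<mu> i)) ** adjoint_matrix U"
    unfolding Suc using assms by (simp add: diagonalizes_def unitary_conj_mult)
  finally show ?case by (simp add: mult.commute)
qed

lemma trace_unitary_conj:
  assumes "unitary_on S U"
  shows "trace (U ** diag_on S d ** adjoint_matrix U) = (\<Sum>i\<in>S. d i)"
proof -
  have "trace (U ** diag_on S d ** adjoint_matrix U) = trace (adjoint_matrix U ** (U ** diag_on S d))"
    by (rule trace_mul_sym)
  also have "adjoint_matrix U ** (U ** diag_on S d) = diag_on S d"
    using assms by (simp add: matrix_mul_assoc unitary_on_def one_on_mult)
  finally show ?thesis by (simp add: trace_diag_on)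
qed

lemma trace_matpow_on:
  assumes "diagonalizes S B U \<mu>"
  shows "trace (matpow_on S B k) = of_real (\<Sum>i\<in>S. \<mu> i ^ k)"
  using assms unfolding matpow_on_diagonalizes[OF assms] by (simp add: diagonalizes_def trace_unitary_conj)

lemma sum_poly_diagonalizes:
  assumes "diagonalizes S B U \<mu>"
  shows "(\<Sum>i\<in>S. poly p (\<mu> i)) = (\<Sum>k\<le>Polynomial.degree p. Polynomial.coeff p k * Re (trace (matpow_on S B k)))"
  unfolding trace_matpow_on[OF assms] Re_complex_of_real poly_altdef sum_distrib_left
  by (rule sum.swap)

lemma finite_interpolation:
  assumes "finite (Z :: real set)"
  obtains p where "poly p y = 1" "\<And>z. z \<in> Z \<Longrightarrow> z \<noteq> y \<Longrightarrow> poly p z = 0"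
proof
  show "poly (\<Prod>z\<in>Z - {y}. Polynomial.smult (1 / (y - z)) [:- z, 1:]) y = 1"
    by (auto simp: poly_prod diff_divide_distrib[symmetric] intro!: prod.neutral)
  show "poly (\<Prod>z\<in>Z - {y}. Polynomial.smult (1 / (y - z)) [:- z, 1:]) z = 0" if "z \<in> Z" "z \<noteq> y" for z
    using assms that by (auto simp: poly_prod)
qed

text \<open>The sum of a polynomial over the diagonal entries depends on \<open>B\<close> alone,
  through traces of powers. A polynomial that is 1 at \<open>y\<close> and 0 at the finitely many
  other values turns this sum into the multiplicity of \<open>y\<close>.\<close>

lemma diagonalizes_unique:
  fixes S :: "('n::finite) set"
  assumes "diagonalizes S B U \<mu>" "diagonalizes S B V \<nu>"
  shows "image_mset \<mu> (mset_set S) = image_mset \<nu> (mset_set S)"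
proof (rule multiset_eqI)
  fix y
  obtain p where p: "poly p y = 1" "\<And>z. z \<in> \<mu> ` S \<union> \<nu> ` S \<Longrightarrow> z \<noteq> y \<Longrightarrow> poly p z = 0"
    using finite_interpolation[of "\<mu> ` S \<union> \<nu> ` S" y] by auto
  have c: "real (count (image_mset \<kappa> (mset_set S)) y) = (\<Sum>i\<in>S. poly p (\<kappa> i))" if "\<kappa> ` S \<subseteq> \<mu> ` S \<union> \<nu> ` S" for \<kappa>
  proof -
    have "(\<Sum>i\<in>S. poly p (\<kappa> i)) = (\<Sum>i\<in>S. if \<kappa> i = y then 1 else 0)"
      using p that by (intro sum.cong) auto
    also have "\<dots> = real (card {i \<in> S. \<kappa> i = y})" by (simp add: sum.If_cases Int_def)
    finally show ?thesis by (simp add: count_image_mset' eq_commute)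
  qed
  have "real (count (image_mset \<mu> (mset_set S)) y) = real (count (image_mset \<nu> (mset_set S)) y)"
    by (subst (1 2) c) (auto simp: sum_poly_diagonalizes[OF assms(1)] sum_poly_diagonalizes[OF assms(2)])
  then show "count (image_mset \<mu> (mset_set S)) y = count (image_mset \<nu> (mset_set S)) y" by simp
qed

lemma spectrum_on_eq:
  assumes "diagonalizes S B U \<mu>"
  shows "spectrum_on S B = image_mset \<mu> (mset_set S)"
  unfolding spectrum_on_def 
  by (rule the_equality, use assms in blast, elim exE conjE, simp only:, rule diagonalizes_unique[OF _ assms])

lemma diagonalizes_exists:
  assumes "supported S B" "hermitian B"
  obtains U \<mu> where "diagonalizes S B U \<mu>"
  using spectral_theorem_on[OF assms] unfolding diagonalizes_def by metis

lemma size_spectrum_on: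
  assumes "supported S B" "hermitian B"
  shows "size (spectrum_on S B) = card S"
  using diagonalizes_exists[OF assms] spectrum_on_eq by (metis size_image_mset size_mset_set)

lemma map_matrix_const_poly_mult:
  "map_matrix (\<lambda>a. [:a:]) (A ** B) = map_matrix (\<lambda>a. [:a:]) A ** map_matrix (\<lambda>a. [:a:]) (B :: complex^'n^'n)"
proof -
  have "[:\<Sum>k\<in>K. f k:] = (\<Sum>k\<in>K. [:f k:])" for K and f :: "'n \<Rightarrow> complex"
  proof (induction K rule: infinite_finite_induct)
    case (insert x F)
    have "[:f x + sum f F:] = [:f x:] + [:sum f F:]" by simp
    then show ?case using insert by (simp del: add_pCons)
  qed auto
  then show ?thesis by (simp add: vec_eq_iff map_matrix_def matrix_matrix_mult_def mult.commute)
qed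

lemma mat_eq_one_on: "mat 1 = one_on UNIV"
  by (simp add: vec_eq_iff mat_def diag_on_nth)

lemma matrix_diff_ldistrib: "A ** (B - C) = A ** B - A ** (C :: 'a::ring_1^'n^'m)"
  by (simp add: vec_eq_iff matrix_matrix_mult_def algebra_simps sum_subtractf)

lemma matrix_diff_rdistrib: "(B - C) ** A = B ** A - (C :: 'a::ring_1^'n^'m) ** A"
  by (simp add: vec_eq_iff matrix_matrix_mult_def algebra_simps sum_subtractf)

text \<open>The scalar matrix \<open>X\<close> commutes with everything, so \<open>X - B\<close> is
  \<open>X - D\<close> conjugated by the constant matrix \<open>U\<close>. Over the polynomial ring
  the determinants of \<open>U\<close> and of its adjoint still multiply to 1.\<close>

lemma charpoly_diagonalizes:
  assumes "diagonalizes UNIV B U \<mu>"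
  shows "charpoly B = (\<Prod>i\<in>UNIV. [:- complex_of_real (\<mu> i), 1:])"
proof -
  let ?C = "map_matrix (\<lambda>a::complex. [:a:])"
  let ?X = "mat [:0, 1:] :: complex poly^'n^'n"
  let ?D = "diag_on UNIV (\<lambda>i. complex_of_real (\<mu> i))"
  have C1: "?C (mat 1) = mat 1" by (simp add: vec_eq_iff map_matrix_def mat_def)
  have UU: "U ** adjoint_matrix U = mat 1" "B = U ** ?D ** adjoint_matrix U"
    using assms by (auto simp: diagonalizes_def unitary_on_def mat_eq_one_on)
  have comm: "M ** ?X = ?X ** M" for M
  proof -
    have "(M ** ?X) $ i $ j = M $ i $ j * [:0, 1:]" for i j
    proof -
      have "(M ** ?X) $ i $ j = (\<Sum>k\<in>UNIV. if k = j then M $ i $ j * [:0, 1:] else 0)"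
        unfolding matrix_matrix_mult_def vec_lambda_beta mat_def by (intro sum.cong) auto
      then show ?thesis by simp
    qed
    moreover have "(?X ** M) $ i $ j = [:0, 1:] * M $ i $ j" for i j
    proof -
      have "(?X ** M) $ i $ j = (\<Sum>k\<in>UNIV. if k = i then [:0, 1:] * M $ i $ j else 0)"
        unfolding matrix_matrix_mult_def vec_lambda_beta mat_def by (intro sum.cong) auto
      then show ?thesis by simp
    qed
    ultimately show ?thesis by (simp add: vec_eq_iff mult.commute)
  qed
  have "?C U ** (?X - ?C ?D) ** ?C (adjoint_matrix U) = ?X ** (?C U ** ?C (adjoint_matrix U)) - ?C U ** ?C ?D ** ?C (adjoint_matrix U)"
    by (simp add: matrix_diff_ldistrib matrix_diff_rdistrib matrix_mul_assoc comm)
  also have "\<dots> = ?X - ?C B"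
    by (simp add: map_matrix_const_poly_mult[symmetric] UU C1 del: map_matrix_const_poly_mult)
  finally have "charpoly B = det (?C U) * det (?X - ?C ?D) * det (?C (adjoint_matrix U))"
    unfolding charpoly_def by (simp flip: det_mul)
  also have "\<dots> = det (?X - ?C ?D) * (det (?C U ** ?C (adjoint_matrix U)))"
    by (simp add: det_mul mult_ac)
  also have "det (?C U ** ?C (adjoint_matrix U)) = 1"
    unfolding map_matrix_const_poly_mult[symmetric] UU C1 by simp
  also have "det (?X - ?C ?D) = (\<Prod>i\<in>UNIV. (?X - ?C ?D) $ i $ i)"
    by (rule det_diagonal) (simp add: mat_def map_matrix_def diag_on_nth)
  also have "\<dots> = (\<Prod>i\<in>UNIV. [:- complex_of_real (\<mu> i), 1:])"
    by (intro prod.cong) (simp_all add: mat_def map_matrix_def diag_on_nth)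
  finally show ?thesis by simp
qed

text \<open>Links the list in the theorem, defined by the characteristic polynomial, to the multiset
  on which the proof works. A product of linear factors determines its roots with multiplicity, and
  a sorted list is determined by its multiset.\<close>

lemma eigenvalues_eq:
  fixes B :: "complex^'n^'n"
  assumes "hermitian B"
  shows "eigenvalues B = sorted_list_of_multiset (spectrum_on UNIV B)"
proof -
  obtain U \<mu> where d: "diagonalizes UNIV B U \<mu>"
    using diagonalizes_exists[OF _ assms, of UNIV] by (auto simp: supported_def)
  let ?L = "sorted_list_of_multiset (spectrum_on UNIV B)"
  have poly_list: "(\<Prod>l\<leftarrow>ls. [:- complex_of_real l, 1:]) = (\<Prod>l\<in>#mset ls. [:- complex_of_real l, 1:])" for ls
    by (simp flip: prod_mset_prod_list)
  have L: "charpoly B = (\<Prod>l\<leftarrow>?L. [:- complex_of_real l, 1:])"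
    unfolding poly_list mset_sorted_list_of_multiset spectrum_on_eq[OF d] charpoly_diagonalizes[OF d]
    by (simp add: prod_unfold_prod_mset image_mset.compositionality o_def)
  have roots: "proots (\<Prod>l\<leftarrow>ls. [:- complex_of_real l, 1:]) = image_mset complex_of_real (mset ls)" for ls
  proof (induction ls)
    case (Cons a ls)
    have "(\<Prod>l\<leftarrow>ls. [:- complex_of_real l, 1:]) \<noteq> 0" by (auto simp: prod_list_zero_iff)
    then have "proots ([:- complex_of_real a, 1:] * (\<Prod>l\<leftarrow>ls. [:- complex_of_real l, 1:])) =
        {#complex_of_real a#} + image_mset complex_of_real (mset ls)"
      by (subst proots_mult) (simp_all add: Cons)
    then show ?case by simp
  qed simp
  show ?thesis unfolding eigenvalues_def
  proof (rule the_equality)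
    show "sorted ?L \<and> charpoly B = (\<Prod>l\<leftarrow>?L. [:- complex_of_real l, 1:])"
      using L by simp
    fix ls assume ls: "sorted ls \<and> charpoly B = (\<Prod>l\<leftarrow>ls. [:- complex_of_real l, 1:])"
    then have "image_mset complex_of_real (mset ls) = image_mset complex_of_real (mset ?L)"
      using L roots by metis
    then have "mset ls = mset ?L"
      using multiset.inj_map[OF inj_of_real] by (rule injD[rotated])
    then show "ls = ?L" using ls by (metis mset_sorted_list_of_multiset sorted_list_of_multiset_mset sort_key_id_if_sorted sorted_sort_id)
  qed
qed

section \<open>Excursion sets\<close>

lemma outer_conj:
  "A ** outer h ** adjoint_matrix A = outer (A *v h)"
proof -
  have "(A ** outer h ** adjoint_matrix A) $ i $ j = outer (A *v h) $ i $ j" for i j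
  proof -
    have "(A ** outer h ** adjoint_matrix A) $ i $ j = (\<Sum>k\<in>UNIV. (\<Sum>l\<in>UNIV. A $ i $ l * (h $ l * cnj (h $ k))) * cnj (A $ j $ k))"
      by (simp add: matrix_matrix_mult_def)
    also have "\<dots> = (\<Sum>k\<in>UNIV. (\<Sum>l\<in>UNIV. A $ i $ l * h $ l) * (cnj (h $ k) * cnj (A $ j $ k)))"
      by (intro sum.cong) (simp_all add: sum_distrib_right mult.assoc)
    also have "\<dots> = (A *v h) $ i * (\<Sum>k\<in>UNIV. cnj (h $ k) * cnj (A $ j $ k))"
      unfolding sum_distrib_left[symmetric] by (simp add: matrix_vector_mult_def)
    also have "\<dots> = outer (A *v h) $ i $ j"
      by (simp add: matrix_vector_mult_def mult.commute)
    finally show ?thesis .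
  qed
  then show ?thesis by (simp add: vec_eq_iff)
qed

lemma sum_cmod_unitary:
  assumes "adjoint_matrix A ** A = mat 1"
  shows "(\<Sum>i\<in>UNIV. (cmod ((A *v h) $ i))\<^sup>2) = (\<Sum>i\<in>UNIV. (cmod (h $ i))\<^sup>2)"
proof -
  have t: "of_real (\<Sum>i\<in>UNIV. (cmod (h $ i))\<^sup>2) = trace (outer h)" for h :: "complex^'n"
    unfolding trace_def of_real_sum outer_nth by (intro sum.cong refl complex_norm_square)
  have "trace (outer (A *v h)) = trace (adjoint_matrix A ** (A ** outer h))"
    unfolding outer_conj[symmetric] by (rule trace_mul_sym)
  also have "\<dots> = trace (outer h)" using assms by (simp add: matrix_mul_assoc)
  finally show ?thesis unfolding t[symmetric] by (simp only: of_real_eq_iff)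
qed

lemma unitary_conj_projections_on_UNIV:
  assumes "adjoint_matrix A ** A = mat 1" "V \<in> projections_on UNIV"
  shows "A ** V ** adjoint_matrix A \<in> projections_on UNIV"
  using assms(2) sum_cmod_unitary[OF assms(1)] unfolding projections_on_def
  by (auto simp: outer_conj)

text \<open>After diagonalising \<open>B\<close>, shrinking the coordinates of eigenvalue below \<open>x\<close> retracts the
  excursion set onto the projective space of the sum of the remaining eigenspaces.\<close>

theorem euler_characteristic_excursion_set:
  fixes B :: "complex^'n^'n"
  assumes "hermitian B"
  shows "euler_characteristic (top_of_set (excursion_set B x)) =
         int (size (filter_mset (\<lambda>l. l \<ge> x) (spectrum_on UNIV B)))"
proof -
  obtain U \<mu> where d: "diagonalizes UNIV B U \<mu>"
    using diagonalizes_exists[OF _ assms, of UNIV] by (auto simp: supported_def)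
  let ?D = "diag_on UNIV (\<lambda>i. complex_of_real (\<mu> i))"
  define S where "S = {i. \<mu> i \<ge> x}"
  have U: "U ** adjoint_matrix U = mat 1" "adjoint_matrix U ** U = mat 1" "B = U ** ?D ** adjoint_matrix U"
    using d by (auto simp: diagonalizes_def unitary_on_def mat_eq_one_on)
  define E where "E = {V \<in> projections_on UNIV. (\<Sum>i\<in>UNIV. \<mu> i * Re (V $ i $ i)) \<ge> x}"
  define f where "f V = adjoint_matrix U ** V ** U" for V
  define g where "g V = U ** V ** adjoint_matrix U" for V
  have fg: "f (g V) = V" for V
  proof -
    have "f (g V) = (adjoint_matrix U ** U) ** V ** (adjoint_matrix U ** U)"
      by (simp only: f_def g_def matrix_mul_assoc)
    then show ?thesis by (simp add: U)
  qed
  have gf: "g (f V) = V" for V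
  proof -
    have "g (f V) = (U ** adjoint_matrix U) ** V ** (U ** adjoint_matrix U)"
      by (simp only: f_def g_def matrix_mul_assoc)
    then show ?thesis by (simp add: U)
  qed
  have tr: "Re (trace (g V ** B)) = (\<Sum>i\<in>UNIV. \<mu> i * Re (V $ i $ i))" for V
  proof -
    have "g V ** B = U ** (V ** (adjoint_matrix U ** U) ** ?D ** adjoint_matrix U)"
      by (simp only: g_def U(3) matrix_mul_assoc)
    then have "trace (g V ** B) = trace ((V ** ?D ** adjoint_matrix U) ** U)"
      unfolding U(2) matrix_mul_rid by (simp only: trace_mul_sym[of U])
    also have "\<dots> = trace (V ** ?D ** (adjoint_matrix U ** U))" by (simp only: matrix_mul_assoc)
    also have "\<dots> = (\<Sum>i\<in>UNIV. V $ i $ i * of_real (\<mu> i))"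
      unfolding U(2) by (simp add: trace_def mult_diag_on_nth)
    finally show ?thesis by (simp add: mult.commute)
  qed
  have gP: "g V \<in> projections_on UNIV" if "V \<in> projections_on UNIV" for V
    unfolding g_def using unitary_conj_projections_on_UNIV[OF U(2) that] .
  have fP: "f V \<in> projections_on UNIV" if "V \<in> projections_on UNIV" for V
    unfolding f_def using unitary_conj_projections_on_UNIV[of "adjoint_matrix U", OF _ that] U(1) by simp
  have gE: "g V \<in> excursion_set B x" if "V \<in> E" for V
    using that gP by (simp add: E_def excursion_set_def rank_one_projections_eq tr)
  have fE: "f V \<in> E" if "V \<in> excursion_set B x" for V
    using that fP tr[of "f V"] gf[of V] by (simp add: E_def excursion_set_def rank_one_projections_eq)
  have cont: "continuous_on Z f" "continuous_on Z g" for Z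
    unfolding f_def g_def matrix_matrix_mult_def adjoint_matrix_def by (intro continuous_intros)+
  have "homeomorphic_maps (top_of_set (excursion_set B x)) (top_of_set E) f g"
    unfolding homeomorphic_maps_def using cont fE gE fg gf by auto
  then have "top_of_set (excursion_set B x) homeomorphic_space top_of_set E"
    by (auto simp: homeomorphic_space_def)
  then have h1: "top_of_set (excursion_set B x) homotopy_equivalent_space top_of_set E"
    by (rule homeomorphic_imp_homotopy_equivalent_space)
  have "top_of_set E homotopy_equivalent_space top_of_set (E \<inter> projections_on S)"
  proof (rule projections_on_retract[of E UNIV])
    \<comment> \<open>The trace of \<open>V\<close> is 1, so the threshold \<open>x\<close> can be
      moved inside the sum. The condition becomes homogeneous and survives division by the positive
      number \<open>s\<close> below.\<close>
    have key: "(\<Sum>i\<in>UNIV. (\<mu> i - x) * Re (V $ i $ i)) \<ge> 0" if "V \<in> E" for V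
    proof -
      have "(\<Sum>i\<in>UNIV. (\<mu> i - x) * Re (V $ i $ i)) = (\<Sum>i\<in>UNIV. \<mu> i * Re (V $ i $ i)) - x * (\<Sum>i\<in>UNIV. Re (V $ i $ i))"
        by (simp add: algebra_simps sum_subtractf sum_distrib_left)
      then show ?thesis using that projections_on_trace(1)[of V UNIV] by (simp add: E_def)
    qed
    \<comment> \<open>Without mass on \<open>S\<close>, all of the unit mass would sit on
      coefficients \<open>\<mu> i - x < 0\<close>, against \<open>key\<close>.\<close>
    show pos: "(\<Sum>k\<in>S. Re (V $ k $ k)) > 0" if V: "V \<in> E" for V
    proof (rule ccontr)
      assume neg: "\<not> (\<Sum>k\<in>S. Re (V $ k $ k)) > 0"
      have P: "V \<in> projections_on UNIV" using V by (simp add: E_def)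
      note nn = projections_on_trace(2)[OF P]
      have "(\<Sum>k\<in>S. Re (V $ k $ k)) = 0"
        using neg sum_nonneg[of S "\<lambda>k. Re (V $ k $ k)"] nn by fastforce
      then have z: "Re (V $ k $ k) = 0" if "k \<in> S" for k
        using nn that by (subst (asm) sum_nonneg_eq_0_iff) auto
      have le: "(\<mu> i - x) * Re (V $ i $ i) \<le> 0" for i
        using z[of i] nn[of i] by (cases "i \<in> S") (auto simp: S_def mult_le_0_iff)
      have zero: "(\<mu> i - x) * Re (V $ i $ i) = 0" for i
      proof (rule ccontr)
        assume "\<not> ?thesis"
        then have "(\<mu> i - x) * Re (V $ i $ i) < 0" using le[of i] by linarith
        then have "(\<Sum>i\<in>UNIV. (\<mu> i - x) * Re (V $ i $ i)) < (\<Sum>i\<in>(UNIV::'n set). 0)"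
          using le by (intro sum_strict_mono_ex1) auto
        then show False using key[OF V] by simp
      qed
      have "Re (V $ i $ i) = 0" for i using z[of i] zero[of i] by (cases "i \<in> S") (auto simp: S_def)
      then show False using projections_on_trace(1)[OF P] by simp
    qed
    fix V :: "complex^'n^'n" and t :: real assume V: "V \<in> E" and t: "0 \<le> t" "t \<le> 1"
    let ?d = "\<lambda>k. if k \<in> S then 1 else t"
    have P: "V \<in> projections_on UNIV" using V by (simp add: E_def)
    note nn = projections_on_trace(2)[OF P]
    define s where "s = (\<Sum>k\<in>UNIV. (?d k)\<^sup>2 * Re (V $ k $ k))"
    have s: "s > 0"
      using diag_ge_sum[OF P, of S ?d] pos[OF V] by (simp add: s_def)
    have RP: "rescale ?d V \<in> projections_on UNIV"
      by (rule rescale_in_projections_on[OF P]) (use s in \<open>auto simp: s_def\<close>)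
    have r: "Re (rescale ?d V $ i $ i) = (?d i)\<^sup>2 * Re (V $ i $ i) / s" for i
    proof -
      have "rescale ?d V $ i $ i = of_real ((?d i)\<^sup>2) * V $ i $ i / of_real s"
        unfolding rescale_def s_def vec_lambda_beta by (simp add: power2_eq_square)
      then show ?thesis by (simp del: of_real_power)
    qed
    \<comment> \<open>Only terms with \<open>\<mu> i < x\<close> are shrunk. These are nonpositive,
      so the sum can only grow.\<close>
    have "(\<Sum>i\<in>UNIV. (\<mu> i - x) * Re (V $ i $ i)) \<le> (\<Sum>i\<in>UNIV. (\<mu> i - x) * ((?d i)\<^sup>2 * Re (V $ i $ i)))"
    proof (rule sum_mono)
      fix i
      show "(\<mu> i - x) * Re (V $ i $ i) \<le> (\<mu> i - x) * ((?d i)\<^sup>2 * Re (V $ i $ i))"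
      proof (cases "i \<in> S")
        case False
        have "t\<^sup>2 * Re (V $ i $ i) \<le> 1 * Re (V $ i $ i)"
          using t nn[of i] by (intro mult_right_mono) (auto simp: power_le_one)
        then show ?thesis using False by (auto simp: S_def intro!: mult_left_mono_neg)
      qed simp
    qed
    then have "0 \<le> (\<Sum>i\<in>UNIV. (\<mu> i - x) * ((?d i)\<^sup>2 * Re (V $ i $ i)))"
      using key[OF V] by linarith
    then have "0 \<le> (\<Sum>i\<in>UNIV. (\<mu> i - x) * ((?d i)\<^sup>2 * Re (V $ i $ i))) / s"
      using s by simp
    also have "\<dots> = (\<Sum>i\<in>UNIV. (\<mu> i - x) * Re (rescale ?d V $ i $ i))"
      unfolding r by (simp add: sum_divide_distrib)
    also have "\<dots> = (\<Sum>i\<in>UNIV. \<mu> i * Re (rescale ?d V $ i $ i)) - x * (\<Sum>i\<in>UNIV. Re (rescale ?d V $ i $ i))"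
      by (simp add: algebra_simps sum_subtractf sum_distrib_left)
    finally show "rescale ?d V \<in> E"
      using projections_on_trace(1)[OF RP] RP by (simp add: E_def)
  qed (auto simp: E_def)
  moreover have "E \<inter> projections_on S = projections_on S"
  proof -
    have "V \<in> E" if V: "V \<in> projections_on S" for V
    proof -
      have P: "V \<in> projections_on UNIV" using V projections_on_mono[of S UNIV] by auto
      have "x * Re (V $ i $ i) \<le> \<mu> i * Re (V $ i $ i)" for i
        using projections_on_trace(2)[OF V, of i] projections_on_zero[OF V, of i i]
        by (cases "i \<in> S") (auto simp: S_def intro!: mult_right_mono)
      then have "(\<Sum>i\<in>UNIV. x * Re (V $ i $ i)) \<le> (\<Sum>i\<in>UNIV. \<mu> i * Re (V $ i $ i))"
        by (rule sum_mono)
      then show ?thesis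
        using P projections_on_trace(1)[OF V] by (simp add: E_def sum_distrib_left[symmetric])
    qed
    then show ?thesis by blast
  qed
  ultimately have "top_of_set (excursion_set B x) homotopy_equivalent_space top_of_set (projections_on S)"
    using homotopy_eqv_trans[OF h1, of "top_of_set (projections_on S)"] by simp
  from euler_characteristic_homotopy_equivalent_projections_on[OF this]
  show ?thesis unfolding spectrum_on_eq[OF d] by (simp add: S_def filter_mset_image_mset)
qed

section \<open>Lebesgue measure under linear maps\<close>

abbreviation lborel_on :: "'k set \<Rightarrow> ('k \<Rightarrow> real) measure" where
  "lborel_on I \<equiv> PiM I (\<lambda>_. lborel)"

interpretation lborel_on: product_sigma_finite "\<lambda>_ :: 'k. lborel :: real measure"
  by standard

lemma sigma_finite_lborel_on: "finite I \<Longrightarrow> sigma_finite_measure (lborel_on I)"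
  by (rule lborel_on.sigma_finite)

lemma space_lborel_on: "space (lborel_on I) = extensional I"
  by (simp add: space_PiM PiE_UNIV_domain) (auto simp: PiE_def)

lemma nn_integral_lborel_on_affine:
  assumes fin: "finite I" and c: "\<And>i. i \<in> I \<Longrightarrow> c i \<noteq> 0"
    and f: "f \<in> borel_measurable (lborel_on I)"
  shows "ennreal (\<Prod>i\<in>I. \<bar>c i\<bar>) * (\<integral>\<^sup>+ x. f (\<lambda>i\<in>I. a i + c i * x i) \<partial>lborel_on I) = (\<integral>\<^sup>+ x. f x \<partial>lborel_on I)"
proof -
  let ?T = "\<lambda>x. \<lambda>i\<in>I. a i + c i * x i"
  have T: "?T \<in> measurable (lborel_on I) (lborel_on I)" by measurable
  let ?k = "ennreal (\<Prod>i\<in>I. \<bar>c i\<bar>)"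
  have "density (distr (lborel_on I) (lborel_on I) ?T) (\<lambda>_. ?k) = lborel_on I"
  proof (rule lborel_on.PiM_eqI[OF fin])
    fix A :: "'a \<Rightarrow> real set" assume "\<And>i. i \<in> I \<Longrightarrow> A i \<in> sets lborel"
    then have A: "A i \<in> sets borel" if "i \<in> I" for i using that by auto
    then have A': "Pi\<^sub>E I A \<in> sets (lborel_on I)" using fin by (intro sets_PiM_I_finite) auto
    have pre: "?T -` Pi\<^sub>E I A \<inter> space (lborel_on I) = Pi\<^sub>E I (\<lambda>i. (\<lambda>y. a i + c i * y) -` A i)"
      by (auto simp: space_lborel_on PiE_def Pi_def)
    have one: "ennreal \<bar>c i\<bar> * emeasure lborel ((\<lambda>y. a i + c i * y) -` A i) = emeasure lborel (A i)" if "i \<in> I" for i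
      using A[OF that]
      by (subst (2) lborel_real_affine[OF c[OF that], of "a i"]) (simp add: emeasure_density nn_integral_cmult_indicator nn_integral_distr emeasure_distr)
    have "emeasure (density (distr (lborel_on I) (lborel_on I) ?T) (\<lambda>_. ?k)) (Pi\<^sub>E I A) =
        ?k * emeasure (lborel_on I) (?T -` Pi\<^sub>E I A \<inter> space (lborel_on I))"
      using A' T by (simp add: emeasure_density nn_integral_cmult_indicator emeasure_distr)
    also have "\<dots> = ?k * (\<Prod>i\<in>I. emeasure lborel ((\<lambda>y. a i + c i * y) -` A i))"
      unfolding pre using A by (subst lborel_on.emeasure_PiM[OF fin]) (auto intro!: measurable_sets_borel[where M=borel])
    also have "\<dots> = (\<Prod>i\<in>I. emeasure lborel (A i))"
      using one by (simp add: prod_ennreal[symmetric] prod.distrib[symmetric])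
    finally show "emeasure (density (distr (lborel_on I) (lborel_on I) ?T) (\<lambda>_. ?k)) (Pi\<^sub>E I A) = (\<Prod>i\<in>I. emeasure lborel (A i))" .
  qed simp
  then have "(\<integral>\<^sup>+ x. f x \<partial>lborel_on I) = (\<integral>\<^sup>+ x. f x \<partial>density (distr (lborel_on I) (lborel_on I) ?T) (\<lambda>_. ?k))" by simp
  also have "\<dots> = (\<integral>\<^sup>+ x. ?k * f x \<partial>distr (lborel_on I) (lborel_on I) ?T)"
    using f by (intro nn_integral_density) auto
  also have "\<dots> = (\<integral>\<^sup>+ x. ?k * f (?T x) \<partial>lborel_on I)"
    using f by (intro nn_integral_distr[OF T]) auto
  also have "\<dots> = ?k * (\<integral>\<^sup>+ x. f (?T x) \<partial>lborel_on I)"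
    using f T by (intro nn_integral_cmult) (rule measurable_compose[OF T f])
  finally show ?thesis ..
qed

lemma nn_integral_lborel_on_translate:
  assumes fin: "finite I" and f: "f \<in> borel_measurable (lborel_on I)"
  shows "(\<integral>\<^sup>+ x. f (\<lambda>i\<in>I. x i + a i) \<partial>lborel_on I) = (\<integral>\<^sup>+ x. f x \<partial>lborel_on I)"
  using nn_integral_lborel_on_affine[OF fin _ f, of "\<lambda>_. 1" a] by (simp add: add.commute)

lemma nn_integral_lborel_on_reindex:
  assumes fin: "finite I" and \<sigma>: "bij_betw \<sigma> I I" and f: "f \<in> borel_measurable (lborel_on I)"
  shows "(\<integral>\<^sup>+ x. f (\<lambda>i\<in>I. x (\<sigma> i)) \<partial>lborel_on I) = (\<integral>\<^sup>+ x. f x \<partial>lborel_on I)"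
proof -
  let ?T = "\<lambda>x. \<lambda>i\<in>I. x (\<sigma> i)"
  have \<sigma>I: "\<sigma> i \<in> I" if "i \<in> I" for i using \<sigma> that by (auto simp: bij_betw_def)
  have T: "?T \<in> measurable (lborel_on I) (lborel_on I)"
    using \<sigma>I by (intro measurable_restrict measurable_component_singleton) auto
  have "distr (lborel_on I) (lborel_on I) ?T = lborel_on I"
  proof (rule lborel_on.PiM_eqI[OF fin])
    fix A :: "'a \<Rightarrow> real set" assume "\<And>i. i \<in> I \<Longrightarrow> A i \<in> sets lborel"
    then have A: "A i \<in> sets borel" if "i \<in> I" for i using that by auto
    then have A': "Pi\<^sub>E I A \<in> sets (lborel_on I)" using fin by (intro sets_PiM_I_finite) auto
    define \<tau> where "\<tau> = inv_into I \<sigma>"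
    have \<tau>: "bij_betw \<tau> I I" unfolding \<tau>_def by (rule bij_betw_inv_into[OF \<sigma>])
    have \<tau>\<sigma>: "\<tau> (\<sigma> i) = i" "\<sigma> (\<tau> i) = i" if "i \<in> I" for i
      using \<sigma> that by (auto simp: \<tau>_def bij_betw_inv_into_left bij_betw_inv_into_right)
    have \<tau>I: "\<tau> i \<in> I" if "i \<in> I" for i using \<tau> that by (auto simp: bij_betw_def)
    have pre: "?T -` Pi\<^sub>E I A \<inter> space (lborel_on I) = Pi\<^sub>E I (\<lambda>i. A (\<tau> i))"
    proof (intro equalityI subsetI)
      fix x assume "x \<in> ?T -` Pi\<^sub>E I A \<inter> space (lborel_on I)"
      then have x: "\<And>i. i \<in> I \<Longrightarrow> x (\<sigma> i) \<in> A i" "x \<in> extensional I"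
        by (auto simp: space_lborel_on PiE_def Pi_def)
      then have "x i \<in> A (\<tau> i)" if "i \<in> I" for i using x(1)[OF \<tau>I[OF that]] \<tau>\<sigma>[OF that] by simp
      then show "x \<in> Pi\<^sub>E I (\<lambda>i. A (\<tau> i))" using x(2) by (auto simp: PiE_def)
    next
      fix x assume x: "x \<in> Pi\<^sub>E I (\<lambda>i. A (\<tau> i))"
      then have "x (\<sigma> i) \<in> A i" if "i \<in> I" for i
        using \<sigma>I[OF that] \<tau>\<sigma>[OF that] by (metis PiE_mem)
      then show "x \<in> ?T -` Pi\<^sub>E I A \<inter> space (lborel_on I)"
        using x by (auto simp: space_lborel_on PiE_def)
    qed
    have "emeasure (distr (lborel_on I) (lborel_on I) ?T) (Pi\<^sub>E I A) = emeasure (lborel_on I) (Pi\<^sub>E I (\<lambda>i. A (\<tau> i)))"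
      using A' T by (simp add: emeasure_distr pre)
    also have "\<dots> = (\<Prod>i\<in>I. emeasure lborel (A (\<tau> i)))"
      using A \<tau>I by (intro lborel_on.emeasure_PiM[OF fin]) auto
    also have "\<dots> = (\<Prod>i\<in>I. emeasure lborel (A i))"
      by (rule prod.reindex_bij_betw[OF \<tau>])
    finally show "emeasure (distr (lborel_on I) (lborel_on I) ?T) (Pi\<^sub>E I A) = (\<Prod>i\<in>I. emeasure lborel (A i))" .
  qed simp
  then have "(\<integral>\<^sup>+ x. f x \<partial>lborel_on I) = (\<integral>\<^sup>+ x. f x \<partial>distr (lborel_on I) (lborel_on I) ?T)" by simp
  also have "\<dots> = (\<integral>\<^sup>+ x. f (?T x) \<partial>lborel_on I)"
    using f by (intro nn_integral_distr[OF T]) auto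
  finally show ?thesis ..
qed

text \<open>Lebesgue measure is determined up to a factor by its invariance under translations, and the
  image of an invariant measure under a linear bijection is again invariant.\<close>

lemma nn_integral_lborel_on_linear:
  assumes fin: "finite I" and T: "T \<in> measurable (lborel_on I) (lborel_on I)"
    and T': "\<And>x. x \<in> extensional I \<Longrightarrow> T' x \<in> extensional I"
    and TT': "\<And>x. x \<in> extensional I \<Longrightarrow> T (T' x) = x"
    and add: "\<And>x y. x \<in> extensional I \<Longrightarrow> y \<in> extensional I \<Longrightarrow> T (\<lambda>i\<in>I. x i + y i) = (\<lambda>i\<in>I. T x i + T y i)"
  obtains c where "\<And>g. g \<in> borel_measurable (lborel_on I) \<Longrightarrow>
    (\<integral>\<^sup>+ x. g (T x) \<partial>lborel_on I) = c * (\<integral>\<^sup>+ x. g x \<partial>lborel_on I)"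
proof -
  let ?L = "lborel_on I"
  interpret pair_sigma_finite ?L ?L
    using sigma_finite_lborel_on[OF fin] by (simp add: pair_sigma_finite_def)
  define f :: "('a \<Rightarrow> real) \<Rightarrow> ennreal" where "f = indicator (Pi\<^sub>E I (\<lambda>_. {0..1}))"
  have f[measurable]: "f \<in> borel_measurable ?L"
    unfolding f_def using fin by (intro borel_measurable_indicator sets_PiM_I_finite) auto
  have "(\<integral>\<^sup>+ x. f x \<partial>?L) = emeasure ?L (Pi\<^sub>E I (\<lambda>_. {0..1}))"
    unfolding f_def using fin by (intro nn_integral_indicator sets_PiM_I_finite) auto
  also have "\<dots> = 1" by (subst lborel_on.emeasure_PiM[OF fin]) auto
  finally have f1: "(\<integral>\<^sup>+ x. f x \<partial>?L) = 1" .
  \<comment> \<open>As in the uniqueness proof for Haar measure, the double integral of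
    \<open>f x * g (x + T y)\<close> is evaluated in two ways. For fixed \<open>x\<close>,
    translating \<open>y\<close> by \<open>T' x\<close> turns the inner integral into that of
    \<open>g (T y)\<close>, and \<open>f\<close> integrates to 1. Translating \<open>x\<close> by
    \<open>T y\<close> first leaves the integral of \<open>f (x - T y)\<close> over
    \<open>y\<close>, which by the same translation is \<open>c\<close> for every
    \<open>x\<close>.\<close>
  define c where "c = (\<integral>\<^sup>+ y. f (\<lambda>i\<in>I. - T y i) \<partial>?L)"
  note T[measurable]
  have Tx[measurable]: "(\<lambda>x. T x i) \<in> borel_measurable ?L" if "i \<in> I" for i
    using measurable_compose[OF T measurable_component_singleton[OF that]] by simp
  have ext: "T x \<in> extensional I" if "x \<in> extensional I" for x
    using measurable_space[OF T] that by (simp add: space_lborel_on)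
  have "(\<integral>\<^sup>+ x. g (T x) \<partial>?L) = c * (\<integral>\<^sup>+ x. g x \<partial>?L)" if g[measurable]: "g \<in> borel_measurable ?L" for g
  proof -
    have TT: "T (\<lambda>i\<in>I. y i + T' x i) = (\<lambda>i\<in>I. x i + T y i)" if "x \<in> extensional I" "y \<in> extensional I" for x y
      using add[OF that(2) T'[OF that(1)]] TT'[OF that(1)] by (auto simp: add.commute)
    have m1: "(\<lambda>p. (\<lambda>i\<in>I. fst p i + T (snd p) i)) \<in> measurable (?L \<Otimes>\<^sub>M ?L) ?L"
      "(\<lambda>p. (\<lambda>i\<in>I. fst p i - T (snd p) i)) \<in> measurable (?L \<Otimes>\<^sub>M ?L) ?L"
      by (intro measurable_restrict; measurable)+
    have "(\<integral>\<^sup>+ y. g (T y) \<partial>?L) = (\<integral>\<^sup>+ x. f x \<partial>?L) * (\<integral>\<^sup>+ y. g (T y) \<partial>?L)" using f1 by simp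
    also have "\<dots> = (\<integral>\<^sup>+ x. f x * (\<integral>\<^sup>+ y. g (T y) \<partial>?L) \<partial>?L)" by (simp add: nn_integral_multc)
    also have "\<dots> = (\<integral>\<^sup>+ x. \<integral>\<^sup>+ y. f x * g (\<lambda>i\<in>I. x i + T y i) \<partial>?L \<partial>?L)"
    proof (rule nn_integral_cong)
      fix x assume "x \<in> space ?L"
      then have x: "x \<in> extensional I" by (simp add: space_lborel_on)
      have mm: "(\<lambda>y. g (\<lambda>i\<in>I. x i + T y i)) \<in> borel_measurable ?L"
        by (rule measurable_compose[OF _ g]) (intro measurable_restrict; measurable)
      have "(\<integral>\<^sup>+ y. g (T y) \<partial>?L) = (\<integral>\<^sup>+ y. g (T (\<lambda>i\<in>I. y i + T' x i)) \<partial>?L)"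
        by (rule nn_integral_lborel_on_translate[OF fin, symmetric]) measurable
      also have "\<dots> = (\<integral>\<^sup>+ y. g (\<lambda>i\<in>I. x i + T y i) \<partial>?L)"
        by (rule nn_integral_cong) (simp add: TT x space_lborel_on)
      finally show "f x * (\<integral>\<^sup>+ y. g (T y) \<partial>?L) = (\<integral>\<^sup>+ y. f x * g (\<lambda>i\<in>I. x i + T y i) \<partial>?L)"
        by (simp add: nn_integral_cmult mm)
    qed
    also have "\<dots> = (\<integral>\<^sup>+ y. \<integral>\<^sup>+ x. f x * g (\<lambda>i\<in>I. x i + T y i) \<partial>?L \<partial>?L)"
      by (rule Fubini'[symmetric]) (use measurable_compose[OF m1(1) g] in \<open>simp add: case_prod_beta\<close>)
    also have "\<dots> = (\<integral>\<^sup>+ y. \<integral>\<^sup>+ x. f (\<lambda>i\<in>I. x i - T y i) * g x \<partial>?L \<partial>?L)"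
    proof (rule nn_integral_cong)
      fix y assume "y \<in> space ?L"
      have "(\<integral>\<^sup>+ x. f (\<lambda>i\<in>I. x i - T y i) * g x \<partial>?L) =
        (\<integral>\<^sup>+ x. f (\<lambda>i\<in>I. (\<lambda>i\<in>I. x i + T y i) i - T y i) * g (\<lambda>i\<in>I. x i + T y i) \<partial>?L)"
        by (rule nn_integral_lborel_on_translate[OF fin, symmetric]) measurable
      also have "\<dots> = (\<integral>\<^sup>+ x. f x * g (\<lambda>i\<in>I. x i + T y i) \<partial>?L)"
        by (intro nn_integral_cong arg_cong2[where f="(*)"] arg_cong[where f=f])
           (auto simp: space_lborel_on extensional_def)
      finally show "(\<integral>\<^sup>+ x. f x * g (\<lambda>i\<in>I. x i + T y i) \<partial>?L) = (\<integral>\<^sup>+ x. f (\<lambda>i\<in>I. x i - T y i) * g x \<partial>?L)" ..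
    qed
    also have "\<dots> = (\<integral>\<^sup>+ x. \<integral>\<^sup>+ y. f (\<lambda>i\<in>I. x i - T y i) * g x \<partial>?L \<partial>?L)"
      by (rule Fubini') (use measurable_compose[OF m1(2) f] in \<open>simp add: case_prod_beta\<close>)
    also have "\<dots> = (\<integral>\<^sup>+ x. c * g x \<partial>?L)"
    proof (rule nn_integral_cong)
      fix x assume "x \<in> space ?L"
      then have x: "x \<in> extensional I" by (simp add: space_lborel_on)
      have mm: "(\<lambda>y. f (\<lambda>i\<in>I. x i - T y i)) \<in> borel_measurable ?L"
        by (rule measurable_compose[OF _ f]) (intro measurable_restrict; measurable)
      have "(\<integral>\<^sup>+ y. f (\<lambda>i\<in>I. x i - T y i) \<partial>?L) = (\<integral>\<^sup>+ y. f (\<lambda>i\<in>I. x i - T (\<lambda>i\<in>I. y i + T' x i) i) \<partial>?L)"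
        by (rule nn_integral_lborel_on_translate[OF fin mm, symmetric])
      also have "\<dots> = c"
        unfolding c_def
        by (intro nn_integral_cong arg_cong[where f=f]) (auto simp: TT x space_lborel_on)
      finally show "(\<integral>\<^sup>+ y. f (\<lambda>i\<in>I. x i - T y i) * g x \<partial>?L) = c * g x"
        by (simp add: nn_integral_multc mm)
    qed
    also have "\<dots> = c * (\<integral>\<^sup>+ x. g x \<partial>?L)" by (simp add: nn_integral_cmult)
    finally show ?thesis .
  qed
  then show thesis by (rule that)
qed

section \<open>Integrals over Hermitian matrices\<close>

text \<open>Hermitian matrices with entries in a symmetric set \<open>J\<close> of positions, in the coordinates of
  \<^const>\<open>hermitian_of\<close>.\<close>

definition herm :: "('n \<times> 'n) set \<Rightarrow> ('n \<times> 'n \<Rightarrow> real) \<Rightarrow> complex^'n^'n" where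
  "herm J X = (\<chi> i j. if (i, j) \<in> J
     then Complex ((X (i, j) + X (j, i)) / 2) ((X (i, j) - X (j, i)) / 2) else 0)"

text \<open>Inverse to \<open>herm J\<close>: the real part is the symmetric part of the coordinates
  and the imaginary part the antisymmetric one, so their sum recovers the coordinate.\<close>

definition coords :: "('n \<times> 'n) set \<Rightarrow> complex^'n^'n \<Rightarrow> 'n \<times> 'n \<Rightarrow> real" where
  "coords J H = (\<lambda>p\<in>J. Re (H $ fst p $ snd p) + Im (H $ fst p $ snd p))"

definition zero_outside :: "('n \<times> 'n) set \<Rightarrow> complex^'n^'n \<Rightarrow> bool" where
  "zero_outside J H \<longleftrightarrow> (\<forall>i j. (i, j) \<notin> J \<longrightarrow> H $ i $ j = 0)"

definition herm_integral :: "('n \<times> 'n) set \<Rightarrow> (complex^'n^'n \<Rightarrow> ennreal) \<Rightarrow> ennreal" where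
  "herm_integral J F = (\<integral>\<^sup>+ X. F (herm J X) \<partial>lborel_on J)"

definition mconj :: "complex^'n^'n \<Rightarrow> complex^'n^'n \<Rightarrow> complex^'n^'n" where
  "mconj M H = M ** H ** adjoint_matrix M"

text \<open>A condition on the zero pattern of \<open>M\<close> under which \<open>mconj M\<close>
  maps matrices vanishing off \<open>J\<close> to such matrices.\<close>

definition compatible :: "('n \<times> 'n) set \<Rightarrow> complex^'n^'n \<Rightarrow> bool" where
  "compatible J M \<longleftrightarrow> (\<forall>i j k l. (k, l) \<in> J \<longrightarrow> M $ i $ k \<noteq> 0 \<longrightarrow> M $ j $ l \<noteq> 0 \<longrightarrow> (i, j) \<in> J)"

text \<open>\<open>c\<close> plays the part of the absolute determinant of the real linear map
  \<open>mconj M\<close>. Stating it through integrals makes factors multiply under composition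
  without any determinant of that map being formed.\<close>

definition conj_scale :: "('n \<times> 'n) set \<Rightarrow> complex^'n^'n \<Rightarrow> ennreal \<Rightarrow> bool" where
  "conj_scale J M c \<longleftrightarrow> (\<forall>F\<in>borel_measurable borel. herm_integral J F = c * herm_integral J (\<lambda>H. F (mconj M H)))"

lemma borel_measurable_matrixI:
  fixes f :: "'a \<Rightarrow> complex^'n^'m"
  assumes "\<And>i j. (\<lambda>x. f x $ i $ j) \<in> borel_measurable M"
  shows "f \<in> borel_measurable M"
proof (subst borel_measurable_euclidean_space, rule ballI)
  fix b :: "complex^'n^'m" assume "b \<in> Basis"
  then obtain i j u where b: "b = axis i (axis j u)" unfolding Basis_vec_def by auto
  have "(\<lambda>x. f x \<bullet> b) = (\<lambda>x. f x $ i $ j \<bullet> u)" unfolding b by (simp add: inner_axis)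
  then show "(\<lambda>x. f x \<bullet> b) \<in> borel_measurable M" using assms[of i j] by simp
qed

lemma borel_measurable_matrix_nth [measurable (raw)]:
  fixes f :: "'a \<Rightarrow> complex^'n^'m"
  assumes "f \<in> borel_measurable M"
  shows "(\<lambda>x. f x $ i $ j) \<in> borel_measurable M"
  by (rule measurable_compose[OF assms]) (intro borel_measurable_continuous_onI continuous_intros)

lemma borel_measurable_matrix_mult [measurable (raw)]:
  fixes f g :: "'a \<Rightarrow> complex^'n^'n"
  assumes [measurable]: "f \<in> borel_measurable M" "g \<in> borel_measurable M"
  shows "(\<lambda>x. f x ** g x) \<in> borel_measurable M"
  by (rule borel_measurable_matrixI) (simp add: matrix_matrix_mult_def)

lemma borel_measurable_adjoint_matrix [measurable (raw)]:
  assumes [measurable]: "f \<in> borel_measurable M"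
  shows "(\<lambda>x. adjoint_matrix (f x)) \<in> borel_measurable M"
proof (rule borel_measurable_matrixI)
  have "cnj \<in> borel_measurable borel" by (intro borel_measurable_continuous_onI continuous_intros)
  then show "(\<lambda>x. adjoint_matrix (f x) $ i $ j) \<in> borel_measurable M" for i j
    unfolding adjoint_matrix_nth by (rule measurable_compose[rotated]) measurable
qed

lemma borel_measurable_Complex [measurable (raw)]:
  assumes [measurable]: "f \<in> borel_measurable M" "g \<in> borel_measurable M"
  shows "(\<lambda>x. Complex (f x) (g x)) \<in> borel_measurable M"
  unfolding Complex_eq by measurable

lemma borel_measurable_herm:
  assumes "sym J"
  shows "herm J \<in> borel_measurable (lborel_on J)"
proof (rule borel_measurable_matrixI)
  fix i j
  show "(\<lambda>X. herm J X $ i $ j) \<in> borel_measurable (lborel_on J)"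
  proof (cases "(i, j) \<in> J")
    case True
    then have [simp]: "(j, i) \<in> J" using assms by (auto dest: symD)
    have [measurable]: "(\<lambda>X. X (i, j)) \<in> borel_measurable (lborel_on J)" "(\<lambda>X. X (j, i)) \<in> borel_measurable (lborel_on J)"
      using True measurable_component_singleton[of _ J "\<lambda>_. lborel"] by auto
    show ?thesis using True by (simp add: herm_def)
  qed (simp add: herm_def)
qed

lemma hermitian_herm: "sym J \<Longrightarrow> hermitian (herm J X)"
  unfolding hermitian_def herm_def by (auto simp: complex_eq_iff field_simps dest: symD)

lemma zero_outside_herm: "zero_outside J (herm J X)"
  by (simp add: zero_outside_def herm_def)

lemma herm_coords:
  assumes "sym J" "hermitian H" "zero_outside J H"
  shows "herm J (coords J H) = H"
proof -
  have "herm J (coords J H) $ i $ j = H $ i $ j" for i j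
  proof (cases "(i, j) \<in> J")
    case True
    then have "(j, i) \<in> J" using assms by (auto dest: symD)
    moreover have "H $ j $ i = cnj (H $ i $ j)" using assms(2) unfolding hermitian_def by blast
    ultimately show ?thesis using True by (simp add: herm_def coords_def complex_eq_iff)
  qed (use assms in \<open>simp add: herm_def zero_outside_def\<close>)
  then show ?thesis by (simp add: vec_eq_iff)
qed

lemma coords_herm:
  fixes X :: "('n::finite) \<times> 'n \<Rightarrow> real"
  assumes "sym J" "X \<in> extensional J"
  shows "coords J (herm J X) = X"
proof
  fix p :: "'n \<times> 'n"
  obtain i j where p: "p = (i, j)" using surj_pair[of p] by blast
  show "coords J (herm J X) p = X p"
    using assms by (cases "p \<in> J") (auto simp: coords_def herm_def p extensional_def field_simps dest: symD)
qed

lemma coords_extensional: "coords J H \<in> extensional J"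
  by (simp add: coords_def)

lemma borel_measurable_coords:
  assumes [measurable]: "f \<in> borel_measurable M"
  shows "(\<lambda>x. coords J (f x)) \<in> measurable M (lborel_on J)"
  unfolding coords_def by (intro measurable_restrict) measurable

lemma coords_add: "coords J (H + K) = (\<lambda>p\<in>J. coords J H p + coords J K p)"
  by (auto simp: coords_def)

lemma herm_add:
  assumes "sym J"
  shows "herm J (\<lambda>p\<in>J. X p + Y p) = herm J X + herm J Y"
proof -
  have "herm J (\<lambda>p\<in>J. X p + Y p) $ i $ j = (herm J X + herm J Y) $ i $ j" for i j
    using assms by (auto simp: herm_def complex_eq_iff field_simps dest: symD)
  then show ?thesis by (simp add: vec_eq_iff)
qed

lemma mconj_nth: "mconj M H $ i $ j = (\<Sum>l\<in>UNIV. \<Sum>k\<in>UNIV. M $ i $ k * H $ k $ l * cnj (M $ j $ l))"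
  by (simp add: mconj_def matrix_matrix_mult_def sum_distrib_right)

lemma mconj_add: "mconj M (H + K) = mconj M H + mconj M K"
  unfolding vec_eq_iff by (simp add: mconj_nth algebra_simps sum.distrib)

lemma mconj_mult: "mconj (M ** N) H = mconj M (mconj N H)"
  by (simp only: mconj_def adjoint_matrix_mult matrix_mul_assoc)

lemma hermitian_mconj: "hermitian H \<Longrightarrow> hermitian (mconj M H)"
  by (simp add: mconj_def hermitian_iff_adjoint_matrix adjoint_matrix_mult matrix_mul_assoc)

lemma zero_outside_mconj:
  assumes "compatible J M" "zero_outside J H"
  shows "zero_outside J (mconj M H)"
  unfolding zero_outside_def mconj_nth
proof (intro allI impI sum.neutral ballI)
  fix i j k l assume "(i, j) \<notin> J"
  then show "M $ i $ k * H $ k $ l * cnj (M $ j $ l) = 0"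
    using assms by (cases "(k, l) \<in> J") (auto simp: compatible_def zero_outside_def)
qed

lemma borel_measurable_mconj [measurable (raw)]:
  assumes [measurable]: "f \<in> borel_measurable M"
  shows "(\<lambda>x. mconj A (f x)) \<in> borel_measurable M"
  unfolding mconj_def by measurable

lemma herm_integral_cong:
  assumes "sym J" "\<And>H. hermitian H \<Longrightarrow> zero_outside J H \<Longrightarrow> F H = G H"
  shows "herm_integral J F = herm_integral J G"
  unfolding herm_integral_def using assms by (auto intro!: nn_integral_cong simp: hermitian_herm zero_outside_herm)

lemma conj_scale_mult:
  fixes M N :: "complex^'n^'n"
  assumes "conj_scale J M c" "conj_scale J N d"
  shows "conj_scale J (M ** N) (c * d)"
  unfolding conj_scale_def
proof
  fix F :: "complex^'n^'n \<Rightarrow> ennreal" assume [measurable]: "F \<in> borel_measurable borel"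
  have "herm_integral J F = c * herm_integral J (\<lambda>H. F (mconj M H))"
    by (rule assms(1)[unfolded conj_scale_def, rule_format]) measurable
  also have "herm_integral J (\<lambda>H. F (mconj M H)) = d * herm_integral J (\<lambda>H. F (mconj M (mconj N H)))"
  proof -
    have "(\<lambda>H. F (mconj M H)) \<in> borel_measurable borel" by measurable
    from assms(2)[unfolded conj_scale_def, rule_format, OF this] show ?thesis .
  qed
  finally show "herm_integral J F = c * d * herm_integral J (\<lambda>H. F (mconj (M ** N) H))"
    by (simp add: mconj_mult mult.assoc)
qed

lemma conj_scale_id:
  assumes "sym J" "\<And>H. hermitian H \<Longrightarrow> zero_outside J H \<Longrightarrow> mconj M H = H"
  shows "conj_scale J M 1"
  unfolding conj_scale_def using assms by (auto intro!: herm_integral_cong)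

text \<open>Tested on the unit cube pulled back by \<open>N\<close>: after composing with
  \<open>M\<close> the integral is 1, so both factors equal the integral before composing.\<close>

lemma conj_scale_unique:
  fixes M N :: "complex^'n^'n"
  assumes J: "sym J" and comp: "compatible J M"
    and inv: "\<And>H. hermitian H \<Longrightarrow> zero_outside J H \<Longrightarrow> mconj N (mconj M H) = H"
    and c: "conj_scale J M c" and d: "conj_scale J M d"
  shows "c = d"
proof -
  define G :: "complex^'n^'n \<Rightarrow> ennreal" where "G H = indicator (Pi\<^sub>E J (\<lambda>_. {0..1})) (coords J H)" for H
  have fin: "finite J" by (rule finite_subset[of _ UNIV]) auto
  have box: "Pi\<^sub>E J (\<lambda>_. {0..1::real}) \<in> sets (lborel_on J)" using fin by (intro sets_PiM_I_finite) auto
  have G[measurable]: "G \<in> borel_measurable borel"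
    unfolding G_def using box by (intro measurable_compose[OF borel_measurable_coords] borel_measurable_indicator) auto
  have "herm_integral J G = (\<integral>\<^sup>+ X. indicator (Pi\<^sub>E J (\<lambda>_. {0..1})) X \<partial>lborel_on J)"
    unfolding herm_integral_def G_def using J by (intro nn_integral_cong) (simp add: coords_herm space_lborel_on)
  also have "\<dots> = emeasure (lborel_on J) (Pi\<^sub>E J (\<lambda>_. {0..1}))"
    using box by (intro nn_integral_indicator) auto
  also have "\<dots> = 1" by (subst lborel_on.emeasure_PiM[OF fin]) auto
  finally have G1: "herm_integral J G = 1" .
  have F: "(\<lambda>H. G (mconj N H)) \<in> borel_measurable borel" by measurable
  have "herm_integral J (\<lambda>H. G (mconj N (mconj M H))) = 1"
    using G1 inv J by (subst herm_integral_cong[OF J, of _ G]) auto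
  then have "herm_integral J (\<lambda>H. G (mconj N H)) = c" "herm_integral J (\<lambda>H. G (mconj N H)) = d"
    using c[unfolded conj_scale_def, rule_format, OF F] d[unfolded conj_scale_def, rule_format, OF F] by simp_all
  then show ?thesis by simp
qed

text \<open>The linear change of variables is made with the inverse \<open>N\<close>. Applied to
  \<open>F\<close> composed with \<open>mconj M\<close>, it returns \<open>F\<close> itself on one
  side, so the factor obtained is the one for \<open>M\<close>.\<close>

lemma conj_scale_exists:
  fixes M N :: "complex^'n^'n"
  assumes J: "sym J" and comp: "compatible J M" "compatible J N"
    and inv: "\<And>H. hermitian H \<Longrightarrow> zero_outside J H \<Longrightarrow> mconj N (mconj M H) = H"
      "\<And>H. hermitian H \<Longrightarrow> zero_outside J H \<Longrightarrow> mconj M (mconj N H) = H"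
  obtains c where "conj_scale J M c"
proof -
  define T where "T A X = coords J (mconj A (herm J X))" for A :: "complex^'n^'n" and X :: "'n \<times> 'n \<Rightarrow> real"
  have fin: "finite J" by (rule finite_subset[of _ UNIV]) auto
  have hT: "herm J (T A X) = mconj A (herm J X)" if "compatible J A" for A X
    unfolding T_def using that by (intro herm_coords J hermitian_mconj hermitian_herm zero_outside_mconj zero_outside_herm)
  have Tm: "T A \<in> measurable (lborel_on J) (lborel_on J)" for A
    unfolding T_def using borel_measurable_herm[OF J] by (intro borel_measurable_coords borel_measurable_mconj)
  obtain c where c: "\<And>g. g \<in> borel_measurable (lborel_on J) \<Longrightarrow>
    (\<integral>\<^sup>+ x. g (T N x) \<partial>lborel_on J) = c * (\<integral>\<^sup>+ x. g x \<partial>lborel_on J)"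
  proof (rule nn_integral_lborel_on_linear[OF fin Tm[of N], where T'="T M"])
    show "T M x \<in> extensional J" if "x \<in> extensional J" for x by (simp add: T_def coords_extensional)
    show "T N (T M x) = x" if "x \<in> extensional J" for x
      unfolding T_def[of N] hT[OF comp(1)]
      using inv(1)[OF hermitian_herm[OF J] zero_outside_herm] coords_herm[OF J that] by simp
    show "T N (\<lambda>i\<in>J. x i + y i) = (\<lambda>i\<in>J. T N x i + T N y i)" for x y
      unfolding T_def herm_add[OF J] mconj_add coords_add ..
  qed blast
  have "conj_scale J M c"
    unfolding conj_scale_def
  proof
    fix F :: "complex^'n^'n \<Rightarrow> ennreal" assume F[measurable]: "F \<in> borel_measurable borel"
    have m: "(\<lambda>X. F (mconj M (herm J X))) \<in> borel_measurable (lborel_on J)"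
      using borel_measurable_herm[OF J] by measurable
    have "c * herm_integral J (\<lambda>H. F (mconj M H)) = (\<integral>\<^sup>+ x. F (mconj M (herm J (T N x))) \<partial>lborel_on J)"
      unfolding herm_integral_def by (rule c[OF m, symmetric])
    also have "\<dots> = herm_integral J F"
      unfolding herm_integral_def
      by (rule nn_integral_cong) (simp add: hT[OF comp(2)] inv(2)[OF hermitian_herm[OF J] zero_outside_herm])
    finally show "herm_integral J F = c * herm_integral J (\<lambda>H. F (mconj M H))" ..
  qed
  then show thesis by (rule that)
qed

lemma mconj_diag_on:
  "mconj (diag_on T (\<lambda>i. of_real (d i))) H $ i $ j = (if i \<in> T \<and> j \<in> T then of_real (d i * d j) * H $ i $ j else 0)"
  unfolding mconj_def adjoint_matrix_diag_on by (simp add: mult_diag_on_nth diag_on_mult_nth)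

lemma conj_scale_diag_on:
  fixes d :: "'n::finite \<Rightarrow> real"
  assumes J: "sym J" "J \<subseteq> T \<times> T" and d: "\<And>i. i \<in> T \<Longrightarrow> d i \<noteq> 0"
  shows "conj_scale J (diag_on T (\<lambda>i. of_real (d i))) (ennreal (\<Prod>p\<in>J. \<bar>d (fst p) * d (snd p)\<bar>))"
  unfolding conj_scale_def
proof
  fix F :: "complex^'n^'n \<Rightarrow> ennreal" assume F[measurable]: "F \<in> borel_measurable borel"
  have fin: "finite J" by (rule finite_subset[of _ UNIV]) auto
  have e: "herm J (\<lambda>p\<in>J. 0 + d (fst p) * d (snd p) * X p) = mconj (diag_on T (\<lambda>i. of_real (d i))) (herm J X)" for X
  proof -
    have "herm J (\<lambda>p\<in>J. 0 + d (fst p) * d (snd p) * X p) $ i $ j = mconj (diag_on T (\<lambda>i. of_real (d i))) (herm J X) $ i $ j" for i j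
    proof (cases "(i, j) \<in> J")
      case True
      have "Complex ((a * x + a * y) / 2) ((a * x - a * y) / 2) = of_real a * Complex ((x + y) / 2) ((x - y) / 2)" for a x y
        by (simp add: complex_eq_iff algebra_simps add_divide_distrib diff_divide_distrib)
      from this[of "d i * d j" "X (i, j)" "X (j, i)"] show ?thesis
        unfolding mconj_diag_on using True J symD[OF J(1) True] by (auto simp: herm_def mult.commute)
    qed (simp add: mconj_diag_on herm_def)
    then show ?thesis by (simp add: vec_eq_iff)
  qed
  have m: "(\<lambda>X. F (herm J X)) \<in> borel_measurable (lborel_on J)"
    using borel_measurable_herm[OF J(1)] by measurable
  have "ennreal (\<Prod>p\<in>J. \<bar>d (fst p) * d (snd p)\<bar>) * (\<integral>\<^sup>+ X. F (herm J (\<lambda>p\<in>J. 0 + d (fst p) * d (snd p) * X p)) \<partial>lborel_on J) = (\<integral>\<^sup>+ X. F (herm J X) \<partial>lborel_on J)"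
    by (rule nn_integral_lborel_on_affine[OF fin _ m]) (use J d in auto)
  then show "herm_integral J F = ennreal (\<Prod>p\<in>J. \<bar>d (fst p) * d (snd p)\<bar>) * herm_integral J (\<lambda>H. F (mconj (diag_on T (\<lambda>i. of_real (d i))) H))"
    unfolding herm_integral_def e ..
qed

lemma mconj_one_on:
  assumes "J \<subseteq> T \<times> T" "zero_outside J H"
  shows "mconj (one_on T) H = H"
  using assms mconj_diag_on[of T "\<lambda>_. 1" H] by (auto simp: vec_eq_iff zero_outside_def)

text \<open>The factors of \<open>U\<close> and of its adjoint are not known separately. Their
  product is 1 because the two conjugations are inverse to each other, so both disappear and the
  diagonal factor remains.\<close>

lemma conj_scale_unitary_diag:
  fixes d :: "'n::finite \<Rightarrow> real"
  assumes J: "sym J" "J \<subseteq> T \<times> T" and d: "\<And>i. i \<in> T \<Longrightarrow> d i \<noteq> 0"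
    and U: "unitary_on T U" "compatible J U" "compatible J (adjoint_matrix U)"
  shows "conj_scale J (U ** diag_on T (\<lambda>i. of_real (d i)) ** adjoint_matrix U) (ennreal (\<Prod>p\<in>J. \<bar>d (fst p) * d (snd p)\<bar>))"
proof -
  have UU: "U ** adjoint_matrix U = one_on T" "adjoint_matrix U ** U = one_on T"
    using U(1) by (auto simp: unitary_on_def)
  have inv: "mconj U (mconj (adjoint_matrix U) H) = H" "mconj (adjoint_matrix U) (mconj U H) = H" if "zero_outside J H" for H
    unfolding mconj_mult[symmetric] UU using mconj_one_on[OF J(2) that] by auto
  obtain c where c: "conj_scale J U c" using conj_scale_exists[OF J(1) U(2,3)] inv by metis
  obtain c' where c': "conj_scale J (adjoint_matrix U) c'" using conj_scale_exists[OF J(1) U(3,2)] inv by metis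
  have one: "compatible J (one_on T)" by (auto simp: compatible_def diag_on_nth split: if_splits)
  have "c * c' = 1"
  proof (rule conj_scale_unique[OF J(1) one])
    show "conj_scale J (one_on T) (c * c')" using conj_scale_mult[OF c c'] by (simp add: UU)
    show "conj_scale J (one_on T) 1" by (rule conj_scale_id[OF J(1)]) (rule mconj_one_on[OF J(2)])
    show "mconj (one_on T) (mconj (one_on T) H) = H" if "hermitian H" "zero_outside J H" for H
      using mconj_one_on[OF J(2) that(2)] by simp
  qed
  moreover have "conj_scale J (U ** diag_on T (\<lambda>i. of_real (d i)) ** adjoint_matrix U) (c * ennreal (\<Prod>p\<in>J. \<bar>d (fst p) * d (snd p)\<bar>) * c')"
    by (intro conj_scale_mult c c' conj_scale_diag_on J d)
  moreover have "c * e * c' = (c * c') * e" for e by (simp add: mult_ac)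
  ultimately show ?thesis by simp
qed

section \<open>Eigenvalues as Borel functions\<close>

definition herm_on :: "'n set \<Rightarrow> (complex^'n^'n) set" where
  "herm_on S = {B. hermitian B \<and> supported S B}"

text \<open>Set to \<open>0\<close> off the Hermitian matrices, so that it is Borel on the space of all matrices.\<close>

definition eigval :: "'n set \<Rightarrow> nat \<Rightarrow> complex^'n^'n \<Rightarrow> real" where
  "eigval S k B = (if B \<in> herm_on S then sorted_list_of_multiset (spectrum_on S B) ! k else 0)"

definition spec_prod :: "'n set \<Rightarrow> (real \<Rightarrow> ennreal) \<Rightarrow> complex^'n^'n \<Rightarrow> ennreal" where
  "spec_prod S w B = (\<Prod>k<card S. w (eigval S k B))"

lemma closed_herm_on: "closed (herm_on S :: (complex^'n^'n) set)"
  unfolding herm_on_def hermitian_def supported_def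
  by (intro closed_Collect_conj closed_Collect_all closed_Collect_imp closed_Collect_eq continuous_intros) auto

lemma borel_herm_on [measurable]: "herm_on S \<in> sets borel"
  using closed_herm_on by (rule borel_closed)

lemma borel_measurable_matpow_on: "(\<lambda>B. matpow_on S B k) \<in> borel_measurable borel"
proof (induction k)
  case (Suc k)
  then have [measurable]: "(\<lambda>B. matpow_on S B k) \<in> borel_measurable borel" .
  have "(\<lambda>B. matpow_on S B k ** B) \<in> borel_measurable borel" by measurable
  then show ?case by (simp add: matpow_on_def)
qed (simp add: matpow_on_def)

lemma sum_powers_spectrum_on:
  assumes "B \<in> herm_on S"
  shows "(\<Sum>y\<in>#spectrum_on S B. y ^ k) = Re (trace (matpow_on S B k))"
proof -
  obtain U \<mu> where d: "diagonalizes S B U \<mu>"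
    using assms diagonalizes_exists[of S B] by (auto simp: herm_on_def)
  show ?thesis
    unfolding trace_matpow_on[OF d] spectrum_on_eq[OF d]
    by (simp add: sum_unfold_sum_mset image_mset.compositionality o_def)
qed

text \<open>Gives access to counting functions from power sums. For \<open>m > 0\<close> a ramp
  rising from 0 to 1 on \<open>[x - 1 / m, x]\<close> is approximated by a polynomial within
  \<open>1 / (m + 1)\<close> on \<open>[-m, m]\<close>. As \<open>m\<close> grows the ramp steepens
  and the interval exhausts the line, so every point is reached.\<close>

lemma polynomial_limit_indicator:
  obtains p :: "nat \<Rightarrow> real \<Rightarrow> real"
  where "\<And>m. \<exists>a n. p m = (\<lambda>y. \<Sum>i\<le>(n::nat). a i * y ^ i)"
    and "\<And>y. (\<lambda>m. p m y) \<longlonglongrightarrow> indicator {x..} y"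
proof -
  define g where "g m y = max 0 (min 1 (1 + real m * (y - x)))" for m y
  have "\<exists>p. real_polynomial_function p \<and> (\<forall>y\<in>{- real m..real m}. \<bar>g m y - p y\<bar> < 1 / real (Suc m))" for m
  proof -
    have "continuous_on {- real m..real m} (g m)" unfolding g_def by (intro continuous_intros)
    moreover have "0 < 1 / real (Suc m)" by simp
    ultimately obtain q where "real_polynomial_function q" "\<And>y. y \<in> {- real m..real m} \<Longrightarrow> \<bar>g m y - q y\<bar> < 1 / real (Suc m)"
      using Stone_Weierstrass_real_polynomial_function[OF compact_Icc] by metis
    then show ?thesis by blast
  qed
  then obtain p where p: "\<And>m. real_polynomial_function (p m)"
    "\<And>m y. y \<in> {- real m..real m} \<Longrightarrow> \<bar>g m y - p m y\<bar> < 1 / real (Suc m)" by metis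
  show thesis
  proof
    show "\<exists>a n. p m = (\<lambda>y. \<Sum>i\<le>(n::nat). a i * y ^ i)" for m
      using p(1)[of m] by (simp add: real_polynomial_function_iff_sum)
    show "(\<lambda>m. p m y) \<longlonglongrightarrow> indicator {x..} y" for y
    proof -
      \<comment> \<open>For \<open>m \<ge> N\<close> the point \<open>y\<close> lies in
        \<open>[-m, m]\<close> and, if below \<open>x\<close>, to the left of the ramp. For
        \<open>y = x\<close> the quotient is 0 by the convention for division and imposes
        nothing.\<close>
      obtain N :: nat where N: "real N > max \<bar>y\<bar> (1 / \<bar>y - x\<bar>)" using reals_Archimedean2 by blast
      have gy: "g m y = indicator {x..} y" if "m \<ge> N" for m
      proof (cases "y \<ge> x")
        case True then show ?thesis by (simp add: g_def)
      next
        case False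
        have "1 / (x - y) < real m" using N that False by simp
        then have "1 < real m * (x - y)" using False by (simp add: pos_divide_less_eq)
        then have "1 + real m * (y - x) \<le> 0" by (simp add: algebra_simps)
        then show ?thesis using False by (simp add: g_def)
      qed
      have "eventually (\<lambda>m. norm (p m y - indicator {x..} y) \<le> 1 / real (Suc m)) sequentially"
        using eventually_ge_at_top[of N]
      proof eventually_elim
        case (elim m)
        then have "y \<in> {- real m..real m}" using N by auto
        from p(2)[OF this] gy[OF elim] show ?case by (simp add: abs_minus_commute)
      qed
      then have "(\<lambda>m. p m y - indicator {x..} y) \<longlonglongrightarrow> 0"
        by (rule Lim_null_comparison) (rule LIMSEQ_Suc[OF lim_1_over_n])
      then show ?thesis by (simp add: LIM_zero_iff)
    qed
  qed
qed

text \<open>A pointwise limit of sums of polynomials over the spectrum. These are linear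
  combinations of traces of powers, hence Borel.\<close>

lemma borel_measurable_count_spectrum:
  "(\<lambda>B. real (size (filter_mset (\<lambda>y. y \<ge> x) (spectrum_on S B)))) \<in> borel_measurable (restrict_space borel (herm_on S))"
proof -
  obtain p :: "nat \<Rightarrow> real \<Rightarrow> real" where p: "\<And>m. \<exists>a n. p m = (\<lambda>y. \<Sum>i\<le>(n::nat). a i * y ^ i)"
    "\<And>y. (\<lambda>m. p m y) \<longlonglongrightarrow> indicator {x..} y" using polynomial_limit_indicator[of x] by metis
  have 1: "(\<lambda>B. \<Sum>y\<in>#spectrum_on S B. p m y) \<in> borel_measurable (restrict_space borel (herm_on S))" for m
  proof -
    obtain a n where pm: "p m = (\<lambda>y. \<Sum>i\<le>(n::nat). a i * y ^ i)" using p(1) by blast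
    have swap: "(\<Sum>y\<in>#M. \<Sum>i\<le>n. a i * y ^ i) = (\<Sum>i\<le>n. a i * (\<Sum>y\<in>#M. y ^ i))" for M
      by (induction M) (simp_all add: sum.distrib algebra_simps)
    have [measurable]: "(\<lambda>B. trace (matpow_on S B i)) \<in> borel_measurable borel" for i
      unfolding trace_def using borel_measurable_matpow_on by measurable
    have "(\<lambda>B. \<Sum>i\<le>n. a i * Re (trace (matpow_on S B i))) \<in> borel_measurable borel" by measurable
    then have "(\<lambda>B. \<Sum>i\<le>n. a i * Re (trace (matpow_on S B i))) \<in> borel_measurable (restrict_space borel (herm_on S))"
      by (rule measurable_restrict_space1)
    then show ?thesis
      by (rule measurable_cong[THEN iffD2, rotated])
         (simp add: pm swap sum_powers_spectrum_on space_restrict_space)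
  qed
  have lim: "(\<lambda>m. \<Sum>y\<in>#M. p m y) \<longlonglongrightarrow> real (size (filter_mset (\<lambda>y. y \<ge> x) M))" for M
  proof (induction M)
    case (add y M)
    have "(\<lambda>m. p m y + (\<Sum>y\<in>#M. p m y)) \<longlonglongrightarrow> indicator {x..} y + real (size (filter_mset (\<lambda>y. y \<ge> x) M))"
      by (intro tendsto_add p(2) add)
    then show ?case by (auto simp: indicator_def)
  qed simp
  show ?thesis
    by (rule borel_measurable_LIMSEQ_real[where u="\<lambda>m B. \<Sum>y\<in>#spectrum_on S B. p m y", OF lim 1])
qed

text \<open>Reduces the measurability of a single ordered eigenvalue to that of counting functions.
  The number \<open>length xs - k\<close> counts the entry at index \<open>k\<close> and all entries
  after it.\<close>

lemma sorted_nth_ge_iff: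
  fixes xs :: "real list"
  assumes "sorted xs" "k < length xs"
  shows "xs ! k \<ge> x \<longleftrightarrow> length xs - k \<le> size (filter_mset (\<lambda>y. y \<ge> x) (mset xs))"
proof -
  have eq: "size (filter_mset (\<lambda>y. y \<ge> x) (mset xs)) = card {i. i < length xs \<and> xs ! i \<ge> x}"
    by (metis length_filter_conv_card mset_filter size_mset)
  show ?thesis
  proof
    assume "xs ! k \<ge> x"
    then have "{k..<length xs} \<subseteq> {i. i < length xs \<and> xs ! i \<ge> x}"
      using sorted_nth_mono[OF assms(1), of k] by fastforce
    then have "card {k..<length xs} \<le> card {i. i < length xs \<and> xs ! i \<ge> x}" by (intro card_mono) auto
    then show "length xs - k \<le> size (filter_mset (\<lambda>y. y \<ge> x) (mset xs))" by (simp add: eq)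
  next
    assume a: "length xs - k \<le> size (filter_mset (\<lambda>y. y \<ge> x) (mset xs))"
    show "xs ! k \<ge> x"
    proof (rule ccontr)
      assume "\<not> xs ! k \<ge> x"
      have "{i. i < length xs \<and> xs ! i \<ge> x} \<subseteq> {Suc k..<length xs}"
      proof
        fix i assume i: "i \<in> {i. i < length xs \<and> xs ! i \<ge> x}"
        have "\<not> i \<le> k" using sorted_nth_mono[OF assms(1), of i k] assms(2) i \<open>\<not> xs ! k \<ge> x\<close> by auto
        then show "i \<in> {Suc k..<length xs}" using i by auto
      qed
      then have "card {i. i < length xs \<and> xs ! i \<ge> x} \<le> card {Suc k..<length xs}" by (intro card_mono) auto
      then show False using a assms(2) by (simp add: eq)
    qed
  qed
qed

lemma size_spectrum_herm_on: "B \<in> herm_on S \<Longrightarrow> size (spectrum_on S B) = card S"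
  by (simp add: herm_on_def size_spectrum_on)

lemma borel_measurable_eigval [measurable]:
  assumes "k < card S"
  shows "eigval S k \<in> borel_measurable borel"
proof -
  let ?L = "\<lambda>B. sorted_list_of_multiset (spectrum_on S B)"
  have len: "length (?L B) = card S" if "B \<in> herm_on S" for B
    using size_spectrum_herm_on[OF that] by (metis mset_sorted_list_of_multiset size_mset)
  have "(\<lambda>B. ?L B ! k) \<in> borel_measurable (restrict_space borel (herm_on S))"
  proof (rule borel_measurableI_ge)
    fix x
    have eq: "{B \<in> space (restrict_space borel (herm_on S)). x \<le> ?L B ! k} =
      {B \<in> space (restrict_space borel (herm_on S)). real (card S - k) \<le> real (size (filter_mset (\<lambda>y. y \<ge> x) (spectrum_on S B)))}"
      using sorted_nth_ge_iff[of "?L _" k x] assms len by (auto simp: space_restrict_space)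
    show "{B \<in> space (restrict_space borel (herm_on S)). x \<le> ?L B ! k} \<in> sets (restrict_space borel (herm_on S))"
      unfolding eq by (intro borel_measurable_le borel_measurable_const borel_measurable_count_spectrum)
  qed
  then have "(\<lambda>B. if B \<in> herm_on S then ?L B ! k else 0) \<in> borel_measurable borel"
    by (intro measurable_If_restrict_space_iff[THEN iffD2]) auto
  then show ?thesis by (simp add: eigval_def[abs_def])
qed

lemma spec_prod_eq:
  assumes "B \<in> herm_on S"
  shows "spec_prod S w B = (\<Prod>y\<in>#spectrum_on S B. w y)"
proof -
  let ?L = "sorted_list_of_multiset (spectrum_on S B)"
  have len: "length ?L = card S"
    using size_spectrum_herm_on[OF assms] by (metis mset_sorted_list_of_multiset size_mset)
  have "spec_prod S w B = (\<Prod>k<length ?L. w (?L ! k))"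
    using assms by (simp add: spec_prod_def eigval_def len)
  also have "\<dots> = prod_list (map w ?L)"
    by (simp add: prod.list_conv_set_nth atLeast0LessThan)
  also have "\<dots> = (\<Prod>y\<in>#mset ?L. w y)" by (metis mset_map prod_mset_prod_list)
  finally show ?thesis by simp
qed

lemma spec_prod_diagonalizes:
  assumes "diagonalizes S B U \<mu>" "B \<in> herm_on S"
  shows "spec_prod S w B = (\<Prod>i\<in>S. w (\<mu> i))"
  unfolding spec_prod_eq[OF assms(2)] spectrum_on_eq[OF assms(1)]
  by (simp add: prod_unfold_prod_mset image_mset.compositionality o_def)

lemma borel_measurable_spec_prod [measurable (raw)]:
  assumes w[measurable]: "case_prod w \<in> borel_measurable (M \<Otimes>\<^sub>M borel)" and f[measurable]: "f \<in> borel_measurable M"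
  shows "(\<lambda>x. spec_prod S (w x) (f x)) \<in> borel_measurable M"
  unfolding spec_prod_def
proof (rule borel_measurable_prod_ennreal)
  fix k assume "k \<in> {..<card S}"
  then have [measurable]: "eigval S k \<in> borel_measurable borel" by auto
  have "(\<lambda>x. case_prod w (x, eigval S k (f x))) \<in> borel_measurable M" by measurable
  then show "(\<lambda>x. w x (eigval S k (f x))) \<in> borel_measurable M" by simp
qed

lemma diagonalizes_herm_on:
  assumes "diagonalizes S B U \<mu>"
  shows "B \<in> herm_on S"
proof -
  have "adjoint_matrix B = B"
    using assms by (simp add: diagonalizes_def adjoint_matrix_mult adjoint_matrix_diag_on matrix_mul_assoc)
  moreover have "supported S B"
    using assms by (auto simp: diagonalizes_def unitary_on_def intro!: supported_mult supported_adjoint_matrix)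
  ultimately show ?thesis by (simp add: herm_on_def hermitian_iff_adjoint_matrix)
qed

section \<open>Bordered matrices\<close>

abbreviation unit_at :: "'n \<Rightarrow> complex^'n^'n" where
  "unit_at b \<equiv> one_on {b}"

text \<open>A matrix \<open>R\<close> with \<open>column_at b S R\<close> is \<open>u e\<^sub>b\<^sup>*\<close> with a vector \<open>u\<close> supported on \<open>S\<close>.\<close>

definition column_at :: "'n \<Rightarrow> 'n set \<Rightarrow> complex^'n^'n \<Rightarrow> bool" where
  "column_at b S R \<longleftrightarrow> (\<forall>i j. j \<noteq> b \<or> i \<notin> S \<longrightarrow> R $ i $ j = 0)"

text \<open>The squared Frobenius norm; for a column matrix \<open>R = u e_b^*\<close> it is the
  squared length of \<open>u\<close>.\<close>

definition sqnorm :: "complex^'n^'n \<Rightarrow> real" where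
  "sqnorm R = Re (trace (adjoint_matrix R ** R))"

lemma matrix_zero_right [simp]: "A ** 0 = (0 :: complex^'n^'n)"
  by (simp add: vec_eq_iff matrix_matrix_mult_def)

lemma adjoint_matrix_zero [simp]: "adjoint_matrix 0 = 0"
  by (simp add: vec_eq_iff)

lemma adjoint_matrix_add: "adjoint_matrix (A + B) = adjoint_matrix A + adjoint_matrix B"
  by (simp add: vec_eq_iff)

lemma adjoint_matrix_diff: "adjoint_matrix (A - B) = adjoint_matrix A - adjoint_matrix B"
  by (simp add: vec_eq_iff)

lemma adjoint_matrix_scaleR: "adjoint_matrix (c *\<^sub>R A) = c *\<^sub>R adjoint_matrix A"
  by (simp add: vec_eq_iff)

lemma scaleR_matrix_left: "(c *\<^sub>R A) ** B = c *\<^sub>R (A ** (B :: complex^'n^'n))"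
  by (simp add: vec_eq_iff matrix_matrix_mult_def scaleR_sum_right)

lemma scaleR_matrix_right: "A ** (c *\<^sub>R B) = c *\<^sub>R (A ** (B :: complex^'n^'n))"
  by (simp add: vec_eq_iff matrix_matrix_mult_def scaleR_sum_right)

lemma matrix_add_rdistrib: "(A + B) ** C = A ** C + B ** (C :: complex^'n^'n)"
  by (simp add: vec_eq_iff matrix_matrix_mult_def algebra_simps sum.distrib)

lemma scaleR_matrix_nth: "(c *\<^sub>R A) $ i $ j = of_real c * (A :: complex^'n^'n) $ i $ j"
  by (simp add: scaleR_conv_of_real[where 'a=complex])

lemma mult_diag_on_zero: "(\<And>i j. j \<in> X \<Longrightarrow> A $ i $ j = 0) \<Longrightarrow> A ** diag_on X d = 0"
  by (simp add: vec_eq_iff mult_diag_on_nth)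

lemma diag_on_mult_zero: "(\<And>i j. i \<in> X \<Longrightarrow> A $ i $ j = 0) \<Longrightarrow> diag_on X d ** A = 0"
  by (simp add: vec_eq_iff diag_on_mult_nth)

lemmas matrix_ring = matrix_add_ldistrib matrix_add_rdistrib matrix_diff_ldistrib matrix_diff_rdistrib
  scaleR_matrix_left scaleR_matrix_right adjoint_matrix_add adjoint_matrix_diff adjoint_matrix_scaleR
  adjoint_matrix_mult adjoint_matrix_diag_on matrix_mul_assoc

lemma matrix_mult_zeroI:
  fixes A B :: "complex^'n^'n"
  assumes "\<And>i j k. A $ i $ k = 0 \<or> B $ k $ j = 0"
  shows "A ** B = 0"
proof -
  have "(\<Sum>k\<in>UNIV. A $ i $ k * B $ k $ j) = 0" for i j
    by (rule sum.neutral) (use assms in auto)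
  then show ?thesis by (simp add: vec_eq_iff matrix_matrix_mult_def)
qed

lemma one_on_insert: "b \<notin> S \<Longrightarrow> one_on (insert b S) = unit_at b + one_on S"
  by (auto simp: vec_eq_iff diag_on_nth)

lemma trace_adjoint_mult: "trace (adjoint_matrix R ** R) = of_real (\<Sum>i\<in>UNIV. \<Sum>k\<in>UNIV. (cmod (R $ k $ i))\<^sup>2)"
proof -
  have "trace (adjoint_matrix R ** R) = (\<Sum>i\<in>UNIV. \<Sum>k\<in>UNIV. R $ k $ i * cnj (R $ k $ i))"
    by (simp add: trace_def matrix_matrix_mult_def mult.commute)
  also have "\<dots> = of_real (\<Sum>i\<in>UNIV. \<Sum>k\<in>UNIV. (cmod (R $ k $ i))\<^sup>2)"
    unfolding of_real_sum complex_norm_square ..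
  finally show ?thesis .
qed

lemma sqnorm_eq: "sqnorm R = (\<Sum>i\<in>UNIV. \<Sum>k\<in>UNIV. (cmod (R $ k $ i))\<^sup>2)"
  unfolding sqnorm_def trace_adjoint_mult by simp

lemma sqnorm_nonneg [simp]: "sqnorm R \<ge> 0"
  unfolding sqnorm_eq by (intro sum_nonneg) auto

section \<open>Block calculus for a border column\<close>

locale column_matrix =
  fixes b :: "'n::finite" and S :: "'n set" and R :: "complex^'n^'n"
  assumes b: "b \<notin> S" and R: "column_at b S R"
begin

lemma one_R: "one_on S ** R = R"
  using R by (auto simp: vec_eq_iff diag_on_mult_nth column_at_def)

lemma R_one: "R ** one_on S = 0"
  using R b by (intro matrix_mult_zeroI) (auto simp: column_at_def diag_on_nth)

lemma R_unit: "R ** unit_at b = R"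
  using R by (auto simp: vec_eq_iff mult_diag_on_nth column_at_def)

lemma unit_R: "unit_at b ** R = 0"
  using R b by (intro matrix_mult_zeroI) (auto simp: column_at_def diag_on_nth)

lemma R_R: "R ** R = 0"
proof (rule matrix_mult_zeroI)
  fix i j k
  show "R $ i $ k = 0 \<or> R $ k $ j = 0"
    using R b by (cases "k = b") (auto simp: column_at_def)
qed

lemma one_unit: "one_on S ** unit_at b = 0" "unit_at b ** one_on S = 0"
  using b by (auto simp: diag_on_mult_diag_on[where d="\<lambda>_. 1"] vec_eq_iff diag_on_mult_nth diag_on_nth)

lemma adj_one: "adjoint_matrix R ** one_on S = adjoint_matrix R"
  using arg_cong[OF one_R, of adjoint_matrix] by (simp add: matrix_ring)

lemma one_adj: "one_on S ** adjoint_matrix R = 0"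
  using arg_cong[OF R_one, of adjoint_matrix] by (simp add: matrix_ring)

lemma unit_adj: "unit_at b ** adjoint_matrix R = adjoint_matrix R"
  using arg_cong[OF R_unit, of adjoint_matrix] by (simp add: matrix_ring)

lemma adj_unit: "adjoint_matrix R ** unit_at b = 0"
  using arg_cong[OF unit_R, of adjoint_matrix] by (simp add: matrix_ring)

lemma adj_R: "adjoint_matrix R ** R = sqnorm R *\<^sub>R unit_at b"
proof -
  have 0: "R $ k $ i = 0" if "i \<noteq> b" for i k using R that by (auto simp: column_at_def)
  have "(\<Sum>k\<in>UNIV. cnj (R $ k $ b) * R $ k $ b) = of_real (sqnorm R)"
  proof -
    have "(\<Sum>i\<in>UNIV. \<Sum>k\<in>UNIV. (cmod (R $ k $ i))\<^sup>2) = (\<Sum>i\<in>UNIV. if i = b then \<Sum>k\<in>UNIV. (cmod (R $ k $ b))\<^sup>2 else 0)"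
      using 0 by (intro sum.cong) auto
    then have s: "sqnorm R = (\<Sum>k\<in>UNIV. (cmod (R $ k $ b))\<^sup>2)" by (simp add: sqnorm_eq)
    show ?thesis unfolding s of_real_sum complex_norm_square by (simp add: mult.commute)
  qed
  then have "(adjoint_matrix R ** R) $ i $ j = (sqnorm R *\<^sub>R unit_at b) $ i $ j" for i j
  proof -
    have "(adjoint_matrix R ** R) $ i $ j = (\<Sum>k\<in>UNIV. cnj (R $ k $ i) * R $ k $ j)"
      by (simp add: matrix_matrix_mult_def)
    also have "\<dots> = (sqnorm R *\<^sub>R unit_at b) $ i $ j"
    proof (cases "i = b \<and> j = b")
      case True
      then show ?thesis
        using \<open>(\<Sum>k\<in>UNIV. cnj (R $ k $ b) * R $ k $ b) = of_real (sqnorm R)\<close>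
        by (simp add: diag_on_nth scaleR_matrix_nth del: vector_scaleR_component)
    next
      case False
      then have "cnj (R $ k $ i) * R $ k $ j = 0" for k using 0[of i k] 0[of j k] by auto
      then show ?thesis using False by (simp only: sum.neutral_const) (auto simp: diag_on_nth)
    qed
    finally show ?thesis .
  qed
  then show ?thesis by (simp add: vec_eq_iff)
qed

definition \<sigma> :: real where "\<sigma> = sqrt (1 + sqnorm R)"

text \<open>For \<open>R = u e_b^*\<close> this is the positive square root of
  \<open>1 + u u^*\<close> on the block: it multiplies \<open>u\<close> by \<open>\<sigma>\<close>
  and fixes the orthogonal complement of \<open>u\<close>. The coefficient is (\<sigma> - 1) /
  |u|^2, rewritten by |u|^2 = \<sigma>^2 - 1 so that it stays defined at u = 0. \<open>T'\<close> is
  the inverse, with factor 1 / \<sigma> on \<open>u\<close>.\<close>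

definition T :: "complex^'n^'n" where "T = one_on S + (1 / (1 + \<sigma>)) *\<^sub>R (R ** adjoint_matrix R)"

definition T' :: "complex^'n^'n" where "T' = one_on S - (1 / ((1 + \<sigma>) * \<sigma>)) *\<^sub>R (R ** adjoint_matrix R)"

text \<open>The rectangular block (1, -u) with rows in \<open>S\<close> and columns in
  \<open>insert b S\<close>. It has the same Gram matrix of rows as \<open>T\<close>, and this lets
  the spectrum of \<open>N^* P N\<close> be compared with that of \<open>T P T\<close>.\<close>

definition N :: "complex^'n^'n" where "N = one_on S - R"

text \<open>The unit vector spanning the kernel of \<open>N\<close> in the block, stored in column
  \<open>b\<close>; the vector \<open>u + e_b\<close> has length \<open>\<sigma>\<close>.\<close>

definition Q :: "complex^'n^'n" where "Q = (1 / \<sigma>) *\<^sub>R (unit_at b + R)"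

lemma \<sigma>: "\<sigma> > 0" "\<sigma>\<^sup>2 = 1 + sqnorm R" "sqnorm R = \<sigma> * \<sigma> - 1"
proof -
  have "1 + sqnorm R > 0" using sqnorm_nonneg[of R] by linarith
  then show "\<sigma> > 0" "\<sigma>\<^sup>2 = 1 + sqnorm R" by (auto simp: \<sigma>_def)
  then show "sqnorm R = \<sigma> * \<sigma> - 1" by (simp add: power2_eq_square)
qed

lemma RR_RR: "R ** adjoint_matrix R ** R ** adjoint_matrix R = sqnorm R *\<^sub>R (R ** adjoint_matrix R)"
proof -
  have "R ** adjoint_matrix R ** R ** adjoint_matrix R = R ** (adjoint_matrix R ** R) ** adjoint_matrix R"
    by (simp only: matrix_mul_assoc)
  also have "\<dots> = sqnorm R *\<^sub>R (R ** adjoint_matrix R)"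
    unfolding adj_R by (simp add: scaleR_matrix_left scaleR_matrix_right R_unit)
  finally show ?thesis .
qed

lemma one_on_idem: "one_on S ** one_on S = one_on S"
  by (simp add: diag_on_mult_diag_on)

lemma RR_one: "R ** adjoint_matrix R ** one_on S = R ** adjoint_matrix R"
  using adj_one by (metis matrix_mul_assoc)

lemma comb:
  "(one_on S + x *\<^sub>R (R ** adjoint_matrix R)) ** (one_on S + y *\<^sub>R (R ** adjoint_matrix R)) =
   one_on S + (x + y + x * y * sqnorm R) *\<^sub>R (R ** adjoint_matrix R)"
  by (simp add: matrix_ring one_on_idem one_R RR_one RR_RR scaleR_add_left scaleR_add_right mult_ac add_ac)

lemma T_T: "T ** T = one_on S + R ** adjoint_matrix R"
proof -
  have "1 / (1 + \<sigma>) + 1 / (1 + \<sigma>) + 1 / (1 + \<sigma>) * (1 / (1 + \<sigma>)) * sqnorm R = 1"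
    unfolding \<sigma>(3) using \<sigma>(1) by (simp add: divide_simps) (simp add: algebra_simps)
  then show ?thesis unfolding T_def comb by simp
qed

lemma T_T': "T ** T' = one_on S" "T' ** T = one_on S"
proof -
  have T': "T' = one_on S + (- (1 / ((1 + \<sigma>) * \<sigma>))) *\<^sub>R (R ** adjoint_matrix R)"
    by (simp add: T'_def)
  have z: "1 / (1 + \<sigma>) + - (1 / ((1 + \<sigma>) * \<sigma>)) + 1 / (1 + \<sigma>) * (- (1 / ((1 + \<sigma>) * \<sigma>))) * sqnorm R = 0"
    unfolding \<sigma>(3) using \<sigma>(1) by (simp add: divide_simps) (simp add: algebra_simps)
  have z': "- (1 / ((1 + \<sigma>) * \<sigma>)) + 1 / (1 + \<sigma>) + (- (1 / ((1 + \<sigma>) * \<sigma>))) * (1 / (1 + \<sigma>)) * sqnorm R = 0"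
    unfolding \<sigma>(3) using \<sigma>(1) by (simp add: divide_simps) (simp add: algebra_simps)
  show "T ** T' = one_on S" unfolding T_def T' comb z by simp
  show "T' ** T = one_on S" unfolding T_def T' comb z' by simp
qed

lemma supp_RR: "supported S (R ** adjoint_matrix R)"
  using R by (auto simp: supported_def matrix_matrix_mult_def column_at_def intro!: sum.neutral)

lemma supported_T: "supported S T" "supported S T'"
  using supp_RR by (auto simp: T_def T'_def supported_def diag_on_nth)

lemma adjoint_T: "adjoint_matrix T = T" "adjoint_matrix T' = T'"
  by (simp_all add: T_def T'_def matrix_ring)

lemma T_herm_on: "T \<in> herm_on S"
  using supported_T adjoint_T by (simp add: herm_on_def hermitian_iff_adjoint_matrix)

lemma N_adjoint_N: "N ** adjoint_matrix N = T ** T"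
  unfolding T_T N_def
  by (simp add: matrix_ring one_on_idem one_adj R_one)

lemma adjoint_Q_Q: "adjoint_matrix Q ** Q = unit_at b"
proof -
  have "adjoint_matrix Q ** Q = (1 / \<sigma> * (1 / \<sigma>)) *\<^sub>R ((1 + sqnorm R) *\<^sub>R unit_at b)"
    unfolding Q_def by (simp add: matrix_ring unit_R adj_unit adj_R diag_on_mult_diag_on scaleR_add_left scaleR_add_right)
  also have "\<dots> = unit_at b" using \<sigma> by (simp add: \<sigma>(2)[symmetric] power2_eq_square)
  finally show ?thesis .
qed

lemma N_Q: "N ** Q = 0"
  unfolding N_def Q_def by (simp add: matrix_ring one_unit R_unit one_R R_R)

lemma Q_unit: "Q ** unit_at b = Q"
  unfolding Q_def by (simp add: matrix_ring R_unit diag_on_mult_diag_on)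

lemma supported_NQ: "supported (insert b S) N" "supported (insert b S) Q" "supported (insert b S) T'"
  using R supp_RR by (auto simp: supported_def N_def Q_def T'_def diag_on_nth column_at_def)

text \<open>The eigenvectors of the bordered matrix below are the columns of \<open>Z\<close>.\<close>

lemma diagonalizes_bordered:
  assumes P: "supported S P" and d: "diagonalizes S (T ** P ** T) Y \<kappa>"
  shows "\<exists>Z. diagonalizes (insert b S) (l *\<^sub>R one_on (insert b S) - adjoint_matrix N ** P ** N) Z
            (\<lambda>i. if i = b then l else l - \<kappa> i)"
proof -
  \<comment> \<open>Polar decomposition \<open>N = T W\<close>, where \<open>W\<close> has
    orthonormal rows. Thus \<open>N^* P N = W^* (T P T) W\<close>, and the adjoint of
    \<open>W\<close> carries the eigenvectors \<open>Y\<close> of \<open>T P T\<close> isometrically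
    to eigenvectors with the same eigenvalues. The kernel vector \<open>Q\<close> completes the
    basis with eigenvalue 0.\<close>
  define W where "W = T' ** N"
  define K where "K = diag_on S (\<lambda>i. complex_of_real (\<kappa> i))"
  define Z where "Z = adjoint_matrix W ** Y + Q"
  have Y: "supported S Y" "Y ** adjoint_matrix Y = one_on S" "adjoint_matrix Y ** Y = one_on S"
    and TPT: "T ** P ** T = Y ** K ** adjoint_matrix Y"
    using d by (auto simp: diagonalizes_def unitary_on_def K_def)
  have SS': "supported S A \<Longrightarrow> supported (insert b S) A" for A by (auto simp: supported_def)
  have WW: "W ** adjoint_matrix W = one_on S"
  proof -
    have "W ** adjoint_matrix W = T' ** (N ** adjoint_matrix N) ** T'"
      by (simp only: W_def matrix_ring adjoint_T)
    also have "\<dots> = (T' ** T) ** (T ** T')" unfolding N_adjoint_N by (simp only: matrix_mul_assoc)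
    finally show ?thesis by (simp add: T_T' one_on_idem)
  qed
  have WQ: "W ** Q = 0" unfolding W_def using N_Q by (simp add: matrix_mul_assoc[symmetric])
  have QW: "adjoint_matrix Q ** adjoint_matrix W = 0"
    using arg_cong[OF WQ, of adjoint_matrix] by (simp add: adjoint_matrix_mult)
  have Yb: "Y ** unit_at b = 0" "unit_at b ** adjoint_matrix Y = 0" "K ** unit_at b = 0" "unit_at b ** K = 0"
    using Y(1) b
    by (auto intro!: mult_diag_on_zero diag_on_mult_zero simp: supported_def diag_on_nth K_def)
  have Z1: "adjoint_matrix Z ** Z = one_on (insert b S)"
  proof -
    have "adjoint_matrix Z ** Z = adjoint_matrix Y ** (W ** adjoint_matrix W) ** Y + adjoint_matrix Y ** (W ** Q)
        + (adjoint_matrix Q ** adjoint_matrix W) ** Y + adjoint_matrix Q ** Q"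
      by (simp add: Z_def matrix_ring)
    also have "\<dots> = one_on S + unit_at b"
      unfolding WW WQ QW adjoint_Q_Q using Y by (simp add: mult_one_on supported_adjoint_matrix)
    finally show ?thesis by (simp add: one_on_insert[OF b] add.commute)
  qed
  have Zs: "supported (insert b S) Z"
    unfolding Z_def W_def supported_def
    using supported_mult[OF supported_adjoint_matrix[OF supported_mult[OF supported_NQ(3,1)]] SS'[OF Y(1)]] supported_NQ(2)
    by (auto simp: supported_def)
  have Z2: "Z ** adjoint_matrix Z = one_on (insert b S)"
  proof -
    \<comment> \<open>Left and right inverses agree for square matrices of the full size, so the
      block is first completed by the unit matrix on the complement.\<close>
    let ?c = "one_on (- insert b S)"
    have dis: "A ** ?c = 0" "?c ** A = 0" if "supported (insert b S) A" for A
      using that by (auto intro!: mult_diag_on_zero diag_on_mult_zero simp: supported_def)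
    have one: "one_on (insert b S) + ?c = mat 1" by (auto simp: vec_eq_iff diag_on_nth mat_def)
    have cc: "?c ** ?c = ?c" by (simp add: diag_on_mult_diag_on)
    have "(adjoint_matrix Z + ?c) ** (Z + ?c) = mat 1"
      using Zs by (simp add: matrix_ring Z1 dis supported_adjoint_matrix cc one)
    then have "(Z + ?c) ** (adjoint_matrix Z + ?c) = mat 1" by (simp add: matrix_left_right_inverse)
    then have "Z ** adjoint_matrix Z + ?c = one_on (insert b S) + ?c"
      using Zs by (simp add: matrix_ring dis supported_adjoint_matrix cc one)
    then show ?thesis by simp
  qed
  have NTW: "N = T ** W" unfolding W_def
  proof -
    have "T ** (T' ** N) = one_on S ** N" by (simp add: matrix_mul_assoc T_T')
    also have "\<dots> = N" by (simp add: N_def matrix_ring one_on_idem one_R)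
    finally show "N = T ** (T' ** N)" ..
  qed
  have NPN: "adjoint_matrix N ** P ** N = adjoint_matrix W ** (T ** P ** T) ** W"
    by (subst (1 2) NTW) (simp only: matrix_ring adjoint_T)
  have NPNZ: "adjoint_matrix N ** P ** N ** Z = Z ** K"
  proof -
    have "adjoint_matrix N ** P ** N ** Z = adjoint_matrix W ** Y ** K ** adjoint_matrix Y ** (W ** adjoint_matrix W) ** Y
        + adjoint_matrix W ** (T ** P ** T) ** (W ** Q)"
      unfolding NPN Z_def TPT by (simp add: matrix_ring)
    also have "\<dots> = adjoint_matrix W ** Y ** K ** (adjoint_matrix Y ** one_on S ** Y)"
      unfolding WW WQ by (simp add: matrix_mul_assoc)
    also have "adjoint_matrix Y ** one_on S ** Y = one_on S"
      using Y by (simp add: mult_one_on supported_adjoint_matrix)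
    also have "adjoint_matrix W ** Y ** K ** one_on S = adjoint_matrix W ** Y ** K"
      by (simp add: K_def diag_on_mult_diag_on flip: matrix_mul_assoc)
    also have "\<dots> = Z ** K"
    proof -
      have "Q ** K = Q ** unit_at b ** K" by (simp add: Q_unit)
      also have "\<dots> = 0" using Yb by (simp add: matrix_mul_assoc[symmetric])
      finally show ?thesis by (simp add: Z_def matrix_ring)
    qed
    finally show ?thesis .
  qed
  have "adjoint_matrix N ** P ** N = adjoint_matrix N ** P ** N ** (Z ** adjoint_matrix Z)"
  proof -
    have "supported (insert b S) (adjoint_matrix N ** P ** N)"
      by (intro supported_mult supported_adjoint_matrix supported_NQ SS'[OF P])
    then show ?thesis by (simp add: Z2 mult_one_on)
  qed
  also have "\<dots> = Z ** K ** adjoint_matrix Z" by (simp add: matrix_mul_assoc NPNZ)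
  finally have e: "adjoint_matrix N ** P ** N = Z ** K ** adjoint_matrix Z" .
  have D: "diag_on (insert b S) (\<lambda>i. complex_of_real (if i = b then l else l - \<kappa> i)) = l *\<^sub>R one_on (insert b S) - K"
    using b by (auto simp: vec_eq_iff diag_on_nth K_def scaleR_matrix_nth simp del: vector_scaleR_component)
  have "Z ** (l *\<^sub>R one_on (insert b S) - K) ** adjoint_matrix Z = l *\<^sub>R one_on (insert b S) - adjoint_matrix N ** P ** N"
    unfolding e using Zs by (simp add: matrix_ring Z2 mult_one_on)
  then have "diagonalizes (insert b S) (l *\<^sub>R one_on (insert b S) - adjoint_matrix N ** P ** N) Z (\<lambda>i. if i = b then l else l - \<kappa> i)"
    unfolding diagonalizes_def D unitary_on_def using Zs Z1 Z2 by simp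
  then show ?thesis by blast
qed

end

section \<open>Recursion on the top eigenvalue\<close>

text \<open>The measure with density \<open>r'\<close> on \<open>A\<close>, pushed forward by
  \<open>r\<close>, gives the interval from \<open>l\<close> to \<open>u\<close> the mass
  \<open>r b - r a = u - l\<close> by the fundamental theorem of calculus. This characterises
  Lebesgue measure, so the formula holds for every Borel function at once.\<close>

lemma nn_integral_substitution_bijection:
  fixes r r' :: "real \<Rightarrow> real" and A :: "real set"
  assumes A: "is_interval A" "open A"
    and deriv: "\<And>x. x \<in> A \<Longrightarrow> (r has_real_derivative r' x) (at x)"
    and pos: "\<And>x. x \<in> A \<Longrightarrow> r' x > 0"
    and surj: "\<And>y. \<exists>x\<in>A. r x = y"
    and r[measurable]: "r \<in> borel_measurable borel" and r'[measurable]: "r' \<in> borel_measurable borel"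
    and f[measurable]: "f \<in> borel_measurable borel"
  shows "(\<integral>\<^sup>+ y. f y \<partial>lborel) = (\<integral>\<^sup>+ x. indicator A x * ennreal (r' x) * f (r x) \<partial>lborel)"
proof -
  have [measurable]: "A \<in> sets borel" using A(2) by simp
  have Icc: "{x..y} \<subseteq> A" if "x \<in> A" "y \<in> A" for x y
    using mem_is_interval_1_I[OF A(1) that] by auto
  have mono: "r x < r y" if "x \<in> A" "y \<in> A" "x < y" for x y
  proof (rule DERIV_pos_imp_increasing[OF that(3)])
    fix t assume "x \<le> t" "t \<le> y"
    then have "t \<in> A" using Icc[OF that(1,2)] by auto
    then show "\<exists>y. (r has_real_derivative y) (at t) \<and> y > 0" using deriv pos by blast
  qed
  define \<nu> where "\<nu> = distr (density lborel (\<lambda>x. indicator A x * ennreal (r' x))) borel r"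
  have "lborel = \<nu>"
  proof (rule lborel_eqI)
    fix l u :: real assume "\<And>b. b \<in> Basis \<Longrightarrow> l \<bullet> b \<le> u \<bullet> b"
    then have lu: "l \<le> u" by simp
    obtain a where a: "a \<in> A" "r a = l" using surj by blast
    obtain b where b: "b \<in> A" "r b = u" using surj by blast
    have ab: "a \<le> b" using lu mono[OF b(1) a(1)] a(2) b(2) by (cases "b < a") auto
    have eq: "indicator A x * indicator (r -` box l u) x = (indicator {a<..<b} x :: ennreal)" for x
    proof -
      have "x \<in> A \<and> l < r x \<and> r x < u \<longleftrightarrow> a < x \<and> x < b"
      proof
        assume h: "x \<in> A \<and> l < r x \<and> r x < u"
        then have "\<not> x \<le> a" "\<not> b \<le> x"
          using mono[of x a] mono[of b x] a b by (auto simp: le_less)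
        then show "a < x \<and> x < b" by simp
      next
        assume h: "a < x \<and> x < b"
        then have "x \<in> A" using Icc[OF a(1) b(1)] by auto
        then show "x \<in> A \<and> l < r x \<and> r x < u" using mono[OF a(1) \<open>x \<in> A\<close>] mono[OF \<open>x \<in> A\<close> b(1)] a b h by simp
      qed
      then show ?thesis by (auto simp: indicator_def box_real)
    qed
    have "emeasure \<nu> (box l u) = (\<integral>\<^sup>+ x. indicator A x * ennreal (r' x) * indicator (r -` box l u) x \<partial>lborel)"
      unfolding \<nu>_def using measurable_sets_borel[OF r, of "box l u"]
      by (subst emeasure_distr) (simp_all add: emeasure_density)
    also have "\<dots> = (\<integral>\<^sup>+ x. ennreal (r' x) * indicator {a<..<b} x \<partial>lborel)"
      by (intro nn_integral_cong) (simp add: eq[symmetric] mult_ac)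
    also have "\<dots> = (\<integral>\<^sup>+ x. ennreal (indicator A x * r' x) * indicator {a..b} x \<partial>lborel)"
    proof (rule nn_integral_cong_AE)
      have "AE x in lborel. x \<noteq> a" "AE x in lborel. x \<noteq> b" by (rule AE_lborel_singleton)+
      then show "AE x in lborel. ennreal (r' x) * indicator {a<..<b} x = ennreal (indicator A x * r' x) * indicator {a..b} x"
      proof eventually_elim
        case (elim x)
        show ?case
        proof (cases "x \<in> {a<..<b}")
          case True
          then have "x \<in> A" using Icc[OF a(1) b(1)] by auto
          then show ?thesis using True by (simp add: indicator_def)
        next
          case False
          then have "x \<notin> {a..b}" using elim by auto
          then show ?thesis using False by simp
        qed
      qed
    qed
    also have "\<dots> = ennreal (r b - r a)"
    proof (rule nn_integral_FTC_Icc)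
      fix x assume "x \<in> {a..b}"
      then have "x \<in> A" using Icc[OF a(1) b(1)] by auto
      then show "(r has_real_derivative indicator A x * r' x) (at x)" "0 \<le> indicator A x * r' x"
        using deriv pos[of x] by simp_all
    qed (use ab in auto)
    finally show "emeasure \<nu> (box l u) = (\<Prod>b\<in>Basis. (u - l) \<bullet> b)" using a b by simp
  qed (simp add: \<nu>_def)
  then have "(\<integral>\<^sup>+ y. f y \<partial>lborel) = (\<integral>\<^sup>+ y. f y \<partial>\<nu>)" by simp
  also have "\<dots> = (\<integral>\<^sup>+ x. f (r x) \<partial>density lborel (\<lambda>x. indicator A x * ennreal (r' x)))"
    unfolding \<nu>_def by (rule nn_integral_distr) auto
  also have "\<dots> = (\<integral>\<^sup>+ x. indicator A x * ennreal (r' x) * f (r x) \<partial>lborel)"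
    by (rule nn_integral_density) auto
  finally show ?thesis .
qed

text \<open>On the right of all poles, \<open>\<lambda> - \<Sum> q\<^sub>i / (\<lambda> - \<mu>\<^sub>i)\<close> increases from \<open>-\<infinity>\<close> to \<open>\<infinity>\<close>.\<close>

lemma nn_integral_secular_substitution:
  fixes \<mu> q :: "'i \<Rightarrow> real"
  assumes fin: "finite S" and q: "\<And>i. i \<in> S \<Longrightarrow> q i \<ge> 0"
    and top: "S \<noteq> {} \<Longrightarrow> \<exists>t\<in>S. q t > 0 \<and> (\<forall>i\<in>S. \<mu> i \<le> \<mu> t)"
    and f: "f \<in> borel_measurable borel"
  shows "(\<integral>\<^sup>+ a. f a \<partial>lborel) = (\<integral>\<^sup>+ l. indicator {l. \<forall>i\<in>S. \<mu> i < l} l *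
     ennreal (1 + (\<Sum>i\<in>S. q i / (l - \<mu> i)\<^sup>2)) * f (l - (\<Sum>i\<in>S. q i / (l - \<mu> i))) \<partial>lborel)"
proof (rule nn_integral_substitution_bijection)
  let ?A = "{l. \<forall>i\<in>S. \<mu> i < l}"
  let ?r = "\<lambda>l. l - (\<Sum>i\<in>S. q i / (l - \<mu> i))"
  show "is_interval ?A" by (auto simp: is_interval_1)
  have "?A = (\<Inter>i\<in>S. {\<mu> i<..})" by auto
  then show "open ?A" using fin by (simp add: open_INT)
  show der: "(?r has_real_derivative 1 + (\<Sum>i\<in>S. q i / (l - \<mu> i)\<^sup>2)) (at l)" if "l \<in> ?A" for l
  proof -
    have "((\<lambda>l. q i / (l - \<mu> i)) has_real_derivative - (q i / (l - \<mu> i)\<^sup>2)) (at l)" if "i \<in> S" for i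
      using \<open>l \<in> ?A\<close> that by (auto intro!: derivative_eq_intros simp: power2_eq_square)
    then have "((\<lambda>l. \<Sum>i\<in>S. q i / (l - \<mu> i)) has_real_derivative (\<Sum>i\<in>S. - (q i / (l - \<mu> i)\<^sup>2))) (at l)"
      by (rule DERIV_sum)
    from DERIV_diff[OF DERIV_ident this] show ?thesis by (simp add: sum_negf)
  qed
  show "1 + (\<Sum>i\<in>S. q i / (l - \<mu> i)\<^sup>2) > 0" if "l \<in> ?A" for l
    using q sum_nonneg[of S "\<lambda>i. q i / (l - \<mu> i)\<^sup>2"] by (simp add: add_pos_nonneg)
  show "\<exists>l\<in>?A. ?r l = y" for y
  proof (cases "S = {}")
    case False
    then obtain t where t: "t \<in> S" "q t > 0" "\<And>i. i \<in> S \<Longrightarrow> \<mu> i \<le> \<mu> t" using top by blast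
    \<comment> \<open>At \<open>hi\<close> every denominator is at least 1, so the subtracted sum is
      at most the sum of the \<open>q i\<close> and the value is at least \<open>y\<close>. At
      \<open>\<mu> t + e\<close> the term of \<open>t\<close> alone is \<open>q t / e\<close>, and
      \<open>e\<close> makes it at least \<open>\<bar>y\<bar> + \<bar>\<mu> t\<bar> + 1\<close>,
      which pushes the value down to at most \<open>y\<close>.\<close>
    define hi where "hi = max (\<mu> t + 1) (y + (\<Sum>i\<in>S. q i))"
    define e where "e = min 1 (q t / (\<bar>y\<bar> + \<bar>\<mu> t\<bar> + 1))"
    have e: "e > 0" "e \<le> 1" using t(2) by (auto simp: e_def)
    have hiA: "\<mu> i + 1 \<le> hi" if "i \<in> S" for i using t(3)[OF that] by (simp add: hi_def)
    have "(\<Sum>i\<in>S. q i / (hi - \<mu> i)) \<le> (\<Sum>i\<in>S. q i)"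
    proof (rule sum_mono)
      fix i assume i: "i \<in> S"
      have "q i / (hi - \<mu> i) \<le> q i / 1" using hiA[OF i] q[OF i] by (intro divide_left_mono) auto
      then show "q i / (hi - \<mu> i) \<le> q i" by simp
    qed
    then have rhi: "y \<le> ?r hi" by (simp add: hi_def)
    have "q t / e \<le> (\<Sum>i\<in>S. q i / (\<mu> t + e - \<mu> i))"
    proof -
      have "q t / (\<mu> t + e - \<mu> t) \<le> (\<Sum>i\<in>S. q i / (\<mu> t + e - \<mu> i))"
        using t e q fin by (intro member_le_sum) (auto simp: divide_nonneg_pos add_nonneg_pos diff_add_eq less_imp_le add_increasing2)
      then show ?thesis by simp
    qed
    moreover have "\<bar>y\<bar> + \<bar>\<mu> t\<bar> + 1 \<le> q t / e"
    proof -
      have "e \<le> q t / (\<bar>y\<bar> + \<bar>\<mu> t\<bar> + 1)" by (simp add: e_def)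
      then have "e * (\<bar>y\<bar> + \<bar>\<mu> t\<bar> + 1) \<le> q t" by (simp add: pos_le_divide_eq add_nonneg_pos)
      then show ?thesis using e by (simp add: pos_le_divide_eq mult.commute)
    qed
    ultimately have rlo: "?r (\<mu> t + e) \<le> y" using e by linarith
    have le: "\<mu> t + e \<le> hi" using e by (simp add: hi_def)
    have "\<exists>l\<ge>\<mu> t + e. l \<le> hi \<and> ?r l = y"
    proof (rule IVT[OF rlo rhi le], intro allI impI)
      fix l assume "\<mu> t + e \<le> l \<and> l \<le> hi"
      then have "l \<in> ?A" using t(3) e by force
      then show "isCont ?r l" using der by (blast intro: DERIV_isCont)
    qed
    then show ?thesis using t(3) e by force
  qed auto
  show "?r \<in> borel_measurable borel" "(\<lambda>l. 1 + (\<Sum>i\<in>S. q i / (l - \<mu> i)\<^sup>2)) \<in> borel_measurable borel" by measurable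
qed (rule f)

section \<open>Determinant and positivity on a block\<close>

definition det_on :: "'n set \<Rightarrow> complex^'n^'n \<Rightarrow> complex" where
  "det_on S A = det (A + one_on (- S))"

text \<open>Stated through the quadratic form, with the test vectors packed as the columns of
  \<open>R\<close>: the congruence \<open>T P T\<close> moves the eigenvalues but clearly keeps the
  form positive.\<close>

definition posdef_on :: "'n set \<Rightarrow> complex^'n^'n \<Rightarrow> bool" where
  "posdef_on S B \<longleftrightarrow> (\<forall>R. supported S R \<longrightarrow> R \<noteq> 0 \<longrightarrow> Re (trace (adjoint_matrix R ** B ** R)) > 0)"

lemma supported_compl:
  assumes "supported S A"
  shows "A ** one_on (- S) = 0" "one_on (- S) ** A = 0"
  using assms by (auto intro!: mult_diag_on_zero diag_on_mult_zero simp: supported_def)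

lemma det_on_mult:
  assumes "supported S A" "supported S B"
  shows "det_on S (A ** B) = det_on S A * det_on S B"
proof -
  have "(A + one_on (- S)) ** (B + one_on (- S)) = A ** B + one_on (- S)"
    using supported_compl[OF assms(1)] supported_compl[OF assms(2)] by (simp add: matrix_ring diag_on_mult_diag_on)
  then show ?thesis unfolding det_on_def by (metis det_mul)
qed

lemma det_on_diag_on: "det_on S (diag_on S d) = (\<Prod>i\<in>S. d i)"
proof -
  have "det_on S (diag_on S d) = (\<Prod>i\<in>UNIV. (diag_on S d + one_on (- S)) $ i $ i)"
    unfolding det_on_def by (rule det_diagonal) (simp add: diag_on_nth)
  also have "\<dots> = (\<Prod>i\<in>UNIV. if i \<in> S then d i else 1)"
    by (intro prod.cong) (auto simp: diag_on_nth)
  finally show ?thesis by (simp add: prod.If_cases)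
qed

lemma det_on_diagonalizes:
  assumes "diagonalizes S B U \<mu>"
  shows "det_on S B = of_real (\<Prod>i\<in>S. \<mu> i)"
proof -
  have U: "supported S U" "U ** adjoint_matrix U = one_on S" and B: "B = U ** diag_on S (\<lambda>i. of_real (\<mu> i)) ** adjoint_matrix U"
    using assms by (auto simp: diagonalizes_def unitary_on_def)
  have "det_on S U * det_on S (adjoint_matrix U) = 1"
    using det_on_mult[OF U(1) supported_adjoint_matrix[OF U(1)]] det_on_diag_on[of S "\<lambda>_. 1"] by (simp add: U(2))
  moreover have "det_on S B = det_on S U * det_on S (diag_on S (\<lambda>i. of_real (\<mu> i))) * det_on S (adjoint_matrix U)"
    unfolding B using U(1) by (simp add: det_on_mult supported_mult supported_adjoint_matrix)
  ultimately show ?thesis by (simp add: det_on_diag_on mult_ac)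
qed

lemma posdef_on_diagonalizes:
  fixes S :: "('n::finite) set"
  assumes "diagonalizes S B U \<mu>"
  shows "posdef_on S B \<longleftrightarrow> (\<forall>i\<in>S. \<mu> i > 0)"
proof -
  define D where "D = diag_on S (\<lambda>i. complex_of_real (\<mu> i))"
  have U: "supported S U" "U ** adjoint_matrix U = one_on S" "adjoint_matrix U ** U = one_on S"
    and B: "B = U ** D ** adjoint_matrix U"
    using assms by (auto simp: diagonalizes_def unitary_on_def D_def)
  have q: "Re (trace (adjoint_matrix R ** B ** R)) = (\<Sum>j\<in>UNIV. \<Sum>i\<in>S. \<mu> i * (cmod ((adjoint_matrix U ** R) $ i $ j))\<^sup>2)" for R
  proof -
    define W where "W = adjoint_matrix U ** R"
    have "adjoint_matrix R ** B ** R = adjoint_matrix W ** (D ** W)"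
      unfolding B W_def by (simp add: matrix_ring)
    moreover have "(adjoint_matrix W ** (D ** W)) $ j $ j = (\<Sum>i\<in>S. of_real (\<mu> i * (cmod (W $ i $ j))\<^sup>2))" for j
    proof -
      have "(adjoint_matrix W ** (D ** W)) $ j $ j = (\<Sum>i\<in>UNIV. if i \<in> S then of_real (\<mu> i) * (W $ i $ j * cnj (W $ i $ j)) else 0)"
        unfolding matrix_matrix_mult_def[of "adjoint_matrix W"] D_def by (auto simp: diag_on_mult_nth mult_ac intro!: sum.cong)
      also have "\<dots> = (\<Sum>i\<in>S. of_real (\<mu> i) * (W $ i $ j * cnj (W $ i $ j)))" by (simp add: sum.If_cases)
      finally show ?thesis by (simp only: complex_norm_square[symmetric] of_real_mult)
    qed
    ultimately show ?thesis by (simp add: trace_def W_def)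
  qed
  show ?thesis
  proof
    assume pd: "posdef_on S B"
    show "\<forall>i\<in>S. \<mu> i > 0"
    proof
      fix i assume i: "i \<in> S"
      define R where "R = U ** unit_at i"
      have R: "supported S R" unfolding R_def using U(1) i by (intro supported_mult) (auto simp: supported_def diag_on_nth)
      have W: "adjoint_matrix U ** R = unit_at i"
        unfolding R_def using i by (simp add: matrix_mul_assoc U(3)) (auto simp: vec_eq_iff diag_on_mult_nth diag_on_nth)
      have "R \<noteq> 0"
      proof
        assume "R = 0"
        then have "unit_at i $ i $ i = (0 :: complex)" using W by (metis matrix_zero_right zero_index)
        then show False by (simp add: diag_on_nth)
      qed
      then have "0 < (\<Sum>j\<in>UNIV. \<Sum>k\<in>S. \<mu> k * (cmod (unit_at i $ k $ j))\<^sup>2)"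
        using pd R unfolding posdef_on_def q[symmetric] W[symmetric] by blast
      also have "\<dots> = (\<Sum>j\<in>UNIV. if j = i then \<mu> i else 0)"
      proof (rule sum.cong)
        fix j
        have "(\<Sum>k\<in>S. \<mu> k * (cmod (unit_at i $ k $ j))\<^sup>2) = (\<Sum>k\<in>S. if k = i then (if j = i then \<mu> i else 0) else 0)"
          by (intro sum.cong) (auto simp: diag_on_nth)
        then show "(\<Sum>k\<in>S. \<mu> k * (cmod (unit_at i $ k $ j))\<^sup>2) = (if j = i then \<mu> i else 0)" using i by simp
      qed simp
      finally show "\<mu> i > 0" by simp
    qed
  next
    assume pos: "\<forall>i\<in>S. \<mu> i > 0"
    show "posdef_on S B" unfolding posdef_on_def q
    proof (intro allI impI)
      fix R assume R: "supported S R" "R \<noteq> 0"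
      define W where "W = adjoint_matrix U ** R"
      have "U ** W = R" unfolding W_def by (simp add: matrix_mul_assoc U(2) one_on_mult R(1))
      then have "W \<noteq> 0" using R(2) by auto
      then obtain i j where ij: "W $ i $ j \<noteq> 0" by (auto simp: vec_eq_iff)
      have "supported S W" unfolding W_def using U R by (intro supported_mult supported_adjoint_matrix)
      then have iS: "i \<in> S" using ij by (auto simp: supported_def)
      have nn: "\<mu> i * (cmod (W $ i $ j))\<^sup>2 \<ge> 0" if "i \<in> S" for i j using pos that by (simp add: less_imp_le)
      have "0 < (\<Sum>i\<in>S. \<mu> i * (cmod (W $ i $ j))\<^sup>2)"
        using iS ij pos nn by (intro sum_pos2[of _ i]) auto
      then show "0 < (\<Sum>j\<in>UNIV. \<Sum>i\<in>S. \<mu> i * (cmod (W $ i $ j))\<^sup>2)"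
        using nn by (rule_tac sum_pos2[of UNIV j]) (auto intro: sum_nonneg)
    qed
  qed
qed

lemma posdef_on_congruence:
  assumes T: "supported S T" "supported S T'" "T ** T' = one_on S" "T' ** T = one_on S" "adjoint_matrix T = T"
  shows "posdef_on S (T ** P ** T) \<longleftrightarrow> posdef_on S P"
proof -
  have e: "adjoint_matrix R ** (T ** P ** T) ** R = adjoint_matrix (T ** R) ** P ** (T ** R)" for R
    by (simp add: matrix_ring T(5))
  have inj: "T ** R \<noteq> 0" if "supported S R" "R \<noteq> 0" for R
  proof
    assume "T ** R = 0"
    then have "T' ** (T ** R) = 0" by simp
    then show False using that by (simp add: matrix_mul_assoc T(4) one_on_mult)
  qed
  have surj: "T ** (T' ** R) = R" if "supported S R" for R
    using that by (simp add: matrix_mul_assoc T(3) one_on_mult)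
  show ?thesis
  proof
    assume pd: "posdef_on S (T ** P ** T)"
    show "posdef_on S P" unfolding posdef_on_def
    proof (intro allI impI)
      fix R assume R: "supported S R" "R \<noteq> 0"
      have "supported S (T' ** R)" "T' ** R \<noteq> 0" using R T surj[OF R(1)] by (auto intro!: supported_mult)
      then show "0 < Re (trace (adjoint_matrix R ** P ** R))"
        using pd unfolding posdef_on_def e by (metis surj[OF R(1)])
    qed
  next
    assume pd: "posdef_on S P"
    show "posdef_on S (T ** P ** T)" unfolding posdef_on_def e
    proof (intro allI impI)
      fix R assume R: "supported S R" "R \<noteq> 0"
      then have "supported S (T ** R)" "T ** R \<noteq> 0" using T inj by (auto intro!: supported_mult)
      then show "0 < Re (trace (adjoint_matrix (T ** R) ** P ** (T ** R)))"
        using pd unfolding posdef_on_def by blast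
    qed
  qed
qed

context column_matrix begin

text \<open>This is \<open>det (1 + u u^* ) = 1 + |u|^2\<close>. The numbers
  \<open>x i = (s i)^2 - 1\<close> are the eigenvalues of \<open>u u^*\<close>. Its square is |u|^2
  times itself, so each is 0 or |u|^2, and its trace |u|^2 leaves exactly one nonzero value when u
  is nonzero.\<close>

lemma prod_eigenvalues_T:
  assumes "diagonalizes S T U s"
  shows "(\<Prod>i\<in>S. (s i)\<^sup>2) = 1 + sqnorm R"
proof -
  have U: "unitary_on S U" and T: "T = U ** diag_on S (\<lambda>i. of_real (s i)) ** adjoint_matrix U"
    using assms by (auto simp: diagonalizes_def)
  have U': "supported S U" "U ** adjoint_matrix U = one_on S" "adjoint_matrix U ** U = one_on S"
    using U by (auto simp: unitary_on_def)
  define x where "x i = (s i)\<^sup>2 - 1" for i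
  define X where "X = diag_on S (\<lambda>i. complex_of_real (x i))"
  have RR: "R ** adjoint_matrix R = U ** X ** adjoint_matrix U"
  proof -
    have "U ** one_on S ** adjoint_matrix U = one_on S" using U' by (simp add: mult_one_on)
    moreover have "X = diag_on S (\<lambda>i. of_real (s i) * of_real (s i)) - one_on S"
      by (auto simp: X_def x_def vec_eq_iff diag_on_nth power2_eq_square)
    ultimately have "U ** X ** adjoint_matrix U = T ** T - one_on S"
      unfolding T unitary_conj_mult[OF U] by (simp add: matrix_ring)
    then show ?thesis by (simp add: T_T)
  qed
  have "trace (R ** adjoint_matrix R) = (\<Sum>i\<in>S. of_real (x i))"
    unfolding RR X_def by (rule trace_unitary_conj[OF U])
  moreover have "trace (R ** adjoint_matrix R) = of_real (sqnorm R)"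
    using trace_mul_sym[of R "adjoint_matrix R"] trace_adjoint_mult[of R] by (simp add: sqnorm_eq)
  ultimately have "complex_of_real (\<Sum>i\<in>S. x i) = of_real (sqnorm R)" by simp
  then have sumx: "(\<Sum>i\<in>S. x i) = sqnorm R" by (simp only: of_real_eq_iff)
  have "U ** diag_on S (\<lambda>i. of_real (x i) * of_real (x i)) ** adjoint_matrix U = sqnorm R *\<^sub>R (U ** X ** adjoint_matrix U)"
    using RR_RR unfolding RR[symmetric] unitary_conj_mult[OF U, symmetric] X_def[symmetric] by (simp add: matrix_mul_assoc)
  then have "adjoint_matrix U ** (U ** diag_on S (\<lambda>i. of_real (x i) * of_real (x i)) ** adjoint_matrix U) ** U =
     adjoint_matrix U ** (sqnorm R *\<^sub>R (U ** X ** adjoint_matrix U)) ** U" by simp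
  moreover have "adjoint_matrix U ** (U ** diag_on S d ** adjoint_matrix U) ** U = diag_on S d" for d
  proof -
    have "adjoint_matrix U ** (U ** diag_on S d ** adjoint_matrix U) ** U = (adjoint_matrix U ** U) ** diag_on S d ** (adjoint_matrix U ** U)"
      by (simp only: matrix_mul_assoc)
    then show ?thesis by (simp add: U'(3) diag_on_mult_diag_on)
  qed
  ultimately have "diag_on S (\<lambda>i. of_real (x i) * of_real (x i)) = sqnorm R *\<^sub>R X"
    by (simp add: matrix_ring X_def)
  then have eqi: "diag_on S (\<lambda>i. complex_of_real (x i) * of_real (x i)) $ i $ i = (sqnorm R *\<^sub>R X) $ i $ i" for i by simp
  have "complex_of_real (x i * x i) = of_real (sqnorm R * x i)" if "i \<in> S" for i
    using that eqi[of i] by (simp add: diag_on_nth X_def scaleR_matrix_nth del: vector_scaleR_component)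
  then have "x i * x i = sqnorm R * x i" if "i \<in> S" for i using that by (simp only: of_real_eq_iff)
  then have x01: "x i = 0 \<or> x i = sqnorm R" if "i \<in> S" for i using that by force
  have "(\<Prod>i\<in>S. 1 + x i) = 1 + sqnorm R"
  proof (cases "sqnorm R = 0")
    case True
    then show ?thesis using x01 by (auto intro!: prod.neutral)
  next
    case False
    define Z where "Z = {i \<in> S. x i = sqnorm R}"
    have "(\<Sum>i\<in>S. x i) = (\<Sum>i\<in>S. if i \<in> Z then sqnorm R else 0)"
      using x01 by (intro sum.cong) (auto simp: Z_def)
    also have "\<dots> = real (card Z) * sqnorm R" by (simp add: sum.If_cases Z_def Int_def)
    finally have "card Z = 1" using sumx False by simp
    moreover have "(\<Prod>i\<in>S. 1 + x i) = (\<Prod>i\<in>S. if i \<in> Z then 1 + sqnorm R else 1)"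
      using x01 by (intro prod.cong) (auto simp: Z_def)
    moreover have "\<dots> = (1 + sqnorm R) ^ card Z" by (simp add: prod.If_cases Z_def Int_def)
    ultimately show ?thesis by simp
  qed
  then show ?thesis by (simp add: x_def)
qed

end

section \<open>Fubini and volume for blocks of Hermitian matrices\<close>

lemma borel_measurable_herm_integral [measurable (raw)]:
  fixes J :: "('n::finite \<times> 'n) set"
  assumes J: "sym J" and F[measurable]: "case_prod F \<in> borel_measurable (M \<Otimes>\<^sub>M borel)"
  shows "(\<lambda>x. herm_integral J (F x)) \<in> borel_measurable M"
proof -
  interpret sigma_finite_measure "lborel_on J" by (rule sigma_finite_lborel_on) simp
  note borel_measurable_herm[OF J, measurable]
  have "(\<lambda>(x, X). case_prod F (x, herm J X)) \<in> borel_measurable (M \<Otimes>\<^sub>M lborel_on J)" by measurable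
  then show ?thesis unfolding herm_integral_def by (intro borel_measurable_nn_integral) simp
qed

lemma herm_integral_cmult:
  assumes J: "sym J" and F[measurable]: "F \<in> borel_measurable borel"
  shows "herm_integral J (\<lambda>H. c * F H) = c * herm_integral J F"
  unfolding herm_integral_def by (intro nn_integral_cmult measurable_compose[OF borel_measurable_herm[OF J] F])

lemma herm_integral_multc:
  assumes J: "sym J" and F[measurable]: "F \<in> borel_measurable borel"
  shows "herm_integral J (\<lambda>H. F H * c) = herm_integral J F * c"
  unfolding herm_integral_def by (intro nn_integral_multc measurable_compose[OF borel_measurable_herm[OF J] F])

lemma herm_integral_Fubini:
  fixes J :: "('n::finite \<times> 'n) set" and F :: "complex^'n^'n \<Rightarrow> real \<Rightarrow> ennreal"
  assumes J: "sym J" and F[measurable]: "case_prod F \<in> borel_measurable (borel \<Otimes>\<^sub>M borel)"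
  shows "herm_integral J (\<lambda>H. \<integral>\<^sup>+ l. F H l \<partial>lborel) = (\<integral>\<^sup>+ l. herm_integral J (\<lambda>H. F H l) \<partial>lborel)"
proof -
  interpret pair_sigma_finite "lborel :: real measure" "lborel_on J"
    by (simp add: pair_sigma_finite_def sigma_finite_lborel_on sigma_finite_lborel)
  note borel_measurable_herm[OF J, measurable]
  have "(\<lambda>(l, X). case_prod F (herm J X, l)) \<in> borel_measurable (lborel \<Otimes>\<^sub>M lborel_on J)" by measurable
  then show ?thesis unfolding herm_integral_def by (intro Fubini') simp
qed

lemma herm_integral_swap:
  fixes J K :: "('n::finite \<times> 'n) set" and F :: "complex^'n^'n \<Rightarrow> complex^'n^'n \<Rightarrow> ennreal"
  assumes J: "sym J" "sym K" and F[measurable]: "case_prod F \<in> borel_measurable (borel \<Otimes>\<^sub>M borel)"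
  shows "herm_integral J (\<lambda>H. herm_integral K (F H)) = herm_integral K (\<lambda>N. herm_integral J (\<lambda>H. F H N))"
proof -
  interpret pair_sigma_finite "lborel_on K" "lborel_on J"
    by (simp add: pair_sigma_finite_def sigma_finite_lborel_on)
  note borel_measurable_herm[OF J(1), measurable] borel_measurable_herm[OF J(2), measurable]
  have "(\<lambda>(Y, X). case_prod F (herm J X, herm K Y)) \<in> borel_measurable (lborel_on K \<Otimes>\<^sub>M lborel_on J)" by measurable
  then show ?thesis unfolding herm_integral_def by (intro Fubini') simp
qed

lemma herm_integral_Un:
  fixes J K :: "('n::finite \<times> 'n) set"
  assumes J: "sym J" "sym K" "J \<inter> K = {}" and F[measurable]: "F \<in> borel_measurable borel"
  shows "herm_integral (J \<union> K) F = herm_integral J (\<lambda>H. herm_integral K (\<lambda>N. F (H + N)))"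
proof -
  have JK: "sym (J \<union> K)" using J by (auto simp: sym_def)
  have "herm (J \<union> K) (merge J K (X, Y)) = herm J X + herm K Y" for X Y
  proof -
    have "herm (J \<union> K) (merge J K (X, Y)) $ i $ j = (herm J X + herm K Y) $ i $ j" for i j
      using J symD[OF J(1), of i j] symD[OF J(2), of i j] symD[OF J(1), of j i] symD[OF J(2), of j i]
      by (auto simp: herm_def merge_def)
    then show ?thesis by (simp add: vec_eq_iff)
  qed
  moreover have "(\<lambda>Z. F (herm (J \<union> K) Z)) \<in> borel_measurable (lborel_on (J \<union> K))"
    using borel_measurable_herm[OF JK] by measurable
  ultimately show ?thesis
    unfolding herm_integral_def by (simp add: lborel_on.product_nn_integral_fold[OF J(3)])
qed

lemma herm_integral_singleton:
  fixes b :: "'n::finite"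
  assumes F[measurable]: "F \<in> borel_measurable borel"
  shows "herm_integral {(b, b)} F = (\<integral>\<^sup>+ a. F (a *\<^sub>R unit_at b) \<partial>lborel)"
proof -
  have "herm {(b, b)} X = X (b, b) *\<^sub>R unit_at b" for X
    by (auto simp: vec_eq_iff herm_def diag_on_nth complex_eq_iff)
  moreover have "(\<lambda>a. F (a *\<^sub>R unit_at b)) \<in> borel_measurable lborel" by measurable
  ultimately show ?thesis
    unfolding herm_integral_def using lborel_on.product_nn_integral_singleton[of "\<lambda>a. F (a *\<^sub>R unit_at b)" "(b, b)"] by simp
qed

definition cross :: "'n \<Rightarrow> 'n set \<Rightarrow> ('n \<times> 'n) set" where
  "cross b S = {b} \<times> S \<union> S \<times> {b}"

lemma sym_cross [simp]: "sym (cross b S)"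
  by (auto simp: cross_def sym_def)

lemma sym_square [simp]: "sym (S \<times> S)"
  by (auto simp: sym_def)

lemma herm_integral_bordered:
  fixes b :: "'n::finite"
  assumes b: "b \<notin> S" and F[measurable]: "F \<in> borel_measurable borel"
  shows "herm_integral (insert b S \<times> insert b S) F =
    herm_integral (S \<times> S) (\<lambda>H. herm_integral (cross b S) (\<lambda>N. \<integral>\<^sup>+ a. F (H + N + a *\<^sub>R unit_at b) \<partial>lborel))"
proof -
  have eq: "insert b S \<times> insert b S = (S \<times> S) \<union> (cross b S \<union> {(b, b)})" by (auto simp: cross_def)
  have s: "sym {(b, b)}" "sym (cross b S \<union> {(b, b)})" by (auto simp: sym_def cross_def)
  have d: "(S \<times> S) \<inter> (cross b S \<union> {(b, b)}) = {}" "cross b S \<inter> {(b, b)} = {}" using b by (auto simp: cross_def)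
  have e1: "herm_integral (insert b S \<times> insert b S) F = herm_integral (S \<times> S) (\<lambda>H. herm_integral (cross b S \<union> {(b, b)}) (\<lambda>N. F (H + N)))"
    unfolding eq by (rule herm_integral_Un) (use s d in auto)
  have e2: "herm_integral (cross b S \<union> {(b, b)}) (\<lambda>N. F (H + N)) =
     herm_integral (cross b S) (\<lambda>N. herm_integral {(b, b)} (\<lambda>K. F (H + (N + K))))" for H
    by (rule herm_integral_Un) (use s d in auto)
  have e3: "herm_integral {(b, b)} (\<lambda>K. F (H + (N + K))) = (\<integral>\<^sup>+ a. F (H + N + a *\<^sub>R unit_at b) \<partial>lborel)" for H N
    by (subst herm_integral_singleton) (simp_all add: add.assoc)
  show ?thesis unfolding e1 e2 e3 ..
qed

lemma herm_integral_reflect: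
  fixes S :: "('n::finite) set"
  assumes F[measurable]: "F \<in> borel_measurable borel"
  shows "herm_integral (S \<times> S) (\<lambda>H. F (l *\<^sub>R one_on S - H)) = herm_integral (S \<times> S) F"
proof -
  define a where "a p = (if fst p = snd p then l else 0)" for p :: "'n \<times> 'n"
  have e: "herm (S \<times> S) (\<lambda>p\<in>S \<times> S. a p + (- 1) * X p) = l *\<^sub>R one_on S - herm (S \<times> S) X" for X
  proof -
    have "herm (S \<times> S) (\<lambda>p\<in>S \<times> S. a p + (- 1) * X p) $ i $ j = (l *\<^sub>R one_on S - herm (S \<times> S) X) $ i $ j" for i j
      by (auto simp: herm_def a_def complex_eq_iff diag_on_nth field_simps)
    then show ?thesis by (simp add: vec_eq_iff)
  qed
  have m: "(\<lambda>X. F (herm (S \<times> S) X)) \<in> borel_measurable (lborel_on (S \<times> S))"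
    using borel_measurable_herm[OF sym_square] by measurable
  have "(\<integral>\<^sup>+ X. F (herm (S \<times> S) (\<lambda>p\<in>S \<times> S. a p + (- 1) * X p)) \<partial>lborel_on (S \<times> S)) = (\<integral>\<^sup>+ X. F (herm (S \<times> S) X) \<partial>lborel_on (S \<times> S))"
    using nn_integral_lborel_on_affine[OF _ _ m, of "\<lambda>_. - 1" a] by simp
  then show ?thesis unfolding herm_integral_def e .
qed

lemma diag_on_cong: "(\<And>i. i \<in> S \<Longrightarrow> d i = e i) \<Longrightarrow> diag_on S d = diag_on S e"
  by (auto simp: vec_eq_iff diag_on_nth)

text \<open>Cramer's rule, an explicit formula in the entries from which measurability is immediate.
  It is the inverse where the determinant is nonzero.\<close>

definition minv :: "complex^'n^'n \<Rightarrow> complex^'n^'n" where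
  "minv A = (\<chi> i j. det (\<chi> k m. if m = i then axis j 1 $ k else A $ k $ m) / det A)"

lemma borel_measurable_det [measurable (raw)]:
  fixes f :: "'a \<Rightarrow> complex^'n^'n"
  assumes [measurable]: "f \<in> borel_measurable M"
  shows "(\<lambda>x. det (f x)) \<in> borel_measurable M"
  unfolding det_def by measurable

lemma borel_measurable_minv [measurable (raw)]:
  fixes f :: "'a \<Rightarrow> complex^'n^'n"
  assumes [measurable]: "f \<in> borel_measurable M"
  shows "(\<lambda>x. minv (f x)) \<in> borel_measurable M"
proof (rule borel_measurable_matrixI)
  fix i j
  have "(\<lambda>x. (\<chi> k m. if m = i then axis j 1 $ k else f x $ k $ m) :: complex^'n^'n) \<in> borel_measurable M"
  proof (rule borel_measurable_matrixI)
    fix k m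
    show "(\<lambda>x. (\<chi> k m. if m = i then axis j 1 $ k else f x $ k $ m) $ k $ m) \<in> borel_measurable M"
      by (cases "m = i") simp_all
  qed
  then show "(\<lambda>x. minv (f x) $ i $ j) \<in> borel_measurable M" by (simp add: minv_def)
qed

lemma minv_right:
  assumes "det A \<noteq> 0"
  shows "A ** minv A = mat 1"
proof -
  have "A *v (\<chi> i. minv A $ i $ j) = axis j 1" for j
    by (subst cramer[OF assms]) (simp add: minv_def)
  then have "(A *v (\<chi> i. minv A $ i $ j)) $ i = axis j 1 $ i" for i j by simp
  then show ?thesis
    by (simp add: vec_eq_iff matrix_matrix_mult_def matrix_vector_mult_def mat_def axis_def)
qed

text \<open>The inverse of \<open>l - H\<close> on the block \<open>S\<close>; the unit matrix added
  on the complement makes the padded matrix invertible whenever the block is.\<close>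

definition resolvent :: "'n set \<Rightarrow> real \<Rightarrow> complex^'n^'n \<Rightarrow> complex^'n^'n" where
  "resolvent S l H = one_on S ** minv (l *\<^sub>R one_on S - H + one_on (- S)) ** one_on S"

lemma resolvent_eq:
  assumes d: "diagonalizes S H U \<mu>" and l: "\<And>i. i \<in> S \<Longrightarrow> \<mu> i < l"
  shows "resolvent S l H = U ** diag_on S (\<lambda>i. of_real (1 / (l - \<mu> i))) ** adjoint_matrix U"
    and "diagonalizes S (l *\<^sub>R one_on S - H) U (\<lambda>i. l - \<mu> i)"
proof -
  have U: "unitary_on S U" "supported S U" "U ** adjoint_matrix U = one_on S" "adjoint_matrix U ** U = one_on S"
    and H: "H = U ** diag_on S (\<lambda>i. of_real (\<mu> i)) ** adjoint_matrix U"
    using d by (auto simp: diagonalizes_def unitary_on_def)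
  have "diag_on S (\<lambda>i. complex_of_real (l - \<mu> i)) = l *\<^sub>R one_on S - diag_on S (\<lambda>i. of_real (\<mu> i))"
    by (auto simp: vec_eq_iff diag_on_nth scaleR_matrix_nth simp del: vector_scaleR_component)
  then have P: "U ** diag_on S (\<lambda>i. of_real (l - \<mu> i)) ** adjoint_matrix U = l *\<^sub>R one_on S - H"
    unfolding H using U by (simp add: matrix_ring mult_one_on)
  then show "diagonalizes S (l *\<^sub>R one_on S - H) U (\<lambda>i. l - \<mu> i)"
    using U by (simp add: diagonalizes_def)
  define I where "I = U ** diag_on S (\<lambda>i. complex_of_real (1 / (l - \<mu> i))) ** adjoint_matrix U"
  define P where "P = l *\<^sub>R one_on S - H"
  have Is: "supported S I" unfolding I_def using U by (intro supported_mult supported_adjoint_matrix) auto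
  have Ps: "supported S P" unfolding P_def P[symmetric] using U by (intro supported_mult supported_adjoint_matrix) auto
  have PI: "P ** I = one_on S"
  proof -
    have "P ** I = U ** diag_on S (\<lambda>i. of_real (l - \<mu> i) * of_real (1 / (l - \<mu> i))) ** adjoint_matrix U"
      unfolding P_def P[symmetric] I_def by (rule unitary_conj_mult[OF U(1)])
    also have "diag_on S (\<lambda>i. complex_of_real (l - \<mu> i) * of_real (1 / (l - \<mu> i))) = one_on S"
    proof -
      have "complex_of_real (l - \<mu> i) * of_real (1 / (l - \<mu> i)) = 1" if "i \<in> S" for i
        unfolding of_real_mult[symmetric] using l[OF that] by simp
      then show ?thesis by (rule diag_on_cong)
    qed
    finally show ?thesis using U by (simp add: mult_one_on)
  qed
  have one: "one_on S + one_on (- S) = mat 1" by (auto simp: vec_eq_iff diag_on_nth mat_def)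
  have R: "(P + one_on (- S)) ** (I + one_on (- S)) = mat 1"
    using supported_compl[OF Is] supported_compl[OF Ps] by (simp add: matrix_ring PI diag_on_mult_diag_on one)
  then have L: "(I + one_on (- S)) ** (P + one_on (- S)) = mat 1" by (simp add: matrix_left_right_inverse)
  have "det (P + one_on (- S)) * det (I + one_on (- S)) = 1" using R by (metis det_I det_mul)
  then have "det (P + one_on (- S)) \<noteq> 0" by auto
  from minv_right[OF this] have "(I + one_on (- S)) ** (P + one_on (- S)) ** minv (P + one_on (- S)) = I + one_on (- S)"
    by (simp add: matrix_mul_assoc[symmetric])
  then have "minv (P + one_on (- S)) = I + one_on (- S)" unfolding L by simp
  then show "resolvent S l H = I"
    unfolding resolvent_def P_def[symmetric]
    using supported_compl[OF Is] by (simp add: matrix_ring one_on_mult[OF Is] mult_one_on[OF Is] supported_compl[OF supported_diag_on])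
qed

lemma borel_measurable_sqnorm [measurable (raw)]:
  assumes [measurable]: "f \<in> borel_measurable M"
  shows "(\<lambda>x. sqnorm (f x)) \<in> borel_measurable M"
  unfolding sqnorm_def trace_def by measurable

lemma borel_measurable_resolvent [measurable (raw)]:
  assumes [measurable]: "f \<in> borel_measurable M" "g \<in> borel_measurable M"
  shows "(\<lambda>x. resolvent S (f x) (g x)) \<in> borel_measurable M"
  unfolding resolvent_def by measurable

lemma adjoint_diag_mult_nth:
  "(adjoint_matrix W ** diag_on S (\<lambda>i. of_real (d i)) ** W) $ j $ j = of_real (\<Sum>i\<in>S. d i * (cmod (W $ i $ j))\<^sup>2)"
proof -
  have "(adjoint_matrix W ** (diag_on S (\<lambda>i. of_real (d i)) ** W)) $ j $ j =
      (\<Sum>i\<in>UNIV. if i \<in> S then of_real (d i) * (W $ i $ j * cnj (W $ i $ j)) else 0)"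
    unfolding matrix_matrix_mult_def[of "adjoint_matrix W"] by (auto simp: diag_on_mult_nth mult_ac intro!: sum.cong)
  also have "\<dots> = (\<Sum>i\<in>S. of_real (d i) * (W $ i $ j * cnj (W $ i $ j)))" by (simp add: sum.If_cases)
  also have "\<dots> = of_real (\<Sum>i\<in>S. d i * (cmod (W $ i $ j))\<^sup>2)"
    by (simp only: complex_norm_square[symmetric] of_real_mult of_real_sum)
  finally show ?thesis by (simp only: matrix_mul_assoc)
qed

lemma cross_decomposition:
  assumes b: "b \<notin> S" and N: "hermitian N" "zero_outside (cross b S) N"
  shows "column_matrix b S (N ** unit_at b)" and "N = N ** unit_at b + adjoint_matrix (N ** unit_at b)"
proof -
  have Nb: "(N ** unit_at b) $ i $ j = (if j = b then N $ i $ b else 0)" for i j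
    by (auto simp: mult_diag_on_nth)
  show "column_matrix b S (N ** unit_at b)"
    using N(2) b by unfold_locales (auto simp: column_at_def Nb zero_outside_def cross_def)
  have "N $ i $ j = (N ** unit_at b + adjoint_matrix (N ** unit_at b)) $ i $ j" for i j
  proof -
    have h: "N $ b $ j = cnj (N $ j $ b)" for j using N(1) unfolding hermitian_def by blast
    have z: "(i, j) \<notin> cross b S \<Longrightarrow> N $ i $ j = 0" for i j using N(2) by (simp add: zero_outside_def)
    show ?thesis
      using z[of b b] z[of i j] b h[of j] by (cases "i = b"; cases "j = b") (simp_all add: Nb cross_def)
  qed
  then show "N = N ** unit_at b + adjoint_matrix (N ** unit_at b)" by (simp add: vec_eq_iff)
qed

lemma compatible_cross:
  assumes "supported S A" "b \<notin> S"
  shows "compatible (cross b S) (A + unit_at b)"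
proof -
  have nz: "i = b \<and> k = b \<or> i \<in> S \<and> k \<in> S" if "(A + unit_at b) $ i $ k \<noteq> 0" for i k
    using that assms by (cases "i \<in> S \<and> k \<in> S") (auto simp: supported_def diag_on_nth split: if_splits)
  show ?thesis
    unfolding compatible_def
  proof (intro allI impI)
    fix i j k l
    assume h: "(k, l) \<in> cross b S" "(A + unit_at b) $ i $ k \<noteq> 0" "(A + unit_at b) $ j $ l \<noteq> 0"
    from nz[OF h(2)] nz[OF h(3)] h(1) assms(2) show "(i, j) \<in> cross b S" by (auto simp: cross_def)
  qed
qed

lemma cross_subset: "cross b S \<subseteq> insert b S \<times> insert b S"
  by (auto simp: cross_def)

lemma compatible_square: "supported S A \<Longrightarrow> compatible (S \<times> S) A"
  unfolding compatible_def supported_def by blast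

lemma zero_outside_square: "zero_outside (S \<times> S) H \<longleftrightarrow> supported S H"
  by (auto simp: zero_outside_def supported_def)

lemma supported_mult_unit_at:
  assumes "supported S A" "b \<notin> S"
  shows "A ** unit_at b = 0" "unit_at b ** A = 0"
  using assms by (auto intro!: mult_diag_on_zero diag_on_mult_zero simp: supported_def)

context column_matrix begin

lemma supported_mult_adjoint:
  assumes "supported S A"
  shows "A ** adjoint_matrix R = 0" "R ** A = 0"
proof -
  show "A ** adjoint_matrix R = 0"
  proof (rule matrix_mult_zeroI)
    fix i j k
    show "A $ i $ k = 0 \<or> adjoint_matrix R $ k $ j = 0"
      using assms R b by (cases "k = b") (auto simp: supported_def column_at_def)
  qed
  show "R ** A = 0"
  proof (rule matrix_mult_zeroI)
    fix i j k
    show "R $ i $ k = 0 \<or> A $ k $ j = 0"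
      using assms R b by (cases "k = b") (auto simp: supported_def column_at_def)
  qed
qed

lemma mconj_cross:
  assumes A: "supported S A"
  shows "mconj (A + unit_at b) (R + adjoint_matrix R) = A ** R + adjoint_matrix (A ** R)"
proof -
  have "R ** adjoint_matrix A = 0" using supported_mult_adjoint(2)[OF supported_adjoint_matrix[OF A]] .
  moreover have "A ** R ** adjoint_matrix A = 0" using calculation by (simp add: matrix_mul_assoc[symmetric])
  moreover have "A ** R ** unit_at b = A ** R" by (simp add: matrix_mul_assoc[symmetric] R_unit)
  ultimately show ?thesis
    by (simp add: mconj_def matrix_ring supported_mult_adjoint[OF A] unit_R unit_adj adj_unit)
qed

lemma column_matrix_mult: "supported S A \<Longrightarrow> column_matrix b S (A ** R)"
  using R b by unfold_locales (auto simp: column_at_def matrix_matrix_mult_def supported_def intro!: sum.neutral)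

lemma cross_sum: "hermitian (R + adjoint_matrix R)" "zero_outside (cross b S) (R + adjoint_matrix R)"
  "(R + adjoint_matrix R) ** unit_at b = R"
proof -
  show "hermitian (R + adjoint_matrix R)" by (simp add: hermitian_iff_adjoint_matrix adjoint_matrix_add add.commute)
  show "zero_outside (cross b S) (R + adjoint_matrix R)"
    using R b unfolding zero_outside_def cross_def column_at_def by auto
  show "(R + adjoint_matrix R) ** unit_at b = R" by (simp add: matrix_ring R_unit adj_unit)
qed

text \<open>In an eigenbasis of \<open>H\<close> the border column has the squared coefficients
  \<open>q i\<close>. The second sum is subtracted from \<open>l\<close> in the secular equation,
  and the first is minus its derivative in \<open>l\<close>. Hence the Jacobian of the corner
  substitution is 1 plus a squared norm.\<close>

lemma resolvent_column:
  assumes d: "diagonalizes S H U \<mu>" and l: "\<And>i. i \<in> S \<Longrightarrow> \<mu> i < l"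
  defines "q \<equiv> \<lambda>i. (cmod ((adjoint_matrix U ** R) $ i $ b))\<^sup>2"
  shows "sqnorm (resolvent S l H ** R) = (\<Sum>i\<in>S. q i / (l - \<mu> i)\<^sup>2)"
    and "Re (((R + adjoint_matrix R) ** resolvent S l H ** (R + adjoint_matrix R)) $ b $ b) = (\<Sum>i\<in>S. q i / (l - \<mu> i))"
proof -
  define W where "W = adjoint_matrix U ** R"
  define G where "G = resolvent S l H"
  have U: "unitary_on S U" using d by (simp add: diagonalizes_def)
  have G: "G = U ** diag_on S (\<lambda>i. of_real (1 / (l - \<mu> i))) ** adjoint_matrix U"
    unfolding G_def by (rule resolvent_eq(1)[OF d l])
  have Gs: "supported S G" unfolding G using U by (intro supported_mult supported_adjoint_matrix) (auto simp: unitary_on_def)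
  have Ga: "adjoint_matrix G = G" unfolding G by (simp add: matrix_ring)
  have "adjoint_matrix (G ** R) ** (G ** R) = adjoint_matrix R ** (G ** G) ** R" by (simp add: matrix_ring Ga)
  also have "G ** G = U ** diag_on S (\<lambda>i. of_real (1 / (l - \<mu> i)) * of_real (1 / (l - \<mu> i))) ** adjoint_matrix U"
    unfolding G by (rule unitary_conj_mult[OF U])
  also have "diag_on S (\<lambda>i. of_real (1 / (l - \<mu> i)) * of_real (1 / (l - \<mu> i))) = diag_on S (\<lambda>i. complex_of_real (1 / (l - \<mu> i)\<^sup>2))"
    by (rule diag_on_cong) (simp add: power2_eq_square)
  finally have GRGR: "adjoint_matrix (G ** R) ** (G ** R) = adjoint_matrix W ** diag_on S (\<lambda>i. of_real (1 / (l - \<mu> i)\<^sup>2)) ** W"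
    by (simp add: W_def matrix_ring)
  have Wj: "W $ i $ j = 0" if "j \<noteq> b" for i j
    using R that by (auto simp: W_def matrix_matrix_mult_def column_at_def intro!: sum.neutral)
  have "trace (adjoint_matrix (G ** R) ** (G ** R)) = (\<Sum>j\<in>UNIV. if j = b then of_real (\<Sum>i\<in>S. 1 / (l - \<mu> i)\<^sup>2 * (cmod (W $ i $ b))\<^sup>2) else 0)"
    unfolding GRGR trace_def adjoint_diag_mult_nth by (intro sum.cong) (auto simp: Wj)
  also have "\<dots> = of_real (\<Sum>i\<in>S. 1 / (l - \<mu> i)\<^sup>2 * (cmod (W $ i $ b))\<^sup>2)" by simp
  finally show "sqnorm (resolvent S l H ** R) = (\<Sum>i\<in>S. q i / (l - \<mu> i)\<^sup>2)"
    unfolding sqnorm_def G_def[symmetric] q_def W_def[symmetric] by simp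
  have "(R + adjoint_matrix R) ** G ** (R + adjoint_matrix R) = adjoint_matrix R ** G ** R"
  proof -
    have "adjoint_matrix R ** G ** adjoint_matrix R = 0"
      by (simp add: matrix_mul_assoc[symmetric] supported_mult_adjoint[OF Gs])
    then show ?thesis by (simp add: matrix_ring supported_mult_adjoint[OF Gs])
  qed
  also have "\<dots> = adjoint_matrix W ** diag_on S (\<lambda>i. of_real (1 / (l - \<mu> i))) ** W"
    unfolding G W_def by (simp add: matrix_ring)
  finally show "Re (((R + adjoint_matrix R) ** resolvent S l H ** (R + adjoint_matrix R)) $ b $ b) = (\<Sum>i\<in>S. q i / (l - \<mu> i))"
    unfolding G_def[symmetric] q_def W_def[symmetric] by (simp only: adjoint_diag_mult_nth) simp
qed

end

text \<open>On the cross this conjugation sends the border column \<open>v\<close> to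
  \<open>P v\<close>. As a real map that has determinant \<open>|det P|^2\<close>: each eigenvalue
  acts once at the position \<open>(b, i)\<close> and once at \<open>(i, b)\<close>.\<close>

lemma conj_scale_cross:
  fixes b :: "'n::finite"
  assumes b: "b \<notin> S" and d: "diagonalizes S P U \<kappa>" and \<kappa>: "\<And>i. i \<in> S \<Longrightarrow> \<kappa> i \<noteq> 0"
  shows "conj_scale (cross b S) (P + unit_at b) (ennreal (\<Prod>i\<in>S. (\<kappa> i)\<^sup>2))"
proof -
  let ?\<kappa> = "\<lambda>i. if i = b then 1 else \<kappa> i"
  have U: "supported S U" "supported S (adjoint_matrix U)" "U ** adjoint_matrix U = one_on S" "adjoint_matrix U ** U = one_on S"
    and P: "P = U ** diag_on S (\<lambda>i. of_real (\<kappa> i)) ** adjoint_matrix U"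
    using d by (auto simp: diagonalizes_def unitary_on_def supported_adjoint_matrix)
  note z = supported_mult_unit_at[OF U(1) b] supported_mult_unit_at[OF U(2) b]
  have s: "supported (insert b S) (U + unit_at b)" using U(1) by (auto simp: supported_def diag_on_nth)
  have U1: "unitary_on (insert b S) (U + unit_at b)"
    unfolding unitary_on_def using s U by (simp add: matrix_ring z diag_on_mult_diag_on one_on_insert[OF b] add.commute)
  have comp: "compatible (cross b S) (U + unit_at b)" "compatible (cross b S) (adjoint_matrix (U + unit_at b))"
    using compatible_cross[OF U(1) b] compatible_cross[OF U(2) b] by (simp_all add: matrix_ring)
  have D: "diag_on (insert b S) (\<lambda>i. complex_of_real (?\<kappa> i)) = diag_on S (\<lambda>i. of_real (\<kappa> i)) + unit_at b"
    using b by (auto simp: vec_eq_iff diag_on_nth)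
  have z2: "unit_at b ** diag_on S (\<lambda>i. complex_of_real (\<kappa> i)) = 0" "diag_on S (\<lambda>i. complex_of_real (\<kappa> i)) ** unit_at b = 0"
    using supported_mult_unit_at[OF supported_diag_on b] by auto
  have z3: "U ** diag_on S (\<lambda>i. complex_of_real (\<kappa> i)) ** unit_at b = 0"
    using z2 by (simp add: matrix_mul_assoc[symmetric])
  have e: "(U + unit_at b) ** diag_on (insert b S) (\<lambda>i. of_real (?\<kappa> i)) ** adjoint_matrix (U + unit_at b) = P + unit_at b"
    unfolding D P by (simp add: matrix_ring z z2 z3 diag_on_mult_diag_on)
  have "(\<Prod>p\<in>cross b S. \<bar>?\<kappa> (fst p) * ?\<kappa> (snd p)\<bar>) = (\<Prod>p\<in>{b} \<times> S. \<bar>?\<kappa> (fst p) * ?\<kappa> (snd p)\<bar>) * (\<Prod>p\<in>S \<times> {b}. \<bar>?\<kappa> (fst p) * ?\<kappa> (snd p)\<bar>)"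
    unfolding cross_def by (rule prod.union_disjoint) (use b in auto)
  also have "(\<Prod>p\<in>{b} \<times> S. \<bar>?\<kappa> (fst p) * ?\<kappa> (snd p)\<bar>) = (\<Prod>i\<in>S. \<bar>\<kappa> i\<bar>)"
    by (rule prod.reindex_bij_witness[of _ "\<lambda>i. (b, i)" snd]) (use b in auto)
  also have "(\<Prod>p\<in>S \<times> {b}. \<bar>?\<kappa> (fst p) * ?\<kappa> (snd p)\<bar>) = (\<Prod>i\<in>S. \<bar>\<kappa> i\<bar>)"
    by (rule prod.reindex_bij_witness[of _ "\<lambda>i. (i, b)" fst]) (use b in auto)
  also have "(\<Prod>i\<in>S. \<bar>\<kappa> i\<bar>) * (\<Prod>i\<in>S. \<bar>\<kappa> i\<bar>) = (\<Prod>i\<in>S. (\<kappa> i)\<^sup>2)"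
    by (simp add: prod.distrib[symmetric] power2_eq_square abs_mult_self_eq)
  finally have p: "(\<Prod>p\<in>cross b S. \<bar>?\<kappa> (fst p) * ?\<kappa> (snd p)\<bar>) = (\<Prod>i\<in>S. (\<kappa> i)\<^sup>2)" .
  have "conj_scale (cross b S) ((U + unit_at b) ** diag_on (insert b S) (\<lambda>i. of_real (?\<kappa> i)) ** adjoint_matrix (U + unit_at b))
      (ennreal (\<Prod>p\<in>cross b S. \<bar>?\<kappa> (fst p) * ?\<kappa> (snd p)\<bar>))"
    by (rule conj_scale_unitary_diag[OF sym_cross cross_subset _ U1 comp]) (use \<kappa> in auto)
  then show ?thesis unfolding e p .
qed

text \<open>Conjugation by \<open>U\<close> turns the set into a coordinate hyperplane of measure 0,
  and any scale factor times 0 is 0. With \<open>t\<close> a top eigenvector it says that almost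
  every border column has a component along it.\<close>

lemma herm_integral_cross_null:
  fixes b :: "'n::finite"
  assumes b: "b \<notin> S" and U: "unitary_on S U" and t: "t \<in> S"
  shows "herm_integral (cross b S) (\<lambda>N. indicator {N. (adjoint_matrix U ** N) $ t $ b = 0} N) = 0"
proof -
  let ?Z = "{N. (adjoint_matrix U ** N) $ t $ b = 0}"
  have U': "supported S U" "supported S (adjoint_matrix U)" "U ** adjoint_matrix U = one_on S" "adjoint_matrix U ** U = one_on S"
    using U by (auto simp: unitary_on_def supported_adjoint_matrix)
  have m: "(\<lambda>N. indicator ?Z N :: ennreal) \<in> borel_measurable borel" by measurable
  have inv: "mconj (A + unit_at b) (mconj (B + unit_at b) N) = N"
    if "supported S A" "supported S B" "A ** B = one_on S" "hermitian N" "zero_outside (cross b S) N" for A B N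
  proof -
    have "(A + unit_at b) ** (B + unit_at b) = one_on (insert b S)"
      using supported_mult_unit_at[OF that(1) b] supported_mult_unit_at[OF that(2) b] that(3)
      by (simp add: matrix_ring diag_on_mult_diag_on one_on_insert[OF b] add.commute)
    then show ?thesis unfolding mconj_mult[symmetric] using mconj_one_on[OF cross_subset that(5)] by simp
  qed
  obtain c where c: "conj_scale (cross b S) (U + unit_at b) c"
    by (rule conj_scale_exists[OF sym_cross compatible_cross[OF U'(1) b] compatible_cross[OF U'(2) b]])
       (use inv U' in auto)
  have "herm_integral (cross b S) (\<lambda>N. indicator ?Z N) = c * herm_integral (cross b S) (\<lambda>N. indicator ?Z (mconj (U + unit_at b) N))"
    using c m unfolding conj_scale_def by blast
  also have "herm_integral (cross b S) (\<lambda>N. indicator ?Z (mconj (U + unit_at b) N)) = 0"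
  proof -
    have "indicator ?Z (mconj (U + unit_at b) N) = (indicator {N. N $ t $ b = 0} N :: ennreal)"
      if N: "hermitian N" "zero_outside (cross b S) N" for N
    proof -
      interpret column_matrix b S "N ** unit_at b" by (rule cross_decomposition(1)[OF b N])
      let ?R = "N ** unit_at b"
      have "mconj (U + unit_at b) N = U ** ?R + adjoint_matrix (U ** ?R)"
        using mconj_cross[OF U'(1)] cross_decomposition(2)[OF b N] by simp
      then have "adjoint_matrix U ** mconj (U + unit_at b) N = ?R + adjoint_matrix U ** adjoint_matrix ?R ** adjoint_matrix U"
        by (simp add: matrix_ring U'(4)) (simp add: matrix_mul_assoc[symmetric] one_R)
      also have "adjoint_matrix U ** adjoint_matrix ?R = 0" by (rule supported_mult_adjoint[OF U'(2)])
      finally have "adjoint_matrix U ** mconj (U + unit_at b) N = ?R" by simp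
      then show ?thesis by (simp add: mult_diag_on_nth indicator_def)
    qed
    then have "herm_integral (cross b S) (\<lambda>N. indicator ?Z (mconj (U + unit_at b) N)) = herm_integral (cross b S) (\<lambda>N. indicator {N. N $ t $ b = 0} N)"
      by (intro herm_integral_cong sym_cross) auto
    also have "\<dots> \<le> (\<integral>\<^sup>+ X. indicator (Pi\<^sub>E (cross b S) (\<lambda>p. if p = (t, b) then {0} else UNIV)) X \<partial>lborel_on (cross b S))"
      unfolding herm_integral_def
    proof (rule nn_integral_mono)
      fix X assume "X \<in> space (lborel_on (cross b S))"
      then have X: "X \<in> extensional (cross b S)" by (simp add: space_lborel_on)
      have tb: "(t, b) \<in> cross b S" using t by (simp add: cross_def)
      show "indicator {N. N $ t $ b = 0} (herm (cross b S) X) \<le> (indicator (Pi\<^sub>E (cross b S) (\<lambda>p. if p = (t, b) then {0} else UNIV)) X :: ennreal)"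
      proof (cases "herm (cross b S) X $ t $ b = 0")
        case True
        then have "X (t, b) = 0" using tb by (simp add: herm_def complex_eq_iff)
        then show ?thesis using X by (auto simp: indicator_def PiE_def)
      qed simp
    qed
    also have "\<dots> = emeasure (lborel_on (cross b S)) (Pi\<^sub>E (cross b S) (\<lambda>p. if p = (t, b) then {0} else UNIV))"
      by (intro nn_integral_indicator sets_PiM_I_finite) auto
    also have "\<dots> = (\<Prod>p\<in>cross b S. emeasure lborel (if p = (t, b) then {0} else UNIV :: real set))"
      by (rule lborel_on.emeasure_PiM) auto
    also have "\<dots> = 0"
      using t by (intro prod_zero bexI[of _ "(t, b)"]) (auto simp: cross_def)
    finally show ?thesis by simp
  qed
  finally show ?thesis by simp
qed

lemma diagonalizes_reflect:
  assumes "diagonalizes S H U \<mu>"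
  shows "diagonalizes S (l *\<^sub>R one_on S - H) U (\<lambda>i. l - \<mu> i)"
proof -
  have U: "unitary_on S U" "supported S U" "U ** adjoint_matrix U = one_on S"
    and H: "H = U ** diag_on S (\<lambda>i. of_real (\<mu> i)) ** adjoint_matrix U"
    using assms by (auto simp: diagonalizes_def unitary_on_def)
  have "diag_on S (\<lambda>i. complex_of_real (l - \<mu> i)) = l *\<^sub>R one_on S - diag_on S (\<lambda>i. of_real (\<mu> i))"
    by (auto simp: vec_eq_iff diag_on_nth scaleR_matrix_nth simp del: vector_scaleR_component)
  then have "U ** diag_on S (\<lambda>i. of_real (l - \<mu> i)) ** adjoint_matrix U = l *\<^sub>R one_on S - H"
    unfolding H using U by (simp add: matrix_ring mult_one_on)
  then show ?thesis using U by (simp add: diagonalizes_def)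
qed

text \<open>The bordered matrix in the variables \<open>l\<close>, \<open>P = l - H\<close> and
  \<open>u\<close>, the column of \<open>R\<close>: its block is \<open>l - P\<close>, its border
  column \<open>P u\<close> and its corner \<open>l - u^* P u\<close>.\<close>

definition bordered :: "'n \<Rightarrow> 'n set \<Rightarrow> real \<Rightarrow> complex^'n^'n \<Rightarrow> complex^'n^'n \<Rightarrow> complex^'n^'n" where
  "bordered b S l P R = l *\<^sub>R one_on (insert b S) - adjoint_matrix (one_on S - R) ** P ** (one_on S - R)"

lemma borel_measurable_bordered [measurable (raw)]:
  assumes [measurable]: "f \<in> borel_measurable M" "g \<in> borel_measurable M" "h \<in> borel_measurable M"
  shows "(\<lambda>x. bordered b S (f x) (g x) (h x)) \<in> borel_measurable M"
  unfolding bordered_def by measurable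

text \<open>The integrand after the substitution \<open>a = \<lambda> - v\<^sup>* (\<lambda> - H)\<^sup>-\<^sup>1 v\<close> for the corner entry \<open>a\<close>:
  here \<open>v\<close> is the column of \<open>N\<close>, and \<open>\<lambda>\<close> is the top eigenvalue of the bordered matrix.\<close>

definition secular :: "'n \<Rightarrow> 'n set \<Rightarrow> (complex^'n^'n \<Rightarrow> ennreal) \<Rightarrow> real \<Rightarrow> complex^'n^'n \<Rightarrow> complex^'n^'n \<Rightarrow> ennreal" where
  "secular b S F l H N = spec_prod S (\<lambda>y. if y < l then 1 else 0) H *
     (ennreal (1 + sqnorm (resolvent S l H ** (N ** unit_at b))) *
      F (H + N + (l - Re ((N ** resolvent S l H ** N) $ b $ b)) *\<^sub>R unit_at b))"

lemma borel_measurable_secular [measurable (raw)]: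
  assumes [measurable]: "F \<in> borel_measurable borel"
    "f \<in> borel_measurable M" "g \<in> borel_measurable M" "h \<in> borel_measurable M"
  shows "(\<lambda>x. secular b S F (f x) (g x) (h x)) \<in> borel_measurable M"
  unfolding secular_def by measurable

text \<open>For a fixed border this is the substitution in the secular equation. It requires
  positive weight at the largest pole, which fails only for a null set of borders.\<close>

lemma herm_integral_corner_substitution:
  fixes b :: "'n::finite"
  assumes b: "b \<notin> S" and F[measurable]: "F \<in> borel_measurable borel" and H: "H \<in> herm_on S"
  shows "herm_integral (cross b S) (\<lambda>N. \<integral>\<^sup>+ a. F (H + N + a *\<^sub>R unit_at b) \<partial>lborel) =
         herm_integral (cross b S) (\<lambda>N. \<integral>\<^sup>+ l. secular b S F l H N \<partial>lborel)"
proof -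
  obtain U \<mu> where d: "diagonalizes S H U \<mu>"
    using H diagonalizes_exists[of S H] by (auto simp: herm_on_def)
  have U: "unitary_on S U" using d by (simp add: diagonalizes_def)
  define q where "q N i = (cmod ((adjoint_matrix U ** (N ** unit_at b)) $ i $ b))\<^sup>2" for N i
  have main: "(\<integral>\<^sup>+ a. F (H + N + a *\<^sub>R unit_at b) \<partial>lborel) = (\<integral>\<^sup>+ l. secular b S F l H N \<partial>lborel)"
    if N: "hermitian N" "zero_outside (cross b S) N"
      and top: "S \<noteq> {} \<Longrightarrow> \<exists>t\<in>S. q N t > 0 \<and> (\<forall>i\<in>S. \<mu> i \<le> \<mu> t)" for N
  proof -
    interpret column_matrix b S "N ** unit_at b" by (rule cross_decomposition(1)[OF b N])
    have NR: "N = N ** unit_at b + adjoint_matrix (N ** unit_at b)" by (rule cross_decomposition(2)[OF b N])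
    have m: "(\<lambda>a. F (H + N + a *\<^sub>R unit_at b)) \<in> borel_measurable borel" by measurable
    have "(\<integral>\<^sup>+ a. F (H + N + a *\<^sub>R unit_at b) \<partial>lborel) =
      (\<integral>\<^sup>+ l. indicator {l. \<forall>i\<in>S. \<mu> i < l} l * ennreal (1 + (\<Sum>i\<in>S. q N i / (l - \<mu> i)\<^sup>2)) *
         F (H + N + (l - (\<Sum>i\<in>S. q N i / (l - \<mu> i))) *\<^sub>R unit_at b) \<partial>lborel)"
      by (rule nn_integral_secular_substitution[OF _ _ top m]) (auto simp: q_def)
    also have "\<dots> = (\<integral>\<^sup>+ l. secular b S F l H N \<partial>lborel)"
    proof (rule nn_integral_cong)
      fix l
      show "indicator {l. \<forall>i\<in>S. \<mu> i < l} l * ennreal (1 + (\<Sum>i\<in>S. q N i / (l - \<mu> i)\<^sup>2)) *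
         F (H + N + (l - (\<Sum>i\<in>S. q N i / (l - \<mu> i))) *\<^sub>R unit_at b) = secular b S F l H N"
      proof (cases "\<forall>i\<in>S. \<mu> i < l")
        case True
        then have l: "\<And>i. i \<in> S \<Longrightarrow> \<mu> i < l" by auto
        have "spec_prod S (\<lambda>y. if y < l then 1 else 0) H = 1"
          unfolding spec_prod_diagonalizes[OF d H] using l by (intro prod.neutral) auto
        moreover have "sqnorm (resolvent S l H ** (N ** unit_at b)) = (\<Sum>i\<in>S. q N i / (l - \<mu> i)\<^sup>2)"
          unfolding q_def by (rule resolvent_column(1)[OF d l])
        moreover have "Re ((N ** resolvent S l H ** N) $ b $ b) = (\<Sum>i\<in>S. q N i / (l - \<mu> i))"
          unfolding q_def using resolvent_column(2)[OF d l] NR by simp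
        ultimately show ?thesis using True by (simp add: secular_def)
      next
        case False
        then obtain i where "i \<in> S" "\<not> \<mu> i < l" by auto
        then have "spec_prod S (\<lambda>y. if y < l then 1 else 0) H = 0"
          unfolding spec_prod_diagonalizes[OF d H] by (intro prod_zero) auto
        then show ?thesis using False by (simp add: secular_def)
      qed
    qed
    finally show ?thesis .
  qed
  show ?thesis
  proof (cases "S = {}")
    case True
    then show ?thesis using main by (intro herm_integral_cong) auto
  next
    case False
    then have "Max (\<mu> ` S) \<in> \<mu> ` S" by (intro Max_in) auto
    then obtain t where t: "t \<in> S" "\<mu> t = Max (\<mu> ` S)" by auto
    then have tmax: "\<mu> i \<le> \<mu> t" if "i \<in> S" for i using that by simp
    let ?Z = "{N. (adjoint_matrix U ** N) $ t $ b = 0}"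
    note herm_m = borel_measurable_herm[OF sym_cross, of b S]
    have "(\<integral>\<^sup>+ X. indicator ?Z (herm (cross b S) X) \<partial>lborel_on (cross b S)) = 0"
      using herm_integral_cross_null[OF b U t(1)] by (simp add: herm_integral_def)
    moreover have "(\<lambda>X. indicator ?Z (herm (cross b S) X) :: ennreal) \<in> borel_measurable (lborel_on (cross b S))"
      by (rule measurable_compose[OF herm_m]) measurable
    ultimately have "AE X in lborel_on (cross b S). indicator ?Z (herm (cross b S) X) = (0 :: ennreal)"
      by (simp add: nn_integral_0_iff_AE)
    then have "AE X in lborel_on (cross b S). (\<integral>\<^sup>+ a. F (H + herm (cross b S) X + a *\<^sub>R unit_at b) \<partial>lborel) =
        (\<integral>\<^sup>+ l. secular b S F l H (herm (cross b S) X) \<partial>lborel)"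
    proof eventually_elim
      case (elim X)
      let ?N = "herm (cross b S) X"
      have N: "hermitian ?N" "zero_outside (cross b S) ?N" by (simp_all add: hermitian_herm zero_outside_herm)
      have "(adjoint_matrix U ** ?N) $ t $ b \<noteq> 0" using elim by (simp add: indicator_def split: if_splits)
      then have "q ?N t > 0" by (simp add: q_def matrix_mul_assoc mult_diag_on_nth)
      then show ?case using main[OF N] t(1) tmax by blast
    qed
    then show ?thesis unfolding herm_integral_def by (rule nn_integral_cong_AE)
  qed
qed

text \<open>The border column is replaced by \<open>v = P u\<close> with \<open>P = l - H\<close>.
  The scale factor is \<open>det P ^ 2\<close>, the resolvent applied to \<open>v\<close> becomes
  \<open>u\<close>, and the corner becomes \<open>l - u^* P u\<close>. The product over the spectrum
  of \<open>P\<close> encodes both \<open>P > 0\<close> and the squared determinant; if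
  \<open>l\<close> does not exceed the spectrum of \<open>H\<close>, both sides vanish.\<close>

lemma herm_integral_secular:
  fixes b :: "'n::finite"
  assumes b: "b \<notin> S" and F[measurable]: "F \<in> borel_measurable borel" and H: "H \<in> herm_on S"
  shows "herm_integral (cross b S) (secular b S F l H) =
    spec_prod S (\<lambda>y. if y > 0 then ennreal (y\<^sup>2) else 0) (l *\<^sub>R one_on S - H) *
    herm_integral (cross b S) (\<lambda>N. ennreal (1 + sqnorm (N ** unit_at b)) * F (bordered b S l (l *\<^sub>R one_on S - H) (N ** unit_at b)))"
proof -
  obtain U \<mu> where d: "diagonalizes S H U \<mu>"
    using H diagonalizes_exists[of S H] by (auto simp: herm_on_def)
  define P where "P = l *\<^sub>R one_on S - H"
  have dP: "diagonalizes S P U (\<lambda>i. l - \<mu> i)" unfolding P_def by (rule diagonalizes_reflect[OF d])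
  have PH: "P \<in> herm_on S" by (rule diagonalizes_herm_on[OF dP])
  have Ps: "supported S P" "adjoint_matrix P = P" using PH by (auto simp: herm_on_def hermitian_iff_adjoint_matrix)
  show ?thesis
  proof (cases "\<forall>i\<in>S. \<mu> i < l")
    case False
    then obtain i where "i \<in> S" "\<not> \<mu> i < l" by auto
    then have "spec_prod S (\<lambda>y. if y < l then 1 else 0) H = 0" "spec_prod S (\<lambda>y. if y > 0 then ennreal (y\<^sup>2) else 0) P = 0"
      unfolding spec_prod_diagonalizes[OF d H] spec_prod_diagonalizes[OF dP PH] by (auto intro!: prod_zero)
    then show ?thesis by (simp add: secular_def herm_integral_def P_def)
  next
    case True
    then have l: "\<And>i. i \<in> S \<Longrightarrow> \<mu> i < l" by auto
    have sp1: "spec_prod S (\<lambda>y. if y < l then 1 else 0) H = 1"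
      unfolding spec_prod_diagonalizes[OF d H] using l by (intro prod.neutral) auto
    have sp2: "spec_prod S (\<lambda>y. if y > 0 then ennreal (y\<^sup>2) else 0) P = ennreal (\<Prod>i\<in>S. (l - \<mu> i)\<^sup>2)"
    proof -
      have "spec_prod S (\<lambda>y. if y > 0 then ennreal (y\<^sup>2) else 0) P = (\<Prod>i\<in>S. ennreal ((l - \<mu> i)\<^sup>2))"
        unfolding spec_prod_diagonalizes[OF dP PH] using l by (intro prod.cong) auto
      then show ?thesis by (simp add: prod_ennreal)
    qed
    define G where "G = resolvent S l H"
    have G: "G = U ** diag_on S (\<lambda>i. of_real (1 / (l - \<mu> i))) ** adjoint_matrix U"
      unfolding G_def by (rule resolvent_eq(1)[OF d l])
    have U: "unitary_on S U" "supported S U" "U ** adjoint_matrix U = one_on S" using d by (auto simp: diagonalizes_def unitary_on_def)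
    have Gs: "supported S G" unfolding G using U by (intro supported_mult supported_adjoint_matrix) auto
    have GP: "G ** P = one_on S"
    proof -
      have "G ** P = U ** diag_on S (\<lambda>i. of_real (1 / (l - \<mu> i)) * of_real (l - \<mu> i)) ** adjoint_matrix U"
        using dP unfolding G diagonalizes_def by (simp only: unitary_conj_mult[OF U(1)])
      also have "diag_on S (\<lambda>i. complex_of_real (1 / (l - \<mu> i)) * of_real (l - \<mu> i)) = one_on S"
      proof (rule diag_on_cong)
        fix i assume "i \<in> S"
        then show "complex_of_real (1 / (l - \<mu> i)) * of_real (l - \<mu> i) = 1"
          unfolding of_real_mult[symmetric] using l[of i] by simp
      qed
      finally show ?thesis using U by (simp add: mult_one_on)
    qed
    have "(\<lambda>N. secular b S F l H N) \<in> borel_measurable borel" by measurable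
    moreover have "conj_scale (cross b S) (P + unit_at b) (ennreal (\<Prod>i\<in>S. (l - \<mu> i)\<^sup>2))"
      by (rule conj_scale_cross[OF b dP]) (use l in force)
    ultimately have "herm_integral (cross b S) (secular b S F l H) = ennreal (\<Prod>i\<in>S. (l - \<mu> i)\<^sup>2) *
        herm_integral (cross b S) (\<lambda>N. secular b S F l H (mconj (P + unit_at b) N))"
      unfolding conj_scale_def by blast
    also have "herm_integral (cross b S) (\<lambda>N. secular b S F l H (mconj (P + unit_at b) N)) =
        herm_integral (cross b S) (\<lambda>N. ennreal (1 + sqnorm (N ** unit_at b)) * F (bordered b S l P (N ** unit_at b)))"
    proof (rule herm_integral_cong[OF sym_cross])
      fix N :: "complex^'n^'n" assume N: "hermitian N" "zero_outside (cross b S) N"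
      define R where "R = N ** unit_at b"
      interpret column_matrix b S R unfolding R_def by (rule cross_decomposition(1)[OF b N])
      have NR: "N = R + adjoint_matrix R" unfolding R_def by (rule cross_decomposition(2)[OF b N])
      interpret PR: column_matrix b S "P ** R" by (rule column_matrix_mult[OF Ps(1)])
      define N' where "N' = P ** R + adjoint_matrix (P ** R)"
      have N': "mconj (P + unit_at b) N = N'" unfolding N'_def NR by (rule mconj_cross[OF Ps(1)])
      have GPR: "G ** (P ** R) = R" by (simp add: matrix_mul_assoc GP one_R)
      have N'b: "N' ** unit_at b = P ** R" unfolding N'_def by (rule PR.cross_sum(3))
      have NGN: "N' ** G ** N' = adjoint_matrix R ** P ** R"
      proof -
        have a: "P ** R ** G = 0" by (rule PR.supported_mult_adjoint(2)[OF Gs])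
        have "N' ** G = adjoint_matrix (P ** R) ** G" unfolding N'_def by (simp add: matrix_add_rdistrib a)
        then have "N' ** G ** N' = adjoint_matrix (P ** R) ** (G ** (P ** R)) + adjoint_matrix (P ** R) ** (G ** adjoint_matrix (P ** R))"
          unfolding N'_def by (simp add: matrix_add_ldistrib matrix_mul_assoc)
        also have "G ** adjoint_matrix (P ** R) = 0" by (rule PR.supported_mult_adjoint(1)[OF Gs])
        finally show ?thesis unfolding GPR by (simp add: adjoint_matrix_mult Ps(2))
      qed
      \<comment> \<open>The matrix is invariant under multiplication by \<open>unit_at b\<close> on
        both sides, so only its corner entry survives, and that entry is real because the matrix is
        Hermitian.\<close>
      have RPR: "adjoint_matrix R ** P ** R = Re ((adjoint_matrix R ** P ** R) $ b $ b) *\<^sub>R unit_at b"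
      proof -
        let ?K = "adjoint_matrix R ** P ** R"
        have h: "adjoint_matrix ?K = ?K" by (simp add: matrix_ring Ps(2))
        have "?K = unit_at b ** ?K ** unit_at b"
          by (simp add: matrix_mul_assoc unit_adj) (simp add: matrix_mul_assoc[symmetric] R_unit)
        then have z: "?K $ i $ j = (if i = b \<and> j = b then ?K $ b $ b else 0)" for i j
          by (metis diag_on_mult_nth mult_diag_on_nth mult_cancel_right1 mult_cancel_left1 singletonD singletonI)
        have "?K $ b $ b = cnj (?K $ b $ b)" using h by (metis adjoint_matrix_nth)
        then have "?K $ b $ b = of_real (Re (?K $ b $ b))" by (simp add: complex_eq_iff)
        then show ?thesis
          unfolding vec_eq_iff
        proof (intro allI)
          fix i j
          assume r: "?K $ b $ b = of_real (Re (?K $ b $ b))"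
          show "?K $ i $ j = (Re (?K $ b $ b) *\<^sub>R unit_at b) $ i $ j"
            unfolding z[of i j] scaleR_matrix_nth r[symmetric] by (auto simp: diag_on_nth)
        qed
      qed
      have B: "H + N' + (l - Re ((N' ** G ** N') $ b $ b)) *\<^sub>R unit_at b = bordered b S l P R"
      proof -
        have "(l - Re ((N' ** G ** N') $ b $ b)) *\<^sub>R unit_at b = l *\<^sub>R unit_at b - adjoint_matrix R ** P ** R"
          unfolding NGN by (subst (2) RPR) (simp add: scaleR_diff_left)
        moreover have "H = l *\<^sub>R one_on S - P" by (simp add: P_def)
        moreover have "adjoint_matrix (one_on S - R) ** P ** (one_on S - R) = P - P ** R - adjoint_matrix R ** P + adjoint_matrix R ** P ** R"
        proof -
          have "adjoint_matrix R ** P ** one_on S = adjoint_matrix R ** P" by (simp add: matrix_mul_assoc[symmetric] mult_one_on[OF Ps(1)])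
          then show ?thesis by (simp add: matrix_ring one_on_mult[OF Ps(1)] mult_one_on[OF Ps(1)])
        qed
        ultimately show ?thesis
          unfolding bordered_def N'_def one_on_insert[OF b]
          by (simp add: adjoint_matrix_mult Ps(2) scaleR_add_right)
      qed
      show "secular b S F l H (mconj (P + unit_at b) N) = ennreal (1 + sqnorm (N ** unit_at b)) * F (bordered b S l P (N ** unit_at b))"
        unfolding secular_def N' G_def[symmetric] sp1 N'b GPR B R_def[symmetric] by simp
    qed
    finally show ?thesis unfolding sp2[symmetric] P_def .
  qed
qed

text \<open>The variable \<open>l\<close> is moved outermost, so that for fixed \<open>l\<close> the
  reflection \<open>P = l - H\<close> preserves volume. \<open>P\<close> is moved innermost, so that
  it can next be transformed by a map depending on the border column.\<close>

theorem herm_integral_top_eigenvalue: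
  fixes b :: "'n::finite"
  assumes b: "b \<notin> S" and F[measurable]: "F \<in> borel_measurable borel"
  shows "herm_integral (insert b S \<times> insert b S) F = (\<integral>\<^sup>+ l. herm_integral (cross b S) (\<lambda>N.
    herm_integral (S \<times> S) (\<lambda>P. spec_prod S (\<lambda>y. if y > 0 then ennreal (y\<^sup>2) else 0) P *
      (ennreal (1 + sqnorm (N ** unit_at b)) * F (bordered b S l P (N ** unit_at b))))) \<partial>lborel)"
proof -
  define D where "D = spec_prod S (\<lambda>y. if y > 0 then ennreal (y\<^sup>2) else 0)"
  have D[measurable]: "D \<in> borel_measurable borel" unfolding D_def by measurable
  define \<Phi> where "\<Phi> l P N = ennreal (1 + sqnorm (N ** unit_at b)) * F (bordered b S l P (N ** unit_at b))" for l and P N :: "complex^'n^'n"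
  have \<Phi>[measurable]: "(\<lambda>x. \<Phi> (f x) (g x) (h x)) \<in> borel_measurable M"
    if [measurable]: "f \<in> borel_measurable M" "g \<in> borel_measurable M" "h \<in> borel_measurable M" for f g h and M :: "'z measure"
    unfolding \<Phi>_def by measurable
  have "herm_integral (insert b S \<times> insert b S) F =
      herm_integral (S \<times> S) (\<lambda>H. herm_integral (cross b S) (\<lambda>N. \<integral>\<^sup>+ l. secular b S F l H N \<partial>lborel))"
    unfolding herm_integral_bordered[OF b F]
    by (rule herm_integral_cong[OF sym_square], rule herm_integral_corner_substitution[OF b F])
       (simp add: herm_on_def zero_outside_square)
  also have "\<dots> = herm_integral (S \<times> S) (\<lambda>H. \<integral>\<^sup>+ l. herm_integral (cross b S) (secular b S F l H) \<partial>lborel)"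
    by (rule herm_integral_cong[OF sym_square], rule herm_integral_Fubini[OF sym_cross]) measurable
  also have "\<dots> = (\<integral>\<^sup>+ l. herm_integral (S \<times> S) (\<lambda>H. herm_integral (cross b S) (secular b S F l H)) \<partial>lborel)"
  proof (rule herm_integral_Fubini[OF sym_square])
    have "(\<lambda>p. herm_integral (cross b S) (\<lambda>N. secular b S F (snd p) (fst p) N)) \<in> borel_measurable (borel \<Otimes>\<^sub>M borel)"
      by (rule borel_measurable_herm_integral[OF sym_cross]) measurable
    then show "case_prod (\<lambda>H l. herm_integral (cross b S) (secular b S F l H)) \<in> borel_measurable (borel \<Otimes>\<^sub>M borel)"
      by (simp add: case_prod_beta)
  qed
  also have "\<dots> = (\<integral>\<^sup>+ l. herm_integral (S \<times> S) (\<lambda>P. D P * herm_integral (cross b S) (\<Phi> l P)) \<partial>lborel)"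
  proof (rule nn_integral_cong)
    fix l
    have m: "(\<lambda>P. D P * herm_integral (cross b S) (\<Phi> l P)) \<in> borel_measurable borel"
    proof -
      have "(\<lambda>P. herm_integral (cross b S) (\<Phi> l P)) \<in> borel_measurable borel"
        by (rule borel_measurable_herm_integral[OF sym_cross]) (simp add: case_prod_beta)
      then show ?thesis by measurable
    qed
    have "herm_integral (S \<times> S) (\<lambda>H. herm_integral (cross b S) (secular b S F l H)) =
       herm_integral (S \<times> S) (\<lambda>H. D (l *\<^sub>R one_on S - H) * herm_integral (cross b S) (\<Phi> l (l *\<^sub>R one_on S - H)))"
      unfolding D_def \<Phi>_def
      by (rule herm_integral_cong[OF sym_square], rule herm_integral_secular[OF b F])
         (simp add: herm_on_def zero_outside_square)
    also have "\<dots> = herm_integral (S \<times> S) (\<lambda>P. D P * herm_integral (cross b S) (\<Phi> l P))"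
      by (rule herm_integral_reflect[OF m])
    finally show "herm_integral (S \<times> S) (\<lambda>H. herm_integral (cross b S) (secular b S F l H)) = \<dots>" .
  qed
  also have "\<dots> = (\<integral>\<^sup>+ l. herm_integral (cross b S) (\<lambda>N. herm_integral (S \<times> S) (\<lambda>P. D P * \<Phi> l P N)) \<partial>lborel)"
  proof (rule nn_integral_cong)
    fix l
    have "D P * herm_integral (cross b S) (\<Phi> l P) = herm_integral (cross b S) (\<lambda>N. D P * \<Phi> l P N)" for P
      by (rule herm_integral_cmult[OF sym_cross, symmetric]) measurable
    moreover have "herm_integral (S \<times> S) (\<lambda>P. herm_integral (cross b S) (\<lambda>N. D P * \<Phi> l P N)) =
        herm_integral (cross b S) (\<lambda>N. herm_integral (S \<times> S) (\<lambda>P. D P * \<Phi> l P N))"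
      by (rule herm_integral_swap[OF sym_square sym_cross]) (simp add: case_prod_beta)
    ultimately show "herm_integral (S \<times> S) (\<lambda>P. D P * herm_integral (cross b S) (\<Phi> l P)) =
        herm_integral (cross b S) (\<lambda>N. herm_integral (S \<times> S) (\<lambda>P. D P * \<Phi> l P N))" by simp
  qed
  finally show ?thesis unfolding D_def \<Phi>_def .
qed

lemma spec_prod_mult: "spec_prod S (\<lambda>y. f y * g y) B = spec_prod S f B * spec_prod S g B"
  by (simp add: spec_prod_def prod.distrib)

context column_matrix begin

lemma T_conj_herm_on: "P \<in> herm_on S \<Longrightarrow> T ** P ** T \<in> herm_on S"
  by (simp add: herm_on_def supported_mult supported_T hermitian_iff_adjoint_matrix matrix_ring adjoint_T)

lemma spec_prod_bordered:
  assumes P: "P \<in> herm_on S"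
  shows "spec_prod (insert b S) w (bordered b S l P R) = w l * spec_prod S (\<lambda>y. w (l - y)) (T ** P ** T)"
proof -
  obtain Y \<kappa> where d: "diagonalizes S (T ** P ** T) Y \<kappa>"
    using T_conj_herm_on[OF P] diagonalizes_exists[of S] by (auto simp: herm_on_def)
  have "supported S P" using P by (simp add: herm_on_def)
  from diagonalizes_bordered[OF this d, of l] obtain Z where
    Z: "diagonalizes (insert b S) (bordered b S l P R) Z (\<lambda>i. if i = b then l else l - \<kappa> i)"
    by (auto simp: bordered_def N_def)
  have "spec_prod (insert b S) w (bordered b S l P R) = (\<Prod>i\<in>insert b S. w (if i = b then l else l - \<kappa> i))"
    by (rule spec_prod_diagonalizes[OF Z diagonalizes_herm_on[OF Z]])
  also have "\<dots> = w l * (\<Prod>i\<in>S. w (l - \<kappa> i))"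
    using b by (simp add: prod.insert) (intro arg_cong2[where f="(*)"] prod.cong, auto)
  finally show ?thesis by (simp add: spec_prod_diagonalizes[OF d diagonalizes_herm_on[OF d]])
qed

text \<open>The product is the squared determinant on positive definite matrices and 0 elsewhere.
  Congruence by \<open>T\<close> preserves positivity and multiplies the determinant by
  \<open>det T ^ 2 = 1 + sqnorm R\<close>.\<close>

lemma spec_prod_T_conj:
  assumes P: "P \<in> herm_on S"
  shows "spec_prod S (\<lambda>y. if y > 0 then ennreal (y\<^sup>2) else 0) (T ** P ** T) =
    ennreal ((1 + sqnorm R)\<^sup>2) * spec_prod S (\<lambda>y. if y > 0 then ennreal (y\<^sup>2) else 0) P"
proof -
  obtain Y \<kappa> where d: "diagonalizes S (T ** P ** T) Y \<kappa>"
    using T_conj_herm_on[OF P] diagonalizes_exists[of S] by (auto simp: herm_on_def)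
  obtain U s where s: "diagonalizes S T U s"
    using T_herm_on diagonalizes_exists[of S T] by (auto simp: herm_on_def)
  obtain V \<nu> where v: "diagonalizes S P V \<nu>"
    using P diagonalizes_exists[of S P] by (auto simp: herm_on_def)
  have Ps: "supported S P" using P by (simp add: herm_on_def)
  have val: "spec_prod S (\<lambda>y. if y > 0 then ennreal (y\<^sup>2) else 0) B = (if posdef_on S B then ennreal ((\<Prod>i\<in>S. \<mu> i)\<^sup>2) else 0)"
    if B: "diagonalizes S B W \<mu>" for B W \<mu>
  proof (cases "\<forall>i\<in>S. \<mu> i > 0")
    case True
    have "(\<Prod>i\<in>S. if \<mu> i > 0 then ennreal ((\<mu> i)\<^sup>2) else 0) = (\<Prod>i\<in>S. ennreal ((\<mu> i)\<^sup>2))"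
      using True by (intro prod.cong) auto
    then show ?thesis
      using True posdef_on_diagonalizes[OF B] by (simp add: spec_prod_diagonalizes[OF B diagonalizes_herm_on[OF B]] prod_ennreal prod_power_distrib)
  next
    case False
    then have "(\<Prod>i\<in>S. if \<mu> i > 0 then ennreal ((\<mu> i)\<^sup>2) else 0) = 0" by (intro prod_zero) auto
    moreover have "\<not> posdef_on S B" using False posdef_on_diagonalizes[OF B] by simp
    ultimately show ?thesis
      by (simp only: spec_prod_diagonalizes[OF B diagonalizes_herm_on[OF B]] if_False)
  qed
  have "det_on S (T ** P ** T) = det_on S T * det_on S P * det_on S T"
    by (simp add: det_on_mult supported_mult supported_T Ps)
  then have "complex_of_real (\<Prod>i\<in>S. \<kappa> i) = of_real ((\<Prod>i\<in>S. s i) * (\<Prod>i\<in>S. \<nu> i) * (\<Prod>i\<in>S. s i))"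
    unfolding det_on_diagonalizes[OF d] det_on_diagonalizes[OF s] det_on_diagonalizes[OF v] by simp
  then have "(\<Prod>i\<in>S. \<kappa> i) = (\<Prod>i\<in>S. s i) * (\<Prod>i\<in>S. \<nu> i) * (\<Prod>i\<in>S. s i)" by (simp only: of_real_eq_iff)
  also have "\<dots> = (\<Prod>i\<in>S. (s i)\<^sup>2) * (\<Prod>i\<in>S. \<nu> i)" by (simp add: power2_eq_square prod.distrib mult_ac)
  also have "\<dots> = (1 + sqnorm R) * (\<Prod>i\<in>S. \<nu> i)" by (simp only: prod_eigenvalues_T[OF s])
  finally have k: "(\<Prod>i\<in>S. \<kappa> i) = (1 + sqnorm R) * (\<Prod>i\<in>S. \<nu> i)" .
  have "posdef_on S (T ** P ** T) \<longleftrightarrow> posdef_on S P"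
    by (rule posdef_on_congruence[OF supported_T T_T' adjoint_T(1)])
  then show ?thesis
    unfolding val[OF d] val[OF v] k by (simp add: power_mult_distrib ennreal_mult)
qed

text \<open>In an eigenbasis of \<open>T\<close> the position \<open>(i, j)\<close> is scaled by
  \<open>s i * s j\<close>. Over all ordered pairs each \<open>s i\<close> occurs
  \<open>2 * card S\<close> times.\<close>

lemma conj_scale_T: "conj_scale (S \<times> S) T (ennreal ((1 + sqnorm R) ^ card S))"
proof -
  obtain U s where s: "diagonalizes S T U s"
    using T_herm_on diagonalizes_exists[of S T] by (auto simp: herm_on_def)
  then have U: "unitary_on S U" "supported S U" and T: "T = U ** diag_on S (\<lambda>i. of_real (s i)) ** adjoint_matrix U"
    by (auto simp: diagonalizes_def unitary_on_def)
  have P: "(\<Prod>i\<in>S. (s i)\<^sup>2) = 1 + sqnorm R" by (rule prod_eigenvalues_T[OF s])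
  have "1 + sqnorm R > 0" using sqnorm_nonneg[of R] by linarith
  then have nz: "s i \<noteq> 0" if "i \<in> S" for i using P that by (metis finite less_irrefl prod_zero_iff power_zero_numeral)
  have "(\<Prod>p\<in>S \<times> S. \<bar>s (fst p) * s (snd p)\<bar>) = (\<Prod>i\<in>S. \<Prod>j\<in>S. \<bar>s i\<bar> * \<bar>s j\<bar>)"
    by (simp add: prod.cartesian_product case_prod_beta abs_mult)
  also have "\<dots> = ((\<Prod>i\<in>S. \<bar>s i\<bar>) * (\<Prod>i\<in>S. \<bar>s i\<bar>)) ^ card S"
    by (simp add: prod.distrib prod_power_distrib power_mult_distrib)
  also have "(\<Prod>i\<in>S. \<bar>s i\<bar>) * (\<Prod>i\<in>S. \<bar>s i\<bar>) = (\<Prod>i\<in>S. (s i)\<^sup>2)"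
    by (simp add: prod.distrib[symmetric] power2_eq_square)
  finally have e: "(\<Prod>p\<in>S \<times> S. \<bar>s (fst p) * s (snd p)\<bar>) = (1 + sqnorm R) ^ card S" by (simp add: P)
  have "conj_scale (S \<times> S) (U ** diag_on S (\<lambda>i. of_real (s i)) ** adjoint_matrix U) (ennreal (\<Prod>p\<in>S \<times> S. \<bar>s (fst p) * s (snd p)\<bar>))"
    by (rule conj_scale_unitary_diag) (use U nz in \<open>auto intro!: compatible_square supported_adjoint_matrix\<close>)
  then show ?thesis unfolding e T[symmetric] .
qed

end

lemma ennreal_inverse_mult_cancel:
  assumes "0 < c" shows "ennreal (1 / c) * (ennreal c * x) = x"
proof -
  have "ennreal (1 / c) * ennreal c = 1" using assms by (simp add: ennreal_mult[symmetric])
  then show ?thesis by (simp add: mult.assoc[symmetric])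
qed

text \<open>With \<open>T P T\<close> as the new variable, everything that depends on the border
  column collects in one factor, whose integral is \<open>k\<close>. What remains is
  \<open>l\<close> and a matrix whose spectrum lies below \<open>l\<close>, with its squared
  determinant absorbed into the function.\<close>

theorem herm_integral_spec_prod_step:
  fixes b :: "'n::finite"
  assumes b: "b \<notin> S"
  obtains k where "\<And>w. w \<in> borel_measurable borel \<Longrightarrow> herm_integral (insert b S \<times> insert b S) (spec_prod (insert b S) w) =
    k * (\<integral>\<^sup>+ l. w l * herm_integral (S \<times> S) (spec_prod S (\<lambda>y. if y < l then ennreal ((l - y)\<^sup>2) * w y else 0)) \<partial>lborel)"
proof -
  define \<rho> where "\<rho> N = 1 + sqnorm (N ** unit_at b)" for N
  \<comment> \<open>The exponent collects 1 from the Jacobian of the corner, -2 from writing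
    \<open>det P ^ 2\<close> through \<open>T P T\<close>, and \<open>- card S\<close> from the
    volume of \<open>P \<mapsto> T P T\<close>.\<close>
  define K where "K N = ennreal (1 / \<rho> N ^ Suc (card S))" for N
  have K[measurable]: "K \<in> borel_measurable borel" unfolding K_def \<rho>_def by measurable
  define k where "k = herm_integral (cross b S) K"
  have \<rho>: "\<rho> N > 0" for N using sqnorm_nonneg[of "N ** unit_at b"] unfolding \<rho>_def by linarith
  have "herm_integral (insert b S \<times> insert b S) (spec_prod (insert b S) w) =
    k * (\<integral>\<^sup>+ l. w l * herm_integral (S \<times> S) (spec_prod S (\<lambda>y. if y < l then ennreal ((l - y)\<^sup>2) * w y else 0)) \<partial>lborel)"
    if w[measurable]: "w \<in> borel_measurable borel" for w
  proof -
    define D where "D = spec_prod S (\<lambda>y. if y > 0 then ennreal (y\<^sup>2) else 0)"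
    define \<Theta> where "\<Theta> l = spec_prod S (\<lambda>y. (if y > 0 then ennreal (y\<^sup>2) else 0) * w (l - y))" for l
    have \<Theta>[measurable]: "\<Theta> l \<in> borel_measurable borel" for l unfolding \<Theta>_def by measurable
    have inner: "herm_integral (S \<times> S) (\<lambda>P. D P * (ennreal (1 + sqnorm (N ** unit_at b)) * spec_prod (insert b S) w (bordered b S l P (N ** unit_at b)))) =
       K N * (w l * herm_integral (S \<times> S) (\<Theta> l))" if N: "hermitian N" "zero_outside (cross b S) N" for N l
    proof -
      interpret column_matrix b S "N ** unit_at b" by (rule cross_decomposition(1)[OF b N])
      have "D P * (ennreal (1 + sqnorm (N ** unit_at b)) * spec_prod (insert b S) w (bordered b S l P (N ** unit_at b))) =
        ennreal (1 / \<rho> N) * w l * \<Theta> l (mconj T P)" if P: "hermitian P" "zero_outside (S \<times> S) P" for P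
      proof -
        have P: "P \<in> herm_on S" using P by (simp add: herm_on_def zero_outside_square)
        have 1: "D P = ennreal (1 / (\<rho> N)\<^sup>2) * D (T ** P ** T)"
          unfolding D_def spec_prod_T_conj[OF P] \<rho>_def[symmetric]
          using \<rho>[of N] by (subst ennreal_inverse_mult_cancel) auto
        have 2: "ennreal (1 / (\<rho> N)\<^sup>2) * ennreal (\<rho> N) = ennreal (1 / \<rho> N)"
          using \<rho>[of N] by (simp add: ennreal_mult[symmetric] power2_eq_square)
        have 3: "\<Theta> l (mconj T P) = D (T ** P ** T) * spec_prod S (\<lambda>y. w (l - y)) (T ** P ** T)"
          unfolding \<Theta>_def D_def spec_prod_mult mconj_def adjoint_T ..
        show ?thesis
          unfolding spec_prod_bordered[OF P] \<rho>_def[symmetric] 1 3 2[symmetric] by (simp only: mult_ac)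
      qed
      then have "herm_integral (S \<times> S) (\<lambda>P. D P * (ennreal (1 + sqnorm (N ** unit_at b)) * spec_prod (insert b S) w (bordered b S l P (N ** unit_at b)))) =
         herm_integral (S \<times> S) (\<lambda>P. ennreal (1 / \<rho> N) * w l * \<Theta> l (mconj T P))"
        by (rule herm_integral_cong[OF sym_square])
      also have "\<dots> = ennreal (1 / \<rho> N) * w l * herm_integral (S \<times> S) (\<lambda>P. \<Theta> l (mconj T P))"
        by (rule herm_integral_cmult[OF sym_square]) measurable
      also have "herm_integral (S \<times> S) (\<lambda>P. \<Theta> l (mconj T P)) = ennreal (1 / \<rho> N ^ card S) * herm_integral (S \<times> S) (\<Theta> l)"
      proof -
        have "herm_integral (S \<times> S) (\<Theta> l) = ennreal (\<rho> N ^ card S) * herm_integral (S \<times> S) (\<lambda>P. \<Theta> l (mconj T P))"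
          using conj_scale_T \<Theta>[of l] unfolding conj_scale_def \<rho>_def by blast
        then show ?thesis using \<rho>[of N] by (simp only: ennreal_inverse_mult_cancel zero_less_power)
      qed
      also have "ennreal (1 / \<rho> N) * w l * (ennreal (1 / \<rho> N ^ card S) * herm_integral (S \<times> S) (\<Theta> l)) =
        (ennreal (1 / \<rho> N) * ennreal (1 / \<rho> N ^ card S)) * (w l * herm_integral (S \<times> S) (\<Theta> l))"
        by (simp add: mult_ac)
      also have "ennreal (1 / \<rho> N) * ennreal (1 / \<rho> N ^ card S) = K N"
        using \<rho>[of N] by (simp add: K_def ennreal_mult[symmetric])
      finally show ?thesis .
    qed
    \<comment> \<open>The reflection in \<open>l\<close> is undone, so that the formula speaks of
      eigenvalues \<open>y < l\<close> rather than of the gaps \<open>l - y\<close>.\<close>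
    have \<Theta>eq: "herm_integral (S \<times> S) (\<Theta> l) = herm_integral (S \<times> S) (spec_prod S (\<lambda>y. if y < l then ennreal ((l - y)\<^sup>2) * w y else 0))" for l
    proof -
      have "herm_integral (S \<times> S) (\<Theta> l) = herm_integral (S \<times> S) (\<lambda>H. \<Theta> l (l *\<^sub>R one_on S - H))"
        by (rule herm_integral_reflect[symmetric]) measurable
      also have "\<dots> = herm_integral (S \<times> S) (spec_prod S (\<lambda>y. if y < l then ennreal ((l - y)\<^sup>2) * w y else 0))"
      proof (rule herm_integral_cong[OF sym_square])
        fix H :: "complex^'n^'n" assume "hermitian H" "zero_outside (S \<times> S) H"
        then have H: "H \<in> herm_on S" by (simp add: herm_on_def zero_outside_square)
        then obtain U \<mu> where d: "diagonalizes S H U \<mu>"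
          using diagonalizes_exists[of S H] by (auto simp: herm_on_def)
        have d': "diagonalizes S (l *\<^sub>R one_on S - H) U (\<lambda>i. l - \<mu> i)" by (rule diagonalizes_reflect[OF d])
        show "\<Theta> l (l *\<^sub>R one_on S - H) = spec_prod S (\<lambda>y. if y < l then ennreal ((l - y)\<^sup>2) * w y else 0) H"
          unfolding \<Theta>_def spec_prod_diagonalizes[OF d H] spec_prod_diagonalizes[OF d' diagonalizes_herm_on[OF d']]
          by (intro prod.cong) auto
      qed
      finally show ?thesis .
    qed
    have mb: "spec_prod (insert b S) w \<in> borel_measurable borel" by measurable
    have m\<Theta>: "(\<lambda>l. herm_integral (S \<times> S) (spec_prod S (\<lambda>y. if y < l then ennreal ((l - y)\<^sup>2) * w y else 0))) \<in> borel_measurable borel"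
      by (rule borel_measurable_herm_integral[OF sym_square]) measurable
    have "herm_integral (insert b S \<times> insert b S) (spec_prod (insert b S) w) =
      (\<integral>\<^sup>+ l. herm_integral (cross b S) (\<lambda>N. K N * (w l * herm_integral (S \<times> S) (\<Theta> l))) \<partial>lborel)"
      unfolding herm_integral_top_eigenvalue[OF b mb] D_def[symmetric]
      by (intro nn_integral_cong herm_integral_cong[OF sym_cross] inner)
    also have "\<dots> = (\<integral>\<^sup>+ l. k * (w l * herm_integral (S \<times> S) (\<Theta> l)) \<partial>lborel)"
      unfolding k_def by (intro nn_integral_cong herm_integral_multc[OF sym_cross K])
    also have "\<dots> = k * (\<integral>\<^sup>+ l. w l * herm_integral (S \<times> S) (\<Theta> l) \<partial>lborel)"
      unfolding \<Theta>eq using m\<Theta> by (intro nn_integral_cmult) measurable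
    finally show ?thesis unfolding \<Theta>eq .
  qed
  then show thesis by (rule that)
qed

section \<open>The joint density of the eigenvalues\<close>

text \<open>Over ordered pairs each distance occurs twice, so this is the squared Vandermonde
  determinant, written without an order on the index set.\<close>

definition discriminant_on :: "'k set \<Rightarrow> ('k \<Rightarrow> real) \<Rightarrow> real" where
  "discriminant_on S x = (\<Prod>p\<in>S \<times> S. if fst p = snd p then 1 else \<bar>x (fst p) - x (snd p)\<bar>)"

definition eigenvalue_integral :: "'k set \<Rightarrow> (real \<Rightarrow> ennreal) \<Rightarrow> ennreal" where
  "eigenvalue_integral S w = (\<integral>\<^sup>+ x. ennreal (discriminant_on S x) * (\<Prod>i\<in>S. w (x i)) \<partial>lborel_on S)"

lemma discriminant_on_nonneg: "discriminant_on S x \<ge> 0"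
  unfolding discriminant_on_def by (intro prod_nonneg) auto

lemma discriminant_on_insert:
  assumes "finite S" "b \<notin> S"
  shows "discriminant_on (insert b S) x = discriminant_on S x * (\<Prod>i\<in>S. (x b - x i)\<^sup>2)"
proof -
  let ?f = "\<lambda>i j. if i = j then 1 else \<bar>x i - x j\<bar>"
  have d: "discriminant_on S x = (\<Prod>i\<in>S. \<Prod>j\<in>S. ?f i j)" for S
    by (simp add: discriminant_on_def prod.cartesian_product case_prod_beta)
  have "discriminant_on (insert b S) x = (\<Prod>j\<in>insert b S. ?f b j) * (\<Prod>i\<in>S. \<Prod>j\<in>insert b S. ?f i j)"
    unfolding d using assms by (subst prod.insert) auto
  also have "(\<Prod>j\<in>insert b S. ?f b j) = (\<Prod>j\<in>S. \<bar>x b - x j\<bar>)"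
    using assms by (subst prod.insert) (auto intro!: prod.cong)
  also have "(\<Prod>i\<in>S. \<Prod>j\<in>insert b S. ?f i j) = (\<Prod>i\<in>S. \<bar>x i - x b\<bar> * (\<Prod>j\<in>S. ?f i j))"
    using assms by (intro prod.cong refl) (subst prod.insert, auto)
  also have "\<dots> = (\<Prod>i\<in>S. \<bar>x b - x i\<bar>) * discriminant_on S x"
    unfolding d prod.distrib by (simp add: abs_minus_commute)
  also have "(\<Prod>j\<in>S. \<bar>x b - x j\<bar>) * ((\<Prod>i\<in>S. \<bar>x b - x i\<bar>) * discriminant_on S x) = discriminant_on S x * (\<Prod>i\<in>S. (x b - x i)\<^sup>2)"
    by (simp add: prod.distrib[symmetric] power2_eq_square mult_ac flip: abs_mult)
  finally show ?thesis .
qed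

lemma discriminant_on_fun_upd: "b \<notin> S \<Longrightarrow> discriminant_on S (x(b := l)) = discriminant_on S x"
  unfolding discriminant_on_def by (intro prod.cong refl) auto

lemma discriminant_on_reindex:
  assumes "bij_betw \<sigma> S S"
  shows "discriminant_on S (\<lambda>i\<in>S. x (\<sigma> i)) = discriminant_on S x"
proof -
  have inj: "inj_on \<sigma> S" and im: "\<sigma> ` S = S" using assms by (auto simp: bij_betw_def)
  have b2: "bij_betw (\<lambda>p. (\<sigma> (fst p), \<sigma> (snd p))) (S \<times> S) (S \<times> S)"
    using inj im by (auto simp: bij_betw_def inj_on_def image_iff) (metis imageE)+
  have "discriminant_on S (\<lambda>i\<in>S. x (\<sigma> i)) = (\<Prod>p\<in>S \<times> S. if \<sigma> (fst p) = \<sigma> (snd p) then 1 else \<bar>x (\<sigma> (fst p)) - x (\<sigma> (snd p))\<bar>)"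
    unfolding discriminant_on_def using inj by (intro prod.cong) (auto simp: inj_on_def)
  also have "\<dots> = discriminant_on S x"
    unfolding discriminant_on_def using prod.reindex_bij_betw[OF b2, of "\<lambda>p. if fst p = snd p then 1 else \<bar>x (fst p) - x (snd p)\<bar>"]
    by (simp only: fst_conv snd_conv)
  finally show ?thesis .
qed

lemma borel_measurable_discriminant_on [measurable]:
  assumes "S \<subseteq> I"
  shows "discriminant_on S \<in> borel_measurable (lborel_on I)"
  unfolding discriminant_on_def
proof (rule borel_measurable_prod)
  fix p assume "p \<in> S \<times> S"
  then have [measurable]: "(\<lambda>x. x (fst p)) \<in> borel_measurable (lborel_on I)" "(\<lambda>x. x (snd p)) \<in> borel_measurable (lborel_on I)"
    using assms measurable_component_singleton[of _ I "\<lambda>_. lborel"] by auto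
  show "(\<lambda>x. if fst p = snd p then 1 else \<bar>x (fst p) - x (snd p)\<bar>) \<in> borel_measurable (lborel_on I)"
    by measurable
qed

lemma borel_measurable_prod_component:
  assumes w[measurable]: "w \<in> borel_measurable borel" and "S \<subseteq> I"
  shows "(\<lambda>x. \<Prod>i\<in>S. w (x i) :: ennreal) \<in> borel_measurable (lborel_on I)"
proof (rule borel_measurable_prod_ennreal)
  fix i assume "i \<in> S"
  then have [measurable]: "(\<lambda>x. x i) \<in> borel_measurable (lborel_on I)"
    using assms measurable_component_singleton[of i I "\<lambda>_. lborel"] by auto
  show "(\<lambda>x. w (x i)) \<in> borel_measurable (lborel_on I)" by measurable
qed

text \<open>By symmetry each of the coordinates is the strict maximum with equal weight, and ties do not
  count because the discriminant vanishes.\<close>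

lemma eigenvalue_integral_max:
  fixes S :: "'k set"
  assumes fin: "finite S" and b: "b \<in> S" and w[measurable]: "w \<in> borel_measurable borel"
  shows "eigenvalue_integral S w = of_nat (card S) *
    (\<integral>\<^sup>+ x. (if \<forall>i\<in>S - {b}. x i < x b then 1 else 0) * (ennreal (discriminant_on S x) * (\<Prod>i\<in>S. w (x i))) \<partial>lborel_on S)"
proof -
  define g where "g x = ennreal (discriminant_on S x) * (\<Prod>i\<in>S. w (x i))" for x
  define m :: "'k \<Rightarrow> ('k \<Rightarrow> real) \<Rightarrow> ennreal" where "m k x = (if \<forall>i\<in>S - {k}. x i < x k then 1 else 0)" for k x
  have g[measurable]: "g \<in> borel_measurable (lborel_on S)"
    unfolding g_def using borel_measurable_discriminant_on[of S S] borel_measurable_prod_component[OF w, of S S] by measurable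
  have m[measurable]: "m k \<in> borel_measurable (lborel_on S)" if k: "k \<in> S" for k
  proof -
    have c: "(\<lambda>x. x i) \<in> borel_measurable (lborel_on S)" if "i \<in> S" for i
      using measurable_component_singleton[of i S "\<lambda>_. lborel"] that by auto
    have "Measurable.pred (lborel_on S) (\<lambda>x. \<forall>i\<in>S - {k}. x i < x k)"
      using fin c k by (intro pred_intros_finite borel_measurable_less) (auto simp: pred_def intro!: borel_measurable_less)
    then show ?thesis unfolding m_def by measurable
  qed
  have sum: "g x = (\<Sum>k\<in>S. m k x * g x)" for x
  proof (cases "discriminant_on S x = 0")
    case True
    then show ?thesis by (simp add: g_def)
  next
    case False
    have inj: "x i \<noteq> x j" if "i \<in> S" "j \<in> S" "i \<noteq> j" for i j
      using False fin that unfolding discriminant_on_def by (force simp: prod_zero_iff)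
    have "Max (x ` S) \<in> x ` S" using fin b by (intro Max_in) auto
    then obtain t where t: "t \<in> S" "x t = Max (x ` S)" by auto
    have lt: "x i < x t" if "i \<in> S" "i \<noteq> t" for i
      using t that fin inj[OF that(1) t(1) that(2)] by (simp add: order.strict_iff_order)
    have "m k x = (if k = t then 1 else 0)" if k: "k \<in> S" for k
    proof (cases "k = t")
      case True
      then show ?thesis using lt by (auto simp: m_def)
    next
      case False
      then have "t \<in> S - {k}" "\<not> x t < x k" using lt[OF k False] t(1) by auto
      then have "\<not> (\<forall>i\<in>S - {k}. x i < x k)" by blast
      then show ?thesis using False by (simp only: m_def if_False)
    qed
    then have "(\<Sum>k\<in>S. m k x * g x) = (\<Sum>k\<in>S. if k = t then g x else 0)" by (intro sum.cong) auto
    then show ?thesis using t fin by simp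
  qed
  have eq: "(\<integral>\<^sup>+ x. m k x * g x \<partial>lborel_on S) = (\<integral>\<^sup>+ x. m b x * g x \<partial>lborel_on S)" if k: "k \<in> S" for k
  proof -
    let ?\<sigma> = "Transposition.transpose b k"
    have \<sigma>: "bij_betw ?\<sigma> S S" using b k by (intro bij_betw_byWitness[of _ ?\<sigma>]) (auto simp: transpose_def)
    have "m k (\<lambda>i\<in>S. x (?\<sigma> i)) * g (\<lambda>i\<in>S. x (?\<sigma> i)) = m b x * g x" for x
    proof -
      have "(\<Prod>i\<in>S. w ((\<lambda>i\<in>S. x (?\<sigma> i)) i)) = (\<Prod>i\<in>S. w (x (?\<sigma> i)))" by (intro prod.cong) auto
      also have "\<dots> = (\<Prod>i\<in>S. w (x i))" by (rule prod.reindex_bij_betw[OF \<sigma>])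
      finally have "g (\<lambda>i\<in>S. x (?\<sigma> i)) = g x" unfolding g_def discriminant_on_reindex[OF \<sigma>] by simp
      moreover have "(\<forall>i\<in>S - {k}. (\<lambda>i\<in>S. x (?\<sigma> i)) i < (\<lambda>i\<in>S. x (?\<sigma> i)) k) \<longleftrightarrow> (\<forall>i\<in>S - {b}. x i < x b)"
      proof -
        have "inj ?\<sigma>" by (rule inj_on_inverseI[of _ ?\<sigma>]) simp
        then have im: "?\<sigma> ` (S - {k}) = S - {b}"
          using \<sigma> by (simp add: image_set_diff bij_betw_def)
        have "(\<forall>i\<in>S - {k}. (\<lambda>i\<in>S. x (?\<sigma> i)) i < (\<lambda>i\<in>S. x (?\<sigma> i)) k) \<longleftrightarrow> (\<forall>i\<in>S - {k}. x (?\<sigma> i) < x b)"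
          using k by (intro ball_cong) auto
        also have "\<dots> \<longleftrightarrow> (\<forall>j\<in>?\<sigma> ` (S - {k}). x j < x b)" by blast
        finally show ?thesis unfolding im .
      qed
      ultimately show ?thesis by (simp add: m_def)
    qed
    then show ?thesis
      using nn_integral_lborel_on_reindex[OF fin \<sigma>, of "\<lambda>x. m k x * g x"] k by simp
  qed
  have "eigenvalue_integral S w = (\<integral>\<^sup>+ x. (\<Sum>k\<in>S. m k x * g x) \<partial>lborel_on S)"
    unfolding eigenvalue_integral_def g_def[symmetric] sum[symmetric] ..
  also have "\<dots> = (\<Sum>k\<in>S. \<integral>\<^sup>+ x. m k x * g x \<partial>lborel_on S)"
    by (rule nn_integral_sum) measurable
  also have "\<dots> = of_nat (card S) * (\<integral>\<^sup>+ x. m b x * g x \<partial>lborel_on S)" by (simp add: eq)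
  finally show ?thesis by (simp add: m_def g_def)
qed

text \<open>The recursion adds the new eigenvalue as the strict maximum, and by symmetry that region
  carries \<open>1 / card\<close> of the full integral. The induction hypothesis is used at weights
  that change with \<open>l\<close>, which is why the constant must serve all \<open>w\<close> at
  once.\<close>

theorem weyl_integration:
  fixes S :: "('n::finite) set"
  shows "\<exists>C. \<forall>w\<in>borel_measurable borel. herm_integral (S \<times> S) (spec_prod S w) = C * eigenvalue_integral S w"
  using finite[of S]
proof (induction S rule: finite_induct)
  case empty
  have "herm_integral ({} :: ('n \<times> 'n) set) (spec_prod {} w) = 1" for w :: "real \<Rightarrow> ennreal"
    unfolding herm_integral_def by (subst lborel_on.nn_integral_empty) (simp_all add: spec_prod_def)
  moreover have "eigenvalue_integral ({} :: 'n set) w = 1" for w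
    unfolding eigenvalue_integral_def by (subst lborel_on.nn_integral_empty) (simp_all add: discriminant_on_def)
  ultimately show ?case by (intro exI[of _ 1] ballI) (simp only: Sigma_empty1 mult_1)
next
  case (insert b S)
  then obtain C where C: "\<And>w. w \<in> borel_measurable borel \<Longrightarrow> herm_integral (S \<times> S) (spec_prod S w) = C * eigenvalue_integral S w"
    by blast
  obtain k where k: "\<And>w. w \<in> borel_measurable borel \<Longrightarrow> herm_integral (insert b S \<times> insert b S) (spec_prod (insert b S) w) =
    k * (\<integral>\<^sup>+ l. w l * herm_integral (S \<times> S) (spec_prod S (\<lambda>y. if y < l then ennreal ((l - y)\<^sup>2) * w y else 0)) \<partial>lborel)"
    using herm_integral_spec_prod_step[OF insert(2)] by blast
  have "herm_integral (insert b S \<times> insert b S) (spec_prod (insert b S) w) = (k * C / of_nat (card (insert b S))) * eigenvalue_integral (insert b S) w"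
    if w[measurable]: "w \<in> borel_measurable borel" for w
  proof -
    define G where "G x = (if \<forall>i\<in>insert b S - {b}. x i < x b then 1 else 0) * (ennreal (discriminant_on (insert b S) x) * (\<Prod>i\<in>insert b S. w (x i)))" for x
    have G[measurable]: "G \<in> borel_measurable (lborel_on (insert b S))"
    proof -
      have c: "(\<lambda>x. x i) \<in> borel_measurable (lborel_on (insert b S))" if "i \<in> insert b S" for i
        using measurable_component_singleton[of i "insert b S" "\<lambda>_. lborel"] that by auto
      have "Measurable.pred (lborel_on (insert b S)) (\<lambda>x. \<forall>i\<in>insert b S - {b}. x i < x b)"
        using c by (intro pred_intros_finite) (auto simp: pred_def intro!: borel_measurable_less)
      then show ?thesis unfolding G_def
        using borel_measurable_discriminant_on[of "insert b S" "insert b S"] borel_measurable_prod_component[OF w, of "insert b S" "insert b S"]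
        by measurable
    qed
    \<comment> \<open>The factors \<open>(l - x i)^2\<close> complete the discriminant of
      \<open>S\<close> to that of \<open>insert b S\<close>, and the constraints
      \<open>x i < l\<close> say that the new coordinate is the strict maximum.\<close>
    have pt: "w l * (ennreal (discriminant_on S x) * (\<Prod>i\<in>S. if x i < l then ennreal ((l - x i)\<^sup>2) * w (x i) else 0)) = G (x(b := l))" for x l
    proof (cases "\<forall>i\<in>S. x i < l")
      case True
      have "(\<Prod>i\<in>S. if x i < l then ennreal ((l - x i)\<^sup>2) * w (x i) else 0) = (\<Prod>i\<in>S. ennreal ((l - x i)\<^sup>2) * w (x i))"
        using True by (intro prod.cong) auto
      also have "\<dots> = ennreal (\<Prod>i\<in>S. (l - x i)\<^sup>2) * (\<Prod>i\<in>S. w (x i))"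
        by (simp add: prod.distrib prod_ennreal)
      finally have 1: "(\<Prod>i\<in>S. if x i < l then ennreal ((l - x i)\<^sup>2) * w (x i) else 0) = ennreal (\<Prod>i\<in>S. (l - x i)\<^sup>2) * (\<Prod>i\<in>S. w (x i))" .
      have 2: "discriminant_on (insert b S) (x(b := l)) = discriminant_on S x * (\<Prod>i\<in>S. (l - x i)\<^sup>2)"
        unfolding discriminant_on_insert[OF insert(1,2)] discriminant_on_fun_upd[OF insert(2)]
        using insert(2) by (auto intro!: arg_cong2[where f="(*)"] prod.cong)
      have 3: "(\<Prod>i\<in>insert b S. w ((x(b := l)) i)) = w l * (\<Prod>i\<in>S. w (x i))"
        using insert(1,2) by (simp add: prod.insert) (intro arg_cong2[where f="(*)"] prod.cong, auto)
      have 4: "\<forall>i\<in>insert b S - {b}. (x(b := l)) i < (x(b := l)) b" using True insert(2) by auto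
      show ?thesis
        unfolding G_def 1 2 3 using 4 by (simp add: ennreal_mult discriminant_on_nonneg prod_nonneg mult_ac)
    next
      case False
      then obtain i where i: "i \<in> S" "\<not> x i < l" by auto
      then have "(\<Prod>i\<in>S. if x i < l then ennreal ((l - x i)\<^sup>2) * w (x i) else 0) = 0"
        using insert(1) by (intro prod_zero) auto
      moreover have "\<not> (\<forall>i\<in>insert b S - {b}. (x(b := l)) i < (x(b := l)) b)" using i insert(2) by auto
      ultimately show ?thesis unfolding G_def by (simp only: if_False mult_zero_left mult_zero_right)
    qed
    have m: "(\<lambda>y. if y < l then ennreal ((l - y)\<^sup>2) * w y else 0) \<in> borel_measurable borel" for l by measurable
    have mm: "(\<lambda>x. ennreal (discriminant_on S x) * (\<Prod>i\<in>S. if x i < l then ennreal ((l - x i)\<^sup>2) * w (x i) else 0)) \<in> borel_measurable (lborel_on S)" for l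
      using borel_measurable_discriminant_on[of S S] borel_measurable_prod_component[OF m, of S S l] by measurable
    have inner: "w l * herm_integral (S \<times> S) (spec_prod S (\<lambda>y. if y < l then ennreal ((l - y)\<^sup>2) * w y else 0)) =
      C * (\<integral>\<^sup>+ x. G (x(b := l)) \<partial>lborel_on S)" for l
    proof -
      have "(\<integral>\<^sup>+ x. G (x(b := l)) \<partial>lborel_on S) = w l * eigenvalue_integral S (\<lambda>y. if y < l then ennreal ((l - y)\<^sup>2) * w y else 0)"
        unfolding eigenvalue_integral_def pt[symmetric] by (rule nn_integral_cmult[OF mm])
      then show ?thesis unfolding C[OF m] by (simp add: mult_ac)
    qed
    have mG: "(\<lambda>l. \<integral>\<^sup>+ x. G (x(b := l)) \<partial>lborel_on S) \<in> borel_measurable lborel"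
    proof -
      interpret sigma_finite_measure "lborel_on S" by (rule sigma_finite_lborel_on[OF insert(1)])
      show ?thesis by (rule borel_measurable_nn_integral) measurable
    qed
    have "herm_integral (insert b S \<times> insert b S) (spec_prod (insert b S) w) = k * (\<integral>\<^sup>+ l. C * (\<integral>\<^sup>+ x. G (x(b := l)) \<partial>lborel_on S) \<partial>lborel)"
      unfolding k[OF w] inner ..
    also have "\<dots> = k * C * (\<integral>\<^sup>+ l. \<integral>\<^sup>+ x. G (x(b := l)) \<partial>lborel_on S \<partial>lborel)"
      using mG by (simp add: nn_integral_cmult mult.assoc)
    also have "(\<integral>\<^sup>+ l. \<integral>\<^sup>+ x. G (x(b := l)) \<partial>lborel_on S \<partial>lborel) = (\<integral>\<^sup>+ x. G x \<partial>lborel_on (insert b S))"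
      by (rule lborel_on.product_nn_integral_insert_rev[OF insert(1,2) G, symmetric])
    also have "\<dots> = eigenvalue_integral (insert b S) w / of_nat (card (insert b S))"
    proof -
      have "eigenvalue_integral (insert b S) w = of_nat (card (insert b S)) * (\<integral>\<^sup>+ x. G x \<partial>lborel_on (insert b S))"
        unfolding G_def using insert(1) by (intro eigenvalue_integral_max) auto
      moreover have "(of_nat (card (insert b S)) :: ennreal) \<noteq> 0" using insert(1,2) by simp
      moreover have "(of_nat (card (insert b S)) :: ennreal) \<noteq> Orderings.top" by (simp add: ennreal_of_nat_eq_real_of_nat)
      ultimately show ?thesis
        by (metis ennreal_mult_divide_eq mult.commute)
    qed
    finally show ?thesis by (simp add: ennreal_times_divide mult_ac)
  qed
  then show ?case by blast
qed

section \<open>Lebesgue measure on matrices as a product measure\<close>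

lemma borel_measurable_matrix_of_entries:
  "(\<lambda>x. \<chi> i j. x (i, j) :: real^'n^'n) \<in> borel_measurable (lborel_on (UNIV :: ('n::finite \<times> 'n) set))"
proof (subst borel_measurable_euclidean_space, rule ballI)
  fix b :: "real^'n^'n" assume "b \<in> Basis"
  then obtain i j where b: "b = axis i (axis j 1)" by (auto simp: Basis_vec_def)
  have "(\<lambda>x. x (i, j)) \<in> borel_measurable (lborel_on (UNIV :: ('n \<times> 'n) set))"
    using measurable_component_singleton[of "(i, j)" UNIV "\<lambda>_. lborel"] by simp
  then show "(\<lambda>x. (\<chi> i j. x (i, j)) \<bullet> b) \<in> borel_measurable (lborel_on UNIV)" by (simp add: b inner_axis)
qed

lemma lborel_matrix:
  "lborel = distr (lborel_on (UNIV :: ('n::finite \<times> 'n) set)) borel (\<lambda>x. \<chi> i j. x (i, j) :: real^'n^'n)"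
proof (rule lborel_eqI)
  let ?f = "\<lambda>x. \<chi> i j. x (i, j) :: real^'n^'n"
  note f = borel_measurable_matrix_of_entries[where 'n = 'n]
  have basis: "Basis = (\<lambda>p :: 'n \<times> 'n. axis (fst p) (axis (snd p) 1) :: real^'n^'n) ` UNIV"
  proof (rule equalityI; rule subsetI)
    fix b :: "real^'n^'n" assume "b \<in> Basis"
    then obtain i j where b: "b = axis i (axis j 1)" by (auto simp: Basis_vec_def)
    show "b \<in> (\<lambda>p :: 'n \<times> 'n. axis (fst p) (axis (snd p) 1) :: real^'n^'n) ` UNIV"
      by (rule image_eqI[of _ _ "(i, j)"]) (simp_all add: b)
  qed (auto simp: Basis_vec_def)
  have inj: "inj (\<lambda>p :: 'n \<times> 'n. axis (fst p) (axis (snd p) 1) :: real^'n^'n)"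
    by (auto simp: inj_def axis_eq_axis)
  fix l u :: "real^'n^'n" assume lu: "\<And>b. b \<in> Basis \<Longrightarrow> l \<bullet> b \<le> u \<bullet> b"
  have le: "l $ i $ j \<le> u $ i $ j" for i j
    using lu[of "axis i (axis j 1)"] by (simp add: inner_axis axis_in_Basis_iff)
  have pre: "?f -` box l u \<inter> space (lborel_on UNIV) = Pi\<^sub>E UNIV (\<lambda>p. {l $ fst p $ snd p<..<u $ fst p $ snd p})"
    unfolding box_def basis by (auto simp: space_lborel_on inner_axis PiE_iff)
  have "emeasure (distr (lborel_on UNIV) borel ?f) (box l u) = emeasure (lborel_on UNIV) (Pi\<^sub>E UNIV (\<lambda>p. {l $ fst p $ snd p<..<u $ fst p $ snd p}))"
    by (subst emeasure_distr[OF f]) (simp_all add: pre)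
  also have "\<dots> = (\<Prod>p\<in>UNIV. emeasure lborel {l $ fst p $ snd p<..<u $ fst p $ snd p})"
    by (rule lborel_on.emeasure_PiM) auto
  also have "\<dots> = (\<Prod>p\<in>UNIV. ennreal (u $ fst p $ snd p - l $ fst p $ snd p))"
    using le by simp
  also have "\<dots> = ennreal (\<Prod>p\<in>UNIV. u $ fst p $ snd p - l $ fst p $ snd p)"
    by (rule prod_ennreal) (simp add: le)
  also have "(\<Prod>p\<in>UNIV. u $ fst p $ snd p - l $ fst p $ snd p) = (\<Prod>b\<in>Basis. (u - l) \<bullet> b)"
    unfolding basis by (subst prod.reindex[OF inj]) (simp add: inner_axis)
  finally show "emeasure (distr (lborel_on UNIV) borel ?f) (box l u) = (\<Prod>b\<in>Basis. (u - l) \<bullet> b)" .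
qed simp

lemma hermitian_of_eq: "hermitian_of (\<chi> i j. x (i, j)) = herm UNIV x"
  by (simp add: hermitian_of_def herm_def)

lemma borel_measurable_hermitian_of: "hermitian_of \<in> borel_measurable borel"
  unfolding hermitian_of_def Complex_eq by (intro borel_measurable_continuous_onI continuous_intros) auto

lemma nn_integral_hermitian_lborel:
  fixes F :: "complex^'n^'n \<Rightarrow> ennreal"
  assumes F[measurable]: "F \<in> borel_measurable borel"
  shows "(\<integral>\<^sup>+ B. F B \<partial>hermitian_lborel) = herm_integral (UNIV \<times> UNIV) F"
proof -
  note m = borel_measurable_matrix_of_entries[where 'n = 'n]
  have h: "hermitian_of \<in> borel_measurable (lborel :: (real^'n^'n) measure)"
    using borel_measurable_hermitian_of by simp
  have "(\<integral>\<^sup>+ B. F B \<partial>hermitian_lborel) = (\<integral>\<^sup>+ X. F (hermitian_of X) \<partial>lborel)"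
    unfolding hermitian_lborel_def using F by (intro nn_integral_distr[OF h]) simp
  also have "\<dots> = (\<integral>\<^sup>+ x. F (hermitian_of (\<chi> i j. x (i, j))) \<partial>lborel_on UNIV)"
    by (subst lborel_matrix, rule nn_integral_distr[OF m]) (use measurable_compose[OF borel_measurable_hermitian_of F] in simp)
  finally show ?thesis by (simp add: hermitian_of_eq herm_integral_def)
qed

theorem nn_integral_hermitian_spec_prod:
  obtains C where "\<And>w. w \<in> borel_measurable borel \<Longrightarrow>
    (\<integral>\<^sup>+ B. spec_prod (UNIV :: 'n::finite set) w B \<partial>hermitian_lborel) = C * eigenvalue_integral (UNIV :: 'n set) w"
proof -
  obtain C where C: "\<And>w. w \<in> borel_measurable borel \<Longrightarrow> herm_integral (UNIV \<times> UNIV) (spec_prod (UNIV :: 'n set) w) = C * eigenvalue_integral (UNIV :: 'n set) w"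
    using weyl_integration[of "UNIV :: 'n set"] by blast
  have "(\<integral>\<^sup>+ B. spec_prod (UNIV :: 'n set) w B \<partial>hermitian_lborel) = C * eigenvalue_integral (UNIV :: 'n set) w"
    if w[measurable]: "w \<in> borel_measurable borel" for w
    by (subst nn_integral_hermitian_lborel) (measurable, rule C[OF w])
  then show thesis by (rule that)
qed

section \<open>Orthogonal polynomials and the discriminant\<close>

locale orthogonal_polynomials =
  fixes w :: "real \<Rightarrow> real" and \<phi> :: "nat \<Rightarrow> real poly" and h :: "nat \<Rightarrow> real"
  assumes weight: "weight_function w" and monic: "monic_orthogonal_polynomials w \<phi> h"
begin

lemma degree_phi: "Polynomial.degree (\<phi> i) = i" and lead_phi: "Polynomial.coeff (\<phi> i) i = 1" and h_pos: "h i > 0"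
  using monic unfolding monic_orthogonal_polynomials_def by (metis, metis, metis)

lemma w_nonneg: "w x \<ge> 0"
  using weight by (simp add: weight_function_def)

lemma w_measurable [measurable]: "w \<in> borel_measurable borel"
proof -
  have "integrable lborel (\<lambda>x. x ^ 0 * w x)" using weight unfolding weight_function_def by blast
  then show ?thesis by (auto dest: borel_measurable_integrable)
qed

lemma integrable_poly: "integrable lborel (\<lambda>x. poly p x * w x)"
proof -
  have "integrable lborel (\<lambda>x. \<Sum>i\<le>Polynomial.degree p. Polynomial.coeff p i * (x ^ i * w x))"
    using weight unfolding weight_function_def by (intro Bochner_Integration.integrable_sum integrable_mult_right) blast
  then show ?thesis by (simp add: poly_altdef sum_distrib_right mult.assoc)
qed

definition ip :: "real poly \<Rightarrow> real poly \<Rightarrow> real" where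
  "ip p q = (LBINT x. poly p x * poly q x * w x)"

lemma ip_phi: "ip (\<phi> i) (\<phi> j) = (if i = j then h i else 0)"
  using monic unfolding monic_orthogonal_polynomials_def ip_def by blast

lemma integrable_ip: "integrable lborel (\<lambda>x. poly p x * poly q x * w x)"
  using integrable_poly[of "p * q"] by simp

lemma ip_add: "ip (p + q) r = ip p r + ip q r"
  unfolding ip_def using integrable_ip by (simp add: algebra_simps)

lemma ip_smult: "ip (Polynomial.smult c p) r = c * ip p r"
  unfolding ip_def by (simp add: mult.assoc)

lemma ip_commute: "ip p q = ip q p"
  unfolding ip_def by (simp add: mult.commute)

lemma ip_sum: "ip (\<Sum>i\<in>A. f i) r = (\<Sum>i\<in>A. ip (f i) r)"
proof (induction A rule: infinite_finite_induct)
  case (insert a A)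
  then show ?case by (simp add: ip_add)
qed (simp_all add: ip_def)

lemma ip_X: "ip ([:0, 1:] * p) q = ip p ([:0, 1:] * q)"
  unfolding ip_def by (simp add: mult_ac)

lemma expansion:
  "Polynomial.degree p \<le> n \<Longrightarrow> \<exists>c. p = (\<Sum>i\<le>n. Polynomial.smult (c i) (\<phi> i))"
proof (induction n arbitrary: p)
  case 0
  then obtain a where "p = [:a:]" by (metis degree_eq_zeroE le_zero_eq)
  moreover obtain d where "\<phi> 0 = [:d:]" using degree_phi[of 0] by (metis degree_eq_zeroE)
  moreover have "d = 1" using lead_phi[of 0] calculation(2) by simp
  ultimately show ?case by (intro exI[of _ "\<lambda>_. a"]) simp
next
  case (Suc n)
  define a where "a = Polynomial.coeff p (Suc n)"
  define q where "q = p - Polynomial.smult a (\<phi> (Suc n))"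
  have "Polynomial.coeff q k = 0" if "k > n" for k
  proof (cases "k = Suc n")
    case True
    then show ?thesis by (simp add: q_def a_def lead_phi)
  next
    case False
    then have "k > Suc n" using that by simp
    then show ?thesis using Suc.prems degree_phi[of "Suc n"] by (simp add: q_def coeff_eq_0)
  qed
  then have "Polynomial.degree q \<le> n" by (intro degree_le) auto
  from Suc.IH[OF this] obtain c where c: "q = (\<Sum>i\<le>n. Polynomial.smult (c i) (\<phi> i))" by blast
  have "p = (\<Sum>i\<le>n. Polynomial.smult (c i) (\<phi> i)) + Polynomial.smult a (\<phi> (Suc n))"
    using c by (simp add: q_def algebra_simps)
  also have "\<dots> = (\<Sum>i\<le>Suc n. Polynomial.smult ((c(Suc n := a)) i) (\<phi> i))"
  proof -
    have "(\<Sum>i\<le>n. Polynomial.smult ((c(Suc n := a)) i) (\<phi> i)) = (\<Sum>i\<le>n. Polynomial.smult (c i) (\<phi> i))"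
      by (rule sum.cong) auto
    then show ?thesis by simp
  qed
  finally show ?case by blast
qed

lemma ip_expansion:
  assumes "p = (\<Sum>i\<le>n. Polynomial.smult (c i) (\<phi> i))" "j \<le> n"
  shows "ip p (\<phi> j) = c j * h j"
proof -
  have "ip p (\<phi> j) = (\<Sum>i\<le>n. if i = j then c j * h j else 0)"
    unfolding assms(1) ip_sum ip_smult ip_phi by (intro sum.cong) auto
  then show ?thesis using assms(2) by simp
qed

lemma ip_low_degree:
  assumes "Polynomial.degree p < j"
  shows "ip p (\<phi> j) = 0"
proof -
  obtain c where c: "p = (\<Sum>i\<le>Polynomial.degree p. Polynomial.smult (c i) (\<phi> i))" using expansion by blast
  have "ip (\<Sum>i\<le>Polynomial.degree p. Polynomial.smult (c i) (\<phi> i)) (\<phi> j) = 0"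
    unfolding ip_sum ip_smult ip_phi using assms by (intro sum.neutral) auto
  then show ?thesis using c by simp
qed

text \<open>Expand \<open>X \<phi>_(k+1) - \<phi>_(k+2)\<close> in the \<phi>_i with i \<le> k + 1.
  Multiplication by X is symmetric for \<open>ip\<close>, and for j < k the degree of
  \<open>X \<phi>_j\<close> is too small to meet \<phi>_(k+1), so those coefficients vanish. At k,
  \<open>X \<phi>_k\<close> is \<phi>_(k+1) plus lower terms, which gives h_(k+1) / h_k.\<close>

lemma three_term:
  "\<exists>a. \<phi> (Suc (Suc k)) = [:- a, 1:] * \<phi> (Suc k) - Polynomial.smult (h (Suc k) / h k) (\<phi> k)"
proof -
  define p where "p = [:0, 1:] * \<phi> (Suc k) - \<phi> (Suc (Suc k))"
  have ph: "\<phi> m \<noteq> 0" for m using lead_phi[of m] by auto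
  have degX: "Polynomial.degree ([:0, 1:] * \<phi> m) = Suc m" for m
    using ph[of m] degree_phi[of m] by (simp add: degree_mult_eq)
  have "Polynomial.coeff p i = 0" if "i > Suc k" for i
  proof (cases "i = Suc (Suc k)")
    case True
    then show ?thesis by (simp add: p_def lead_phi)
  next
    case False
    then have "i > Suc (Suc k)" using that by simp
    then show ?thesis using degX[of "Suc k"] degree_phi[of "Suc (Suc k)"] by (simp only: p_def coeff_diff coeff_eq_0 diff_self)
  qed
  then have "Polynomial.degree p \<le> Suc k" by (intro degree_le) auto
  then obtain c where c: "p = (\<Sum>i\<le>Suc k. Polynomial.smult (c i) (\<phi> i))" using expansion by blast
  have ipp: "ip p (\<phi> j) = ip (\<phi> (Suc k)) ([:0, 1:] * \<phi> j)" if "j \<le> Suc k" for j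
  proof -
    have "ip p (\<phi> j) = ip ([:0, 1:] * \<phi> (Suc k)) (\<phi> j) + ip (Polynomial.smult (- 1) (\<phi> (Suc (Suc k)))) (\<phi> j)"
      unfolding ip_add[symmetric] by (simp add: p_def)
    then show ?thesis using that by (simp only: ip_smult ip_phi ip_X) simp
  qed
  have cj: "c j = 0" if "j < k" for j
  proof -
    have "c j * h j = ip ([:0, 1:] * \<phi> j) (\<phi> (Suc k))"
      using ip_expansion[OF c, of j] ipp[of j] that ip_commute by simp
    also have "\<dots> = 0" by (rule ip_low_degree) (use degX[of j] that in simp)
    finally show ?thesis using h_pos[of j] by simp
  qed
  have ck: "c k = h (Suc k) / h k"
  proof -
    define q where "q = [:0, 1:] * \<phi> k - \<phi> (Suc k)"
    have "Polynomial.coeff q i = 0" if "i > k" for i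
    proof (cases "i = Suc k")
      case True
      then show ?thesis by (simp add: q_def lead_phi)
    next
      case False
      then have "i > Suc k" using that by simp
      then show ?thesis using degX[of k] degree_phi[of "Suc k"] by (simp only: q_def coeff_diff coeff_eq_0 diff_self)
    qed
    then have "Polynomial.degree q < Suc k" by (intro le_imp_less_Suc degree_le) auto
    then have q0: "ip q (\<phi> (Suc k)) = 0" by (rule ip_low_degree)
    have "c k * h k = ip ([:0, 1:] * \<phi> k) (\<phi> (Suc k))"
      using ip_expansion[OF c, of k] ipp[of k] ip_commute by simp
    also have "[:0, 1:] * \<phi> k = q + \<phi> (Suc k)" by (simp add: q_def)
    also have "ip (q + \<phi> (Suc k)) (\<phi> (Suc k)) = h (Suc k)" by (simp add: ip_add q0 ip_phi)
    finally show ?thesis using h_pos[of k] by (simp add: field_simps)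
  qed
  have "p = (\<Sum>i\<in>{k, Suc k}. Polynomial.smult (c i) (\<phi> i))"
    unfolding c by (rule sum.mono_neutral_right) (use cj in auto)
  then have "p = Polynomial.smult (h (Suc k) / h k) (\<phi> k) + Polynomial.smult (c (Suc k)) (\<phi> (Suc k))" by (simp add: ck)
  then have "\<phi> (Suc (Suc k)) = [:- c (Suc k), 1:] * \<phi> (Suc k) - Polynomial.smult (h (Suc k) / h k) (\<phi> k)"
    by (simp add: p_def algebra_simps)
  then show ?thesis by blast
qed

text \<open>Differentiating the three-term recurrence, the shift cancels in the Wronskian and leaves
  \<phi>_(m+1)^2 plus h_(m+1) / h_m times the previous one. Division by h_(m+1) makes this
  telescope.\<close>

theorem christoffel_darboux:
  "poly (phi_hat \<phi> m) x / h m = (\<Sum>j\<le>m. (poly (\<phi> j) x)\<^sup>2 / h j)"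
proof (induction m)
  case 0
  obtain d where d: "\<phi> 0 = [:d:]" using degree_phi[of 0] by (metis degree_eq_zeroE)
  then have d1: "\<phi> 0 = 1" using lead_phi[of 0] by simp
  have "Polynomial.degree (pderiv (\<phi> 1)) = 0" using degree_phi[of 1] by (simp add: degree_pderiv)
  then obtain e where e: "pderiv (\<phi> 1) = [:e:]" by (metis degree_eq_zeroE)
  have "Polynomial.coeff (pderiv (\<phi> 1)) 0 = 1" using lead_phi[of 1] by (simp add: coeff_pderiv)
  then have "pderiv (\<phi> 1) = 1" using e by simp
  then show ?case by (simp add: phi_hat_def d1)
next
  case (Suc m)
  obtain a where a: "\<phi> (Suc (Suc m)) = [:- a, 1:] * \<phi> (Suc m) - Polynomial.smult (h (Suc m) / h m) (\<phi> m)"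
    using three_term by blast
  have "poly (phi_hat \<phi> (Suc m)) x = (poly (\<phi> (Suc m)) x)\<^sup>2 + h (Suc m) / h m * poly (phi_hat \<phi> m) x"
    unfolding phi_hat_def by (simp add: a pderiv_mult pderiv_add pderiv_diff pderiv_smult pderiv_pCons power2_eq_square algebra_simps)
  then have "poly (phi_hat \<phi> (Suc m)) x / h (Suc m) = (poly (\<phi> (Suc m)) x)\<^sup>2 / h (Suc m) + poly (phi_hat \<phi> m) x / h m"
    using h_pos[of m] h_pos[of "Suc m"] by (simp add: field_simps)
  then show ?case using Suc.IH by simp
qed

end

text \<open>The Vandermonde evaluation for arbitrary monic polynomials. As a function of the newest
  variable the determinant is a polynomial of degree at most \<open>m\<close> that vanishes at the
  \<open>m\<close> earlier points, and its leading coefficient is the previous determinant.\<close>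

lemma discriminant_on_eq_det:
  fixes e :: "'n::finite \<Rightarrow> nat" and p :: "nat \<Rightarrow> real poly" and x :: "'n \<Rightarrow> real"
  assumes e: "bij_betw e UNIV {..<CARD('n)}"
    and deg: "\<And>i. Polynomial.degree (p i) = i" and lead: "\<And>i. Polynomial.coeff (p i) i = 1"
  shows "discriminant_on UNIV x = (det (\<chi> i j. poly (p (e j)) (x i)))\<^sup>2"
proof -
  define r :: "real \<Rightarrow> real^'n" where "r t = (\<chi> j. poly (p (e j)) t)" for t
  \<comment> \<open>Unit rows outside \<open>T\<close> let one matrix size serve every stage of the
    induction; on \<open>T\<close> with the columns of the same indices it is the smaller
    matrix.\<close>
  define M :: "'n set \<Rightarrow> real^'n^'n" where "M T = (\<chi> i. if i \<in> T then r (x i) else axis i 1)" for T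
  have inj: "inj e" using e by (simp add: bij_betw_def)
  have *: "discriminant_on {i. e i < m} x = (det (M {i. e i < m}))\<^sup>2 \<and> card {i. e i < m} = m" if "m \<le> CARD('n)" for m
    using that
  proof (induction m)
    case 0
    have "M {} = mat 1" by (simp add: M_def mat_def axis_def vec_eq_iff eq_commute)
    then show ?case by (simp add: discriminant_on_def)
  next
    case (Suc m)
    define T where "T = {i. e i < m}"
    have IH: "discriminant_on T x = (det (M T))\<^sup>2" "card T = m" using Suc by (simp_all add: T_def)
    have "m \<in> e ` UNIV" using e Suc.prems by (simp add: bij_betw_def)
    then obtain b where b: "e b = m" by auto
    have bT: "b \<notin> T" by (simp add: T_def b)
    have T': "{i. e i < Suc m} = insert b T"
      using b inj by (auto simp: T_def less_Suc_eq inj_def)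
    have cT': "card (insert b T) = Suc m" using bT IH(2) by simp
    have rowM: "row i (M V) = r (x i)" if "i \<in> V" for i V using that by (simp add: M_def row_def vec_eq_iff)
    have "discriminant_on (insert b T) x = (det (M (insert b T)))\<^sup>2"
    proof (cases "inj_on x T")
      case False
      then obtain i j where ij: "i \<in> T" "j \<in> T" "i \<noteq> j" "x i = x j" by (auto simp: inj_on_def)
      have "det (M V) = 0" if "T \<subseteq> V" for V
        by (rule det_identical_rows[OF ij(3)]) (use ij that in \<open>simp add: rowM subset_iff\<close>)
      then have "det (M T) = 0" "det (M (insert b T)) = 0" by (blast, metis subset_insertI)
      then show ?thesis using IH by (simp add: discriminant_on_insert[OF _ bT])
    next
      case True
      \<comment> \<open>The cofactors along row \<open>b\<close>. For \<open>e j > m\<close> they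
        vanish because row \<open>j\<close> is still the unit row, so only polynomials of degree at
        most \<open>m\<close> enter.\<close>
      define d where "d j = det (\<chi> i. if i = b then axis j 1 else M T $ i)" for j
      have d0: "d j = 0" if "e j > m" for j
        unfolding d_def
      proof (rule det_identical_rows)
        show "b \<noteq> j" using that b by auto
        then show "row b (\<chi> i. if i = b then axis j 1 else M T $ i) = row j (\<chi> i. if i = b then axis j 1 else M T $ i)"
          using that by (simp add: row_def M_def T_def vec_eq_iff)
      qed
      have db: "d b = det (M T)"
        unfolding d_def by (rule arg_cong[where f=det]) (use bT in \<open>simp add: M_def vec_eq_iff\<close>)
      define q where "q = (\<Sum>j\<in>insert b T. Polynomial.smult (d j) (p (e j)))"
      have q: "det (\<chi> i. if i = b then r t else M T $ i) = poly q t" for t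
      proof -
        have "r t = (\<Sum>j\<in>UNIV. poly (p (e j)) t *s axis j 1)"
          by (simp add: vec_eq_iff r_def axis_def if_distrib cong: if_cong)
        then have "det (\<chi> i. if i = b then r t else M T $ i) = (\<Sum>j\<in>UNIV. poly (p (e j)) t * d j)"
          by (simp only: det_linear_row_sum[OF finite] det_row_mul d_def)
        also have "\<dots> = (\<Sum>j\<in>insert b T. poly (p (e j)) t * d j)"
          using d0 unfolding T'[symmetric] by (intro sum.mono_neutral_right) auto
        finally show ?thesis by (simp add: q_def poly_sum mult.commute)
      qed
      have low: "e j \<le> m" if "j \<in> insert b T" for j using that b by (auto simp: T_def)
      \<comment> \<open>\<open>q\<close> and \<open>s\<close> have degree at most \<open>m\<close>,
        the same coefficient at \<open>m\<close> and the same value, 0, at the \<open>m\<close>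
        distinct points \<open>x i\<close>, hence they coincide.\<close>
      define s where "s = Polynomial.smult (d b) (\<Prod>i\<in>T. [:- x i, 1:])"
      have "q = s"
      proof (rule poly_eqI_degree_lead_coeff)
        show "Polynomial.degree q \<le> m"
          unfolding q_def by (rule degree_sum_le) (use low deg in \<open>auto intro: order_trans[OF degree_smult_le]\<close>)
        have dp: "Polynomial.degree (\<Prod>i\<in>T. [:- x i, 1:]) = m"
          using IH(2) by (subst degree_prod_eq_sum_degree) auto
        show "Polynomial.degree s \<le> m"
          unfolding s_def using degree_smult_le[of "d b" "\<Prod>i\<in>T. [:- x i, 1:]"] dp by simp
        have "Polynomial.coeff q m = d b * Polynomial.coeff (p m) m + (\<Sum>j\<in>T. d j * Polynomial.coeff (p (e j)) m)"
          using bT by (simp add: q_def coeff_sum b)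
        also have "(\<Sum>j\<in>T. d j * Polynomial.coeff (p (e j)) m) = 0"
          using deg by (intro sum.neutral) (auto simp: T_def coeff_eq_0)
        finally have "Polynomial.coeff q m = d b" by (simp add: lead)
        moreover have "Polynomial.coeff (\<Prod>i\<in>T. [:- x i, 1:]) m = 1"
          using lead_coeff_prod[of "\<lambda>i. [:- x i, 1:]" T] dp by simp
        ultimately show "Polynomial.coeff q m = Polynomial.coeff s m" by (simp add: s_def)
        show "m \<le> card (x ` T)" using card_image[OF True] IH(2) by simp
        fix t assume "t \<in> x ` T"
        then obtain i where i: "i \<in> T" "t = x i" by auto
        have "det (\<chi> k. if k = b then r t else M T $ k) = 0"
        proof (rule det_identical_rows)
          show "b \<noteq> i" using i(1) bT by auto
          then show "row b (\<chi> k. if k = b then r t else M T $ k) = row i (\<chi> k. if k = b then r t else M T $ k)"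
            using i by (simp add: row_def M_def vec_eq_iff)
        qed
        then have "poly q t = 0" by (simp add: q)
        moreover have "poly s t = 0" using i by (auto simp: s_def poly_prod)
        ultimately show "poly q t = poly s t" by simp
      qed
      then have "det (\<chi> i. if i = b then r (x b) else M T $ i) = det (M T) * (\<Prod>i\<in>T. x b - x i)"
        unfolding q by (simp add: s_def poly_prod db)
      moreover have "(\<chi> i. if i = b then r (x b) else M T $ i) = M (insert b T)"
        by (simp add: M_def vec_eq_iff)
      ultimately show ?thesis
        using IH by (simp add: discriminant_on_insert[OF _ bT] power_mult_distrib prod_power_distrib)
    qed
    then show ?case unfolding T' using cT' by simp
  qed
  have U: "{i. e i < CARD('n)} = UNIV" using e by (auto simp: bij_betw_def)
  have "M UNIV = (\<chi> i j. poly (p (e j)) (x i))" by (simp add: M_def r_def vec_eq_iff)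
  then show ?thesis using *[of "CARD('n)"] unfolding U by simp
qed

lemma borel_measurable_poly [measurable]: "(\<lambda>x. poly p x) \<in> borel_measurable borel" for p :: "real poly"
  by (intro borel_measurable_continuous_onI continuous_intros)

context orthogonal_polynomials
begin

text \<open>The squared determinant expands into a double sum over permutations of products of
  one-variable integrals. Only the variable \<open>k\<close> carries \<open>a\<close>, so
  orthogonality in the others forces the two permutations to agree off \<open>k\<close>, hence
  everywhere. The bound on \<open>a\<close> gives integrability by comparison.\<close>

lemma discriminant_integral:
  fixes e :: "'n::finite \<Rightarrow> nat" and a :: "real \<Rightarrow> real"
  assumes e: "bij_betw e UNIV {..<CARD('n)}"
    and a[measurable]: "a \<in> borel_measurable borel" and a1: "\<And>y. \<bar>a y\<bar> \<le> 1"
  shows "integrable (lborel_on UNIV) (\<lambda>x. a (x k) * (discriminant_on UNIV x * (\<Prod>i\<in>UNIV. w (x i))))" (is ?int)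
    and "(LINT x|lborel_on UNIV. a (x k) * (discriminant_on UNIV x * (\<Prod>i\<in>UNIV. w (x i)))) =
      (\<Prod>i\<in>UNIV. h (e i)) * (\<Sum>p | p permutes (UNIV :: 'n set). (LBINT y. a y * (poly (\<phi> (e (p k))) y)\<^sup>2 * w y) / h (e (p k)))" (is ?eq)
proof -
  let ?P = "{p. p permutes (UNIV :: 'n set)}"
  let ?s = "\<lambda>p q. of_int (sign p) * of_int (sign q) :: real"
  define f where "f p q i y = (if i = k then a y else 1) * (poly (\<phi> (e (p i))) y * poly (\<phi> (e (q i))) y * w y)"
    for p q :: "'n \<Rightarrow> 'n" and i y
  have f: "integrable lborel (f p q i)" for p q i
    unfolding f_def
    by (rule Bochner_Integration.integrable_bound[OF integrable_ip[of "\<phi> (e (p i))" "\<phi> (e (q i))"]])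
      (use a1 in \<open>auto simp: abs_mult w_nonneg intro!: mult_left_le_one_le\<close>)
  have expand: "a (x k) * (discriminant_on UNIV x * (\<Prod>i\<in>UNIV. w (x i))) =
      (\<Sum>p\<in>?P. \<Sum>q\<in>?P. ?s p q * (\<Prod>i\<in>UNIV. f p q i (x i)))" for x :: "'n \<Rightarrow> real"
  proof -
    have 1: "discriminant_on UNIV x = (\<Sum>p\<in>?P. \<Sum>q\<in>?P. ?s p q * (\<Prod>i\<in>UNIV. poly (\<phi> (e (p i))) (x i) * poly (\<phi> (e (q i))) (x i)))"
      unfolding discriminant_on_eq_det[OF e degree_phi lead_phi] power2_eq_square
      by (simp add: det_def sum_product prod.distrib mult_ac)
    have 2: "(\<Prod>i\<in>UNIV. f p q i (x i)) = a (x k) * ((\<Prod>i\<in>UNIV. poly (\<phi> (e (p i))) (x i) * poly (\<phi> (e (q i))) (x i)) * (\<Prod>i\<in>UNIV. w (x i)))" for p q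
      unfolding f_def prod.distrib by simp
    show ?thesis unfolding 1 2 by (simp add: sum_distrib_left sum_distrib_right mult_ac)
  qed
  have pint: "integrable (lborel_on UNIV) (\<lambda>x. (\<Prod>i\<in>UNIV. f p q i (x i)))" for p q
    by (rule lborel_on.product_integrable_prod) (simp_all add: f)
  show ?int unfolding expand by (intro Bochner_Integration.integrable_sum integrable_mult_right pint)
  have factor: "integral\<^sup>L lborel (f p q i) = (if p i = q i then h (e (p i)) else 0)" if "i \<noteq> k" for p q i
    using that ip_phi[of "e (p i)" "e (q i)"] bij_betw_imp_inj_on[OF e] by (auto simp: f_def[abs_def] ip_def dest: injD)
  have leibniz: "(LINT x|lborel_on UNIV. (\<Prod>i\<in>UNIV. f p q i (x i))) =
      (if p = q then (\<Prod>i\<in>UNIV. h (e i)) * ((LBINT y. a y * (poly (\<phi> (e (p k))) y)\<^sup>2 * w y) / h (e (p k))) else 0)"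
    if p: "p permutes UNIV" and q: "q permutes UNIV" for p q
  proof -
    have "(LINT x|lborel_on UNIV. (\<Prod>i\<in>UNIV. f p q i (x i))) = (\<Prod>i\<in>UNIV. integral\<^sup>L lborel (f p q i))"
      by (rule lborel_on.product_integral_prod) (simp_all add: f)
    also have "\<dots> = integral\<^sup>L lborel (f p q k) * (\<Prod>i\<in>UNIV - {k}. integral\<^sup>L lborel (f p q i))"
      by (rule prod.remove) auto
    also have "(\<Prod>i\<in>UNIV - {k}. integral\<^sup>L lborel (f p q i)) = (\<Prod>i\<in>UNIV - {k}. if p i = q i then h (e (p i)) else 0)"
      by (intro prod.cong refl factor) auto
    finally have *: "(LINT x|lborel_on UNIV. (\<Prod>i\<in>UNIV. f p q i (x i))) = integral\<^sup>L lborel (f p q k) * (\<Prod>i\<in>UNIV - {k}. if p i = q i then h (e (p i)) else 0)" .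
    show ?thesis
    proof (cases "p = q")
      case True
      have "(\<Prod>i\<in>UNIV. h (e i)) = (\<Prod>i\<in>UNIV. h (e (p i)))"
        using prod.permute[OF p, of "\<lambda>i. h (e i)"] by (simp add: comp_def)
      also have "\<dots> = h (e (p k)) * (\<Prod>i\<in>UNIV - {k}. h (e (p i)))" by (rule prod.remove) auto
      finally show ?thesis
        unfolding * using True h_pos[of "e (p k)"] by (simp add: f_def[abs_def] power2_eq_square mult_ac)
    next
      case False
      \<comment> \<open>Two permutations that agree off one point take the same remaining value
        there.\<close>
      have "\<exists>i\<in>UNIV - {k}. p i \<noteq> q i"
      proof (rule ccontr)
        assume eq: "\<not> ?thesis"
        have "p i = q i" for i
        proof (cases "i = k")
          case True
          obtain j where j: "q j = p k" using permutes_surj[OF q] by (metis surjD)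
          have "j = k"
          proof (rule ccontr)
            assume "j \<noteq> k"
            then have "p j = p k" using eq j by auto
            then show False using permutes_inj[OF p] \<open>j \<noteq> k\<close> by (auto dest: injD)
          qed
          then show ?thesis using j True by simp
        qed (use eq in auto)
        then show False using False by blast
      qed
      then show ?thesis unfolding * using False by (auto intro!: prod_zero)
    qed
  qed
  have "(LINT x|lborel_on UNIV. a (x k) * (discriminant_on UNIV x * (\<Prod>i\<in>UNIV. w (x i)))) =
      (\<Sum>p\<in>?P. \<Sum>q\<in>?P. ?s p q * (LINT x|lborel_on UNIV. (\<Prod>i\<in>UNIV. f p q i (x i))))"
    unfolding expand using pint by simp
  also have "\<dots> = (\<Sum>p\<in>?P. \<Sum>q\<in>?P. if p = q then (\<Prod>i\<in>UNIV. h (e i)) * ((LBINT y. a y * (poly (\<phi> (e (p k))) y)\<^sup>2 * w y) / h (e (p k))) else 0)"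
    by (intro sum.cong refl) (auto simp: leibniz sign_def)
  also have "\<dots> = (\<Sum>p\<in>?P. (\<Prod>i\<in>UNIV. h (e i)) * ((LBINT y. a y * (poly (\<phi> (e (p k))) y)\<^sup>2 * w y) / h (e (p k))))"
    by (rule sum.cong) (auto simp: finite_permutations)
  finally show ?eq by (simp add: sum_distrib_left)
qed

lemma discriminant_norm:
  fixes e :: "'n::finite \<Rightarrow> nat"
  assumes e: "bij_betw e UNIV {..<CARD('n)}"
  shows "integrable (lborel_on UNIV) (\<lambda>x. discriminant_on UNIV x * (\<Prod>i\<in>(UNIV :: 'n set). w (x i)))"
    and "(LINT x|lborel_on UNIV. discriminant_on UNIV x * (\<Prod>i\<in>(UNIV :: 'n set). w (x i))) = (\<Prod>i\<in>UNIV. h (e i)) * fact CARD('n)"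
proof -
  have "(LBINT y. (poly (\<phi> j) y)\<^sup>2 * w y) = h j" for j
    using ip_phi[of j j] by (simp add: ip_def power2_eq_square)
  moreover have "h j \<noteq> 0" for j using h_pos[of j] by simp
  ultimately show "integrable (lborel_on UNIV) (\<lambda>x. discriminant_on UNIV x * (\<Prod>i\<in>(UNIV :: 'n set). w (x i)))"
    "(LINT x|lborel_on UNIV. discriminant_on UNIV x * (\<Prod>i\<in>(UNIV :: 'n set). w (x i))) = (\<Prod>i\<in>UNIV. h (e i)) * fact CARD('n)"
    using discriminant_integral[OF e, of "\<lambda>_. 1"] by (simp_all add: card_permutations[OF refl])
qed

text \<open>For a fixed permutation the degree \<open>e (p k)\<close> runs through all of
  \<open>{..<CARD('n)}\<close> as \<open>k\<close> varies. Every permutation contributes the same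
  sum, which is the integral of \<open>a\<close> against the one-point kernel.\<close>

lemma discriminant_linear_statistic:
  fixes e :: "'n::finite \<Rightarrow> nat" and a :: "real \<Rightarrow> real"
  assumes e: "bij_betw e UNIV {..<CARD('n)}"
    and a: "a \<in> borel_measurable borel" "\<And>y. \<bar>a y\<bar> \<le> 1"
  shows "(LINT x|lborel_on (UNIV :: 'n set). (\<Sum>k\<in>UNIV. a (x k)) * (discriminant_on UNIV x * (\<Prod>i\<in>UNIV. w (x i)))) =
    (\<Prod>i\<in>UNIV. h (e i)) * fact CARD('n) * (\<Sum>j<CARD('n). (LBINT y. a y * (poly (\<phi> j) y)\<^sup>2 * w y) / h j)"
proof -
  let ?I = "\<lambda>j. (LBINT y. a y * (poly (\<phi> j) y)\<^sup>2 * w y) / h j"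
  have "(LINT x|lborel_on (UNIV :: 'n set). (\<Sum>k\<in>UNIV. a (x k)) * (discriminant_on UNIV x * (\<Prod>i\<in>UNIV. w (x i)))) =
      (\<Sum>k\<in>UNIV. LINT x|lborel_on (UNIV :: 'n set). a (x k) * (discriminant_on UNIV x * (\<Prod>i\<in>UNIV. w (x i))))"
    unfolding sum_distrib_right using discriminant_integral(1)[OF e a] by (intro Bochner_Integration.integral_sum) auto
  also have "\<dots> = (\<Prod>i\<in>UNIV. h (e i)) * (\<Sum>p | p permutes (UNIV :: 'n set). \<Sum>k\<in>UNIV. ?I (e (p k)))"
    unfolding discriminant_integral(2)[OF e a] sum_distrib_left[symmetric] by (subst sum.swap) (rule refl)
  also have "(\<Sum>p | p permutes (UNIV :: 'n set). \<Sum>k\<in>UNIV. ?I (e (p k))) = (\<Sum>p | p permutes (UNIV :: 'n set). \<Sum>j<CARD('n). ?I j)"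
  proof (rule sum.cong[OF refl])
    fix p assume "p \<in> {p. p permutes (UNIV :: 'n set)}"
    then have "bij_betw (\<lambda>k. e (p k)) UNIV {..<CARD('n)}"
      using bij_betw_trans[OF _ e, of p UNIV] permutes_imp_bij[of p UNIV] by (simp add: comp_def)
    then show "(\<Sum>k\<in>UNIV. ?I (e (p k))) = (\<Sum>j<CARD('n). ?I j)" by (rule sum.reindex_bij_betw)
  qed
  finally show ?thesis by (simp add: card_permutations[OF refl])
qed

end

section \<open>The expected Euler characteristic\<close>

lemma (in finite_measure) integral_bounded_nat:
  fixes g :: "nat \<Rightarrow> real"
  assumes N: "(\<lambda>\<omega>. real (N \<omega>)) \<in> borel_measurable M" and n: "\<And>\<omega>. \<omega> \<in> space M \<Longrightarrow> N \<omega> \<le> n"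
  shows "integrable M (\<lambda>\<omega>. g (N \<omega>))"
    and "(LINT \<omega>|M. g (N \<omega>)) = (\<Sum>k\<le>n. g k * measure M {\<omega> \<in> space M. N \<omega> = k})"
proof -
  have s: "{\<omega> \<in> space M. N \<omega> = k} \<in> sets M" for k
  proof -
    have "{\<omega> \<in> space M. real (N \<omega>) = real k} \<in> sets M" using N by measurable
    then show ?thesis by simp
  qed
  have g: "g (N \<omega>) = (\<Sum>k\<le>n. g k * indicator {\<omega> \<in> space M. N \<omega> = k} \<omega>)" if "\<omega> \<in> space M" for \<omega>
  proof -
    have "(\<Sum>k\<le>n. g k * indicator {\<omega> \<in> space M. N \<omega> = k} \<omega>) = (\<Sum>k\<le>n. if k = N \<omega> then g k else 0)"
      using that by (intro sum.cong) auto
    then show ?thesis using n[OF that] by simp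
  qed
  have i: "integrable M (\<lambda>\<omega>. g k * indicator {\<omega> \<in> space M. N \<omega> = k} \<omega>)" for k
    using s by (intro integrable_mult_right integrable_real_indicator) (simp_all add: emeasure_finite less_top[symmetric])
  then have "integrable M (\<lambda>\<omega>. \<Sum>k\<le>n. g k * indicator {\<omega> \<in> space M. N \<omega> = k} \<omega>)"
    by (rule Bochner_Integration.integrable_sum)
  then show "integrable M (\<lambda>\<omega>. g (N \<omega>))" using g by (simp cong: Bochner_Integration.integrable_cong)
  have "(LINT \<omega>|M. g (N \<omega>)) = (LINT \<omega>|M. (\<Sum>k\<le>n. g k * indicator {\<omega> \<in> space M. N \<omega> = k} \<omega>))"
    using g by (rule Bochner_Integration.integral_cong[OF refl])
  also have "\<dots> = (\<Sum>k\<le>n. g k * measure M {\<omega> \<in> space M. N \<omega> = k})"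
    by (subst Bochner_Integration.integral_sum) (use i s in \<open>auto simp: Int_absorb2 sets.sets_into_space\<close>)
  finally show "(LINT \<omega>|M. g (N \<omega>)) = (\<Sum>k\<le>n. g k * measure M {\<omega> \<in> space M. N \<omega> = k})" .
qed

text \<open>Both generating functions are polynomials in \<open>1 + s\<close> whose coefficients are
  the point masses. Agreement for infinitely many \<open>s\<close> gives equal distributions and so
  equal means, without differentiation under the integral.\<close>

lemma integral_nat_eq_if_generating_functions_eq:
  assumes M: "finite_measure M" "(\<lambda>\<omega>. real (N \<omega>)) \<in> borel_measurable M" "\<And>\<omega>. \<omega> \<in> space M \<Longrightarrow> N \<omega> \<le> n"
    and M': "finite_measure M'" "(\<lambda>\<omega>. real (N' \<omega>)) \<in> borel_measurable M'" "\<And>\<omega>. \<omega> \<in> space M' \<Longrightarrow> N' \<omega> \<le> n"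
    and eq: "\<And>s. s \<ge> 0 \<Longrightarrow> (\<integral>\<^sup>+ \<omega>. ennreal ((1 + s) ^ N \<omega>) \<partial>M) = (\<integral>\<^sup>+ \<omega>. ennreal ((1 + s) ^ N' \<omega>) \<partial>M')"
  shows "(LINT \<omega>|M. real (N \<omega>)) = (LINT \<omega>|M'. real (N' \<omega>))"
proof -
  let ?m = "\<lambda>k. measure M {\<omega> \<in> space M. N \<omega> = k}" and ?m' = "\<lambda>k. measure M' {\<omega> \<in> space M'. N' \<omega> = k}"
  note I = finite_measure.integral_bounded_nat[OF M] and I' = finite_measure.integral_bounded_nat[OF M']
  define p where "p = (\<Sum>k\<le>n. Polynomial.monom (?m k - ?m' k) k)"
  have "poly p t = 0" if "t \<ge> 1" for t
  proof -
    have "ennreal (LINT \<omega>|M. t ^ N \<omega>) = ennreal (LINT \<omega>|M'. t ^ N' \<omega>)"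
      using eq[of "t - 1"] that I(1)[of "(^) t"] I'(1)[of "(^) t"] by (simp add: nn_integral_eq_integral)
    then have "(LINT \<omega>|M. t ^ N \<omega>) = (LINT \<omega>|M'. t ^ N' \<omega>)"
      using that by (subst (asm) ennreal_inj) (auto intro!: integral_nonneg_AE)
    then have "(\<Sum>k\<le>n. t ^ k * ?m k) = (\<Sum>k\<le>n. t ^ k * ?m' k)"
      by (simp only: I(2)[of "(^) t"] I'(2)[of "(^) t"])
    then show ?thesis
      by (simp add: p_def poly_sum poly_monom algebra_simps sum_subtractf)
  qed
  then have "{1..} \<subseteq> {t. poly p t = 0}" by auto
  then have "infinite {t. poly p t = 0}" using infinite_Ici finite_subset by blast
  then have "p = 0" using poly_roots_finite by blast
  moreover have "Polynomial.coeff p k = ?m k - ?m' k" if "k \<le> n" for k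
    using that by (simp add: p_def coeff_sum coeff_monom if_distrib cong: if_cong)
  ultimately have "?m k = ?m' k" if "k \<le> n" for k using that by simp
  then have "(\<Sum>k\<le>n. real k * ?m k) = (\<Sum>k\<le>n. real k * ?m' k)"
    by (intro sum.cong refl) simp
  then show ?thesis by (simp only: I(2)[of real] I'(2)[of real])
qed

text \<open>Every value of \<open>hermitian_of\<close> is Hermitian. Spectral identities can
  therefore be used under integrals over the space of all complex matrices.\<close>

lemma AE_hermitian_lborel: "AE B in hermitian_lborel. B \<in> herm_on UNIV"
proof -
  have "hermitian_of X \<in> herm_on UNIV" for X :: "real^'n^'n"
    by (simp add: herm_on_def supported_def hermitian_def hermitian_of_def complex_eq_iff field_simps)
  moreover have "hermitian_of \<in> measurable lborel borel" using borel_measurable_hermitian_of by simp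
  ultimately show ?thesis
    unfolding hermitian_lborel_def by (subst AE_distr_iff) auto
qed

lemma spec_prod_eigenvalues:
  fixes B :: "complex^'n^'n"
  assumes "hermitian B"
  shows "spec_prod UNIV u B = (\<Prod>i<CARD('n). u (eigenvalues B ! i))"
  using assms by (simp add: spec_prod_def eigval_def herm_on_def supported_def eigenvalues_eq)

lemma spec_prod_count:
  fixes B :: "complex^'n^'n"
  assumes "hermitian B" "s \<ge> 0"
  shows "spec_prod UNIV (\<lambda>y. ennreal (if y \<ge> b then 1 + s else 1)) B =
    ennreal ((1 + s) ^ size (filter_mset (\<lambda>l. l \<ge> b) (spectrum_on UNIV B)))"
proof -
  have "B \<in> herm_on UNIV" using assms by (simp add: herm_on_def supported_def)
  moreover have "(\<Prod>y\<in>#X. ennreal (if y \<ge> b then 1 + s else 1)) = ennreal ((1 + s) ^ size (filter_mset (\<lambda>l. l \<ge> b) X))" for X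
    using assms(2) by (induction X) (auto simp: ennreal_mult'')
  ultimately show ?thesis by (simp add: spec_prod_eq)
qed

lemma eigenvalue_integral_count:
  fixes w :: "real \<Rightarrow> real"
  assumes w: "\<And>y. w y \<ge> 0" and s: "s \<ge> 0"
  shows "eigenvalue_integral (UNIV :: 'n::finite set) (\<lambda>y. ennreal (w y) * ennreal (if y \<ge> b then 1 + s else 1)) =
    (\<integral>\<^sup>+ x. ennreal (discriminant_on UNIV x * (\<Prod>i\<in>UNIV. w (x i))) * ennreal ((1 + s) ^ card {i. x i \<ge> b}) \<partial>lborel_on (UNIV :: 'n set))"
proof -
  have "(\<Prod>i\<in>UNIV. ennreal (w (x i)) * ennreal (if x i \<ge> b then 1 + s else 1)) =
      ennreal (\<Prod>i\<in>UNIV. w (x i)) * ennreal ((1 + s) ^ card {i. x i \<ge> b})" for x :: "'n \<Rightarrow> real"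
  proof -
    have "(\<Prod>i\<in>UNIV. if x i \<ge> b then 1 + s else 1) = (1 + s) ^ card {i. x i \<ge> b}"
      by (simp add: prod.If_cases)
    then show ?thesis using w s by (simp add: prod.distrib prod_ennreal)
  qed
  then show ?thesis
    unfolding eigenvalue_integral_def using w by (simp add: ennreal_mult discriminant_on_nonneg prod_nonneg mult.assoc)
qed

theorem theorem3p12:
  fixes w :: "real \<Rightarrow> real" and \<phi> :: "nat \<Rightarrow> real poly" and h :: "nat \<Rightarrow> real"
    and P :: "'a measure" and A :: "'a \<Rightarrow> complex^'n^'n" and c x :: real
  assumes "weight_function w"
    and "monic_orthogonal_polynomials w \<phi> h"
    and "prob_space P"
    and "\<And>\<omega>. \<omega> \<in> space P \<Longrightarrow> hermitian (A \<omega>)"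
    and "distributed P hermitian_lborel A
           (\<lambda>B. ennreal (c * (\<Prod>i<CARD('n). w (eigenvalues B ! i))))"
  defines "\<chi>M \<equiv> \<lambda>\<omega>. real_of_int (euler_characteristic (top_of_set (excursion_set (A \<omega>) x)))"
    and "g \<equiv> \<lambda>t. poly (phi_hat \<phi> (CARD('n) - 1)) t * w t"
  shows "integrable P \<chi>M \<and> set_integrable lborel {x..} g \<and>
         prob_space.expectation P \<chi>M = 1 / h (CARD('n) - 1) * (LBINT t:{x..}. g t)"
proof -
  interpret orthogonal_polynomials w \<phi> h using assms(1,2) by unfold_locales
  interpret P: prob_space P by (rule assms(3))
  let ?L = "lborel_on (UNIV :: 'n set)"
  let ?H = "hermitian_lborel :: (complex^'n^'n) measure"
  let ?n = "CARD('n)"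
  let ?u = "\<lambda>y. ennreal (w y)"
  define N where "N B = size (filter_mset (\<lambda>l. l \<ge> x) (spectrum_on UNIV B))" for B :: "complex^'n^'n"
  define K where "K y = card {i. y i \<ge> x}" for y :: "'n \<Rightarrow> real"
  define d where "d y = discriminant_on UNIV y * (\<Prod>i\<in>UNIV. w (y i))" for y :: "'n \<Rightarrow> real"
  have A[measurable]: "A \<in> measurable P borel"
    using distributed_measurable[OF assms(5)] by (simp add: hermitian_lborel_def)
  have herm: "A \<omega> \<in> herm_on UNIV" if "\<omega> \<in> space P" for \<omega>
    using assms(4)[OF that] by (simp add: herm_on_def supported_def)
  have "A \<in> measurable P (restrict_space borel (herm_on UNIV))"
    by (rule measurable_restrict_space2) (auto simp: herm)
  then have N_meas: "(\<lambda>\<omega>. real (N (A \<omega>))) \<in> borel_measurable P"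
    unfolding N_def using borel_measurable_count_spectrum measurable_compose by blast
  have N_le: "N (A \<omega>) \<le> ?n" if "\<omega> \<in> space P" for \<omega>
    unfolding N_def using size_filter_mset_lesseq[of _ "spectrum_on UNIV (A \<omega>)"] size_spectrum_herm_on[OF herm[OF that]] by simp
  have \<chi>: "\<chi>M \<omega> = real (N (A \<omega>))" if "\<omega> \<in> space P" for \<omega>
    by (simp add: \<chi>M_def euler_characteristic_excursion_set[OF assms(4)[OF that]] N_def)
  obtain C where C: "\<And>u. u \<in> borel_measurable borel \<Longrightarrow>
      (\<integral>\<^sup>+ B. spec_prod (UNIV :: 'n set) u B \<partial>?H) = C * eigenvalue_integral (UNIV :: 'n set) u"
    using nn_integral_hermitian_spec_prod by blast
  have d_nonneg: "d y \<ge> 0" for y by (simp add: d_def discriminant_on_nonneg prod_nonneg w_nonneg)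
  have comp: "(\<lambda>y. y i) \<in> borel_measurable ?L" for i
    using measurable_component_singleton[of i UNIV "\<lambda>_. lborel"] by simp
  have d_meas[measurable]: "d \<in> borel_measurable ?L"
    unfolding d_def using borel_measurable_discriminant_on[of UNIV UNIV] measurable_compose[OF comp w_measurable]
    by (intro borel_measurable_times borel_measurable_prod) auto
  have K_sum: "real (K y) = (\<Sum>k\<in>UNIV. indicator {x..} (y k))" for y
    by (simp add: K_def indicator_def sum.If_cases)
  have K_meas[measurable]: "(\<lambda>y. real (K y)) \<in> borel_measurable ?L"
    unfolding K_sum by (intro borel_measurable_sum measurable_compose[OF comp]) simp
  have gen: "(\<integral>\<^sup>+ \<omega>. ennreal ((1 + s) ^ N (A \<omega>)) \<partial>P) =
      (ennreal c * C) * (\<integral>\<^sup>+ y. ennreal (d y) * ennreal ((1 + s) ^ K y) \<partial>?L)" if s: "s \<ge> 0" for s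
  proof -
    define a where "a y = ennreal (if y \<ge> x then 1 + s else 1)" for y
    have a[measurable]: "a \<in> borel_measurable borel" unfolding a_def by measurable
    have "(\<integral>\<^sup>+ \<omega>. ennreal ((1 + s) ^ N (A \<omega>)) \<partial>P) = (\<integral>\<^sup>+ \<omega>. spec_prod UNIV a (A \<omega>) \<partial>P)"
      unfolding N_def a_def using s assms(4) by (intro nn_integral_cong) (simp add: spec_prod_count)
    also have "\<dots> = (\<integral>\<^sup>+ B. ennreal (c * (\<Prod>i<?n. w (eigenvalues B ! i))) * spec_prod UNIV a B \<partial>?H)"
      by (rule distributed_nn_integral[OF assms(5), symmetric]) (simp add: hermitian_lborel_def)
    also have "\<dots> = (\<integral>\<^sup>+ B. ennreal c * spec_prod UNIV (\<lambda>y. ?u y * a y) B \<partial>?H)"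
    proof (rule nn_integral_cong_AE, rule AE_mp[OF AE_hermitian_lborel], rule AE_I2, rule impI)
      fix B :: "complex^'n^'n" assume B: "B \<in> herm_on UNIV"
      have "ennreal (\<Prod>i<?n. w (eigenvalues B ! i)) = spec_prod UNIV ?u B"
        using B by (simp add: spec_prod_eigenvalues herm_on_def prod_ennreal w_nonneg)
      then show "ennreal (c * (\<Prod>i<?n. w (eigenvalues B ! i))) * spec_prod UNIV a B = ennreal c * spec_prod UNIV (\<lambda>y. ?u y * a y) B"
        by (simp add: ennreal_mult'' prod_nonneg w_nonneg spec_prod_def prod.distrib mult.assoc)
    qed
    also have "\<dots> = ennreal c * (C * eigenvalue_integral (UNIV :: 'n set) (\<lambda>y. ?u y * a y))"
    proof -
      have "spec_prod UNIV (\<lambda>y. ?u y * a y) \<in> borel_measurable ?H" by (simp add: hermitian_lborel_def)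
      then show ?thesis by (simp add: nn_integral_cmult C)
    qed
    finally show ?thesis
      unfolding a_def eigenvalue_integral_count[OF w_nonneg s] by (simp add: d_def K_def mult.assoc)
  qed
  obtain e :: "'n \<Rightarrow> nat" where e: "bij_betw e UNIV {..<?n}"
    using ex_bij_betw_finite_nat[OF finite[of "UNIV :: 'n set"]] by (auto simp: atLeast0LessThan)
  define Z where "Z = (\<Prod>i\<in>UNIV. h (e i)) * fact ?n"
  have Z: "Z > 0" by (simp add: Z_def prod_pos h_pos)
  have d_int: "integrable ?L d" and d_Z: "integral\<^sup>L ?L d = Z"
    using discriminant_norm[OF e] by (simp_all add: d_def[abs_def] Z_def)
  have "(\<integral>\<^sup>+ y. ennreal (d y) \<partial>?L) = ennreal Z"
    using d_int d_nonneg by (simp add: nn_integral_eq_integral d_Z)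
  then have "ennreal c * C * ennreal Z = 1"
    using gen[of 0] P.emeasure_space_1 by simp
  \<comment> \<open>At \<open>s = 0\<close> the generating function is the total mass 1. This fixes
    the product of the two unknown constants, and with it its finiteness.\<close>
  then have cC: "ennreal c * C = ennreal (1 / Z)"
    using Z by (metis ennreal_1 ennreal_eq_0_iff ennreal_mult_cancel_left ennreal_neq_top ennreal_mult' less_imp_le mult.commute nonzero_eq_divide_eq not_le zero_le_divide_1_iff)
  \<comment> \<open>The symmetric law of the eigenvalues. It is compared with \<open>P\<close> only
    through the distribution of the count.\<close>
  define M where "M = density ?L (\<lambda>y. ennreal (d y / Z))"
  have M_int: "(\<integral>\<^sup>+ y. f y \<partial>M) = (ennreal c * C) * (\<integral>\<^sup>+ y. ennreal (d y) * f y \<partial>?L)"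
    if [measurable]: "f \<in> borel_measurable ?L" for f
  proof -
    have "(\<integral>\<^sup>+ y. f y \<partial>M) = (\<integral>\<^sup>+ y. ennreal (1 / Z) * (ennreal (d y) * f y) \<partial>?L)"
      unfolding M_def using Z by (subst nn_integral_density) (auto simp: mult.assoc[symmetric] ennreal_mult[symmetric] d_nonneg)
    then show ?thesis unfolding cC by (simp add: nn_integral_cmult)
  qed
  have M_fin: "finite_measure M"
  proof (rule finite_measureI)
    have "emeasure M (space M) = (\<integral>\<^sup>+ y. 1 \<partial>M)" by simp
    also have "\<dots> = 1" using M_int[of "\<lambda>_. 1"] gen[of 0] P.emeasure_space_1 by simp
    finally show "emeasure M (space M) \<noteq> \<infinity>" by simp
  qed
  have "(LINT \<omega>|P. real (N (A \<omega>))) = (LINT y|M. real (K y))"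
  proof (rule integral_nat_eq_if_generating_functions_eq)
    show "K y \<le> ?n" for y unfolding K_def by (rule card_mono) auto
    show "(\<lambda>y. real (K y)) \<in> borel_measurable M" by (simp add: M_def)
    fix s :: real assume s: "s \<ge> 0"
    \<comment> \<open>The real exponent matches \<open>K_meas\<close>, which speaks of the count as
      a real number.\<close>
    have "(\<lambda>y. ennreal ((1 + s) ^ K y)) = (\<lambda>y. ennreal ((1 + s) powr real (K y)))"
      using s by (simp add: powr_realpow)
    then have "(\<lambda>y. ennreal ((1 + s) ^ K y)) \<in> borel_measurable ?L" by simp
    then show "(\<integral>\<^sup>+ \<omega>. ennreal ((1 + s) ^ N (A \<omega>)) \<partial>P) = (\<integral>\<^sup>+ y. ennreal ((1 + s) ^ K y) \<partial>M)"
      by (simp add: gen[OF s] M_int)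
  qed (use N_meas N_le M_fin P.finite_measure_axioms in auto)
  also have "\<dots> = (LINT y|?L. (\<Sum>k\<in>UNIV. indicator {x..} (y k)) * d y) / Z"
    unfolding M_def using Z d_nonneg
    by (subst integral_density) (auto simp: K_sum[symmetric] mult.commute)
  also have "\<dots> = (\<Sum>j<?n. (LBINT t. indicator {x..} t * (poly (\<phi> j) t)\<^sup>2 * w t) / h j)"
  proof -
    have "(LINT y|?L. (\<Sum>k\<in>UNIV. indicator {x..} (y k)) * d y) =
        Z * (\<Sum>j<?n. (LBINT t. indicator {x..} t * (poly (\<phi> j) t)\<^sup>2 * w t) / h j)"
      using discriminant_linear_statistic[OF e, of "indicator {x..}"] by (simp add: d_def Z_def)
    then show ?thesis using Z by simp
  qed
  also have "\<dots> = (LBINT t. (\<Sum>j<?n. indicator {x..} t * (poly (\<phi> j) t)\<^sup>2 * w t / h j))"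
  proof -
    have "integrable lborel (\<lambda>t. indicator {x..} t *\<^sub>R (poly (\<phi> j) t * poly (\<phi> j) t * w t))" for j
      by (intro integrable_mult_indicator integrable_ip) simp
    then show ?thesis
      by (subst Bochner_Integration.integral_sum) (auto simp: power2_eq_square mult.assoc)
  qed
  also have "\<dots> = (LBINT t. 1 / h (?n - 1) * (indicator {x..} t *\<^sub>R g t))"
  proof (rule Bochner_Integration.integral_cong[OF refl])
    fix t
    \<comment> \<open>The index type is nonempty, so \<open>?n - 1\<close> is a true
      predecessor.\<close>
    have "{..?n - 1} = {..<?n}" using lessThan_Suc_atMost[of "?n - 1"] by simp
    then have "(\<Sum>j<?n. (poly (\<phi> j) t)\<^sup>2 / h j) = poly (phi_hat \<phi> (?n - 1)) t / h (?n - 1)"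
      using christoffel_darboux[of "?n - 1" t] by simp
    moreover have "(\<Sum>j<?n. indicator {x..} t * (poly (\<phi> j) t)\<^sup>2 * w t / h j) =
        indicator {x..} t * w t * (\<Sum>j<?n. (poly (\<phi> j) t)\<^sup>2 / h j)"
      by (simp add: sum_distrib_left mult_ac)
    ultimately show "(\<Sum>j<?n. indicator {x..} t * (poly (\<phi> j) t)\<^sup>2 * w t / h j) = 1 / h (?n - 1) * (indicator {x..} t *\<^sub>R g t)"
      by (simp add: g_def)
  qed
  also have "\<dots> = 1 / h (?n - 1) * (LBINT t:{x..}. g t)"
    by (simp only: Bochner_Integration.integral_mult_right_zero set_lebesgue_integral_def)
  finally have "(LINT \<omega>|P. real (N (A \<omega>))) = 1 / h (?n - 1) * (LBINT t:{x..}. g t)" .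
  moreover have "integrable P (\<lambda>\<omega>. real (N (A \<omega>)))"
    by (rule P.integral_bounded_nat(1)[OF N_meas N_le])
  moreover have "set_integrable lborel {x..} g"
    unfolding set_integrable_def g_def by (intro integrable_mult_indicator integrable_poly) simp
  ultimately show ?thesis
    using \<chi> by (simp cong: Bochner_Integration.integrable_cong Bochner_Integration.integral_cong)
qed

end
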